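(* Let $\Omega=\{\bm q\in\mathbb R^3:|\bm q|\le 1\}$, let $b>0$, $\mathrm{De}>0$, let $\bm K\in\mathbb R^{3\times3}$ be a constant matrix with $\mathrm{tr}(\bm K)=0$, let $\Delta t>0$, and let $s$ satisfy $1<s\le b/2$. If $s<b/2$, assume in addition that $$\frac{3}{2\Delta t}>\frac{b-2s}{\mathrm{De}}\,\gamma(s),\qquad \gamma(s)=\frac34\left(1+\frac{s-1}{3}+\frac{3}{4(s-1)}\right).$$ Then for any given $h^n,h^{n-1}\in L^2_s(\Omega)$ there exists a unique $h^{n+1}\in H^1_s(\Omega)$ such that for all $g\in H^1_s(\Omega)$ $$\frac{1}{2\Delta t}\left(3h^{n+1}-4h^{n}+h^{n-1},g\right)_s+\frac{1}{\mathrm{De}}\left(\nabla h^{n+1},\nabla g\right)_s+\frac{b-2s}{\mathrm{De}}\left(h^{n+1},\frac{\bm q\cdot\nabla g}{1-|\bm q|^2}\right)_s=\left(2h^{n}-h^{n-1},(\bm K\bm q)\cdot\nabla g\right)_s .$$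
   Context: For a real parameter $\alpha$, the weighted inner product and norm on $\Omega$ are $(u,v)_\alpha=\int_\Omega u\,v\,(1-|\bm q|^2)^\alpha\,\mathrm d\bm q$ and $\|u\|_\alpha^2=(u,u)_\alpha$ (for vector-valued functions the integrand is the Euclidean dot product). $L^2_s(\Omega)$ is the space of measurable $u$ with $\|u\|_s<\infty$, and $H^1_s(\Omega)$ is the weighted Sobolev space of $u\in L^2_s(\Omega)$ with weak gradient satisfying $\|\nabla u\|_s<\infty$, normed by $(\|u\|_s^2+\|\nabla u\|_s^2)^{1/2}$. The displayed equation is a semi-implicit BDF2 time step (with explicit extrapolation of the convection term) for the weighted weak form of the FENE Fokker–Planck equation, where the density is written $f=(1-|\bm q|^2)^s h$. *)

theory Defs
  imports "HOL-Analysis.Analysis"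
begin

definition Omega :: "(real^3) set" where
  "Omega = cball 0 1"

definition wt :: "real \<Rightarrow> real^3 \<Rightarrow> real" where
  "wt \<alpha> q = (1 - norm q ^ 2) powr \<alpha>"

definition winner :: "real \<Rightarrow> (real^3 \<Rightarrow> real) \<Rightarrow> (real^3 \<Rightarrow> real) \<Rightarrow> real" where
  "winner \<alpha> u v = (LINT q : Omega | lebesgue. u q * v q * wt \<alpha> q)"

definition winnerv :: "real \<Rightarrow> (real^3 \<Rightarrow> real^3) \<Rightarrow> (real^3 \<Rightarrow> real^3) \<Rightarrow> real" where
  "winnerv \<alpha> u v = (LINT q : Omega | lebesgue. (u q \<bullet> v q) * wt \<alpha> q)"

definition L2w :: "real \<Rightarrow> (real^3 \<Rightarrow> real) \<Rightarrow> bool" where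
  "L2w \<alpha> u \<longleftrightarrow> u \<in> borel_measurable lebesgue \<and>
     (\<integral>\<^sup>+ q. indicator Omega q * ennreal (u q ^ 2 * wt \<alpha> q) \<partial>lebesgue) < \<infinity>"

definition L2wv :: "real \<Rightarrow> (real^3 \<Rightarrow> real^3) \<Rightarrow> bool" where
  "L2wv \<alpha> G \<longleftrightarrow> G \<in> borel_measurable lebesgue \<and>
     (\<integral>\<^sup>+ q. indicator Omega q * ennreal (norm (G q) ^ 2 * wt \<alpha> q) \<partial>lebesgue) < \<infinity>"

coinductive smooth_fun :: "(real^3 \<Rightarrow> real) \<Rightarrow> bool" where
  "(\<forall>x. f differentiable (at x)) \<Longrightarrow>
   (\<forall>v. smooth_fun (\<lambda>x. frechet_derivative f (at x) v)) \<Longrightarrow> smooth_fun f"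

definition test_fun :: "(real^3 \<Rightarrow> real) \<Rightarrow> bool" where
  "test_fun \<phi> \<longleftrightarrow> smooth_fun \<phi> \<and>
     (\<exists>K. compact K \<and> K \<subseteq> ball 0 1 \<and> (\<forall>x. x \<notin> K \<longrightarrow> \<phi> x = 0))"

definition loc_int :: "(real^3 \<Rightarrow> real) \<Rightarrow> bool" where
  "loc_int u \<longleftrightarrow> (\<forall>K. compact K \<and> K \<subseteq> ball 0 1 \<longrightarrow> set_integrable lebesgue K u)"

definition weak_grad :: "(real^3 \<Rightarrow> real) \<Rightarrow> (real^3 \<Rightarrow> real^3) \<Rightarrow> bool" where
  "weak_grad u G \<longleftrightarrow> loc_int u \<and> (\<forall>i. loc_int (\<lambda>x. G x $ i)) \<and>
     (\<forall>\<phi> i. test_fun \<phi> \<longrightarrow>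
        (LINT x : ball 0 1 | lebesgue. u x * frechet_derivative \<phi> (at x) (axis i 1))
        = - (LINT x : ball 0 1 | lebesgue. G x $ i * \<phi> x))"

definition H1w :: "real \<Rightarrow> (real^3 \<Rightarrow> real) \<Rightarrow> (real^3 \<Rightarrow> real^3) \<Rightarrow> bool" where
  "H1w \<alpha> u G \<longleftrightarrow> L2w \<alpha> u \<and> weak_grad u G \<and> L2wv \<alpha> G"

definition gamma_fun :: "real \<Rightarrow> real" where
  "gamma_fun s = 3/4 * (1 + (s - 1)/3 + 3 / (4 * (s - 1)))"

text \<open>The BDF2 weak equation, with \<nabla>h = G and \<nabla>g = Gg.\<close>
definition bdf2_eq :: "real \<Rightarrow> real \<Rightarrow> real \<Rightarrow> real \<Rightarrow> real^3^3 \<Rightarrow>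
    (real^3 \<Rightarrow> real) \<Rightarrow> (real^3 \<Rightarrow> real) \<Rightarrow> (real^3 \<Rightarrow> real) \<Rightarrow> (real^3 \<Rightarrow> real^3) \<Rightarrow>
    (real^3 \<Rightarrow> real) \<Rightarrow> (real^3 \<Rightarrow> real^3) \<Rightarrow> bool" where
  "bdf2_eq b De dt s K hn hn1 h G g Gg \<longleftrightarrow>
     1 / (2 * dt) * winner s (\<lambda>q. 3 * h q - 4 * hn q + hn1 q) g
     + 1 / De * winnerv s G Gg
     + (b - 2 * s) / De * winner s h (\<lambda>q. (q \<bullet> Gg q) / (1 - norm q ^ 2))
     = winner s (\<lambda>q. 2 * hn q - hn1 q) (\<lambda>q. (K *v q) \<bullet> Gg q)"

end

theory Submission
  imports Defs
begin

text \<open>Lax--Milgram in \<open>H\<^sup>1\<^sub>s\<close>. With \<open>w = 1 - |q|\<^sup>2\<close>, integration by parts turns the convection term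
  \<open>(h, q \<bullet> \<nabla>h / w)\<^sub>s\<close> into the integral of \<open>h\<^sup>2 w powr s\<close> times \<open>(s - 1) x\<^sup>2 - (s + 1/2) x\<close> with \<open>x = 1 / w\<close>, and the
  minimum of this quadratic is exactly \<open>- \<gamma>(s)\<close>. The same computation gives the Hardy inequality that bounds
  \<open>h / w\<close>, hence the convection form, by the \<open>H\<^sup>1\<^sub>s\<close> norm. Only the radial derivative enters, so for non-smooth h the
  integration by parts is carried out with dilations \<open>h(q / t)\<close>, \<open>t \<rightarrow> 1\<close>, instead of mollifiers; only the inequality that
  is needed, and not the identity, is proved.\<close>

section \<open>Riesz representation and Lax--Milgram for semi-inner products\<close>

text \<open>The obstacle is the factor 1/w: nothing in the \<open>H1\<close> norm visibly controls
  h/w, so at the start not even integrability of the convection term is clear. The quadratic in x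
  comes from div (q w^(s-1)) = 3 w^(s-1) - 2 (s-1) |q|^2 w^(s-2) with |q|^2 = 1 - w. Since s > 1 its
  leading coefficient is positive. Keeping that term on the left gives the Hardy bound with constant
  (2s+3) / (2(s-1)); completing the square at x = (2s+1) / (4(s-1)) gives the minimum -(2s+1)^2 /
  (16(s-1)), which is minus gamma. Both uses need the integration by parts in the same direction,
  and this is the direction that a convexity estimate for dilation quotients delivers. The estimate
  is available only with a cutoff near the sphere. The Hardy constant does not depend on the cutoff,
  so Fatou gives h/w in \<open>L2\<close>; its square is then the majorant with which the cutoff is
  removed from the sharp lower bound. That lower bound spends nothing of the gradient term, which is
  why the restriction on the time step concerns the zero-order term alone.\<close>

text \<open>The operation \<open>comb x c y\<close> stands for x + c y; only bilinearity of the forms with respect to it is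
  assumed, so that functions identified almost everywhere need not be quotiented.\<close>

locale semi_hilbert =
  fixes V :: "'a set" and comb :: "'a \<Rightarrow> real \<Rightarrow> 'a \<Rightarrow> 'a" and ip :: "'a \<Rightarrow> 'a \<Rightarrow> real"
  assumes nonempty: "V \<noteq> {}"
    and comb_in: "\<And>x y c. x \<in> V \<Longrightarrow> y \<in> V \<Longrightarrow> comb x c y \<in> V"
    and ip_comb: "\<And>x y z c. x \<in> V \<Longrightarrow> y \<in> V \<Longrightarrow> z \<in> V \<Longrightarrow> ip (comb x c y) z = ip x z + c * ip y z"
    and ip_sym: "\<And>x y. x \<in> V \<Longrightarrow> y \<in> V \<Longrightarrow> ip x y = ip y x"
    and ip_nonneg: "\<And>x. x \<in> V \<Longrightarrow> 0 \<le> ip x x"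
    and complete: "\<And>X. (\<And>n::nat. X n \<in> V) \<Longrightarrow>
        (\<And>e. 0 < e \<Longrightarrow> \<exists>N. \<forall>m\<ge>N. \<forall>n\<ge>N. ip (comb (X m) (-1) (X n)) (comb (X m) (-1) (X n)) < e) \<Longrightarrow>
        \<exists>x\<in>V. (\<lambda>n. ip (comb (X n) (-1) x) (comb (X n) (-1) x)) \<longlonglongrightarrow> 0"
begin

lemma ip_comb_right: "x \<in> V \<Longrightarrow> y \<in> V \<Longrightarrow> z \<in> V \<Longrightarrow> ip z (comb x c y) = ip z x + c * ip z y"
  using ip_comb[of x y z c] ip_sym comb_in by metis

lemma ip_comb_self:
  assumes "x \<in> V" "y \<in> V"
  shows "ip (comb x c y) (comb x c y) = ip x x + 2 * c * ip x y + c\<^sup>2 * ip y y"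
  using assms
  by (simp add: ip_comb ip_comb_right comb_in ip_sym[of y x] power2_eq_square algebra_simps)

text \<open>The form may vanish on nonzero elements, so a null \<open>y\<close> is a separate case:
  the quadratic in \<open>c\<close> is then affine, and the chosen \<open>c\<close> would give it
  the value -1 if \<open>ip x y\<close> were not 0. Otherwise \<open>c\<close> is the minimiser of
  the quadratic.\<close>

lemma cauchy_schwarz:
  assumes x: "x \<in> V" and y: "y \<in> V"
  shows "(ip x y)\<^sup>2 \<le> ip x x * ip y y"
proof -
  have *: "0 \<le> ip x x + 2 * c * ip x y + c\<^sup>2 * ip y y" for c
    using ip_nonneg[OF comb_in[OF x y]] ip_comb_self[OF x y] by metis
  show ?thesis
  proof (cases "ip y y = 0")
    case True
    have "ip x y = 0"
    proof (rule ccontr)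
      assume n: "ip x y \<noteq> 0"
      show False using *[of "- (ip x x + 1) / (2 * ip x y)"] True n by (simp add: field_simps)
    qed
    then show ?thesis using True by simp
  next
    case False
    then have p: "ip y y > 0" using ip_nonneg[OF y] by simp
    have "0 \<le> ip x x - (ip x y)\<^sup>2 / ip y y"
      using *[of "- ip x y / ip y y"] p by (simp add: field_simps power2_eq_square)
    then show ?thesis using p by (simp add: field_simps)
  qed
qed

text \<open>The representer is the minimiser of the energy \<open>J\<close>. Minimising sequences
  are Cauchy by the parallelogram identity, \<open>complete\<close> supplies the limit, and the
  first variation of \<open>J\<close> there is the claimed equation. No orthogonal decomposition is
  used, so null vectors need no quotient.\<close>

lemma riesz:
  fixes F :: "'a \<Rightarrow> real"
  assumes lin: "\<And>x y c. x \<in> V \<Longrightarrow> y \<in> V \<Longrightarrow> F (comb x c y) = F x + c * F y"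
    and bdd: "\<And>x. x \<in> V \<Longrightarrow> (F x)\<^sup>2 \<le> C * ip x x"
  shows "\<exists>x\<in>V. \<forall>g\<in>V. ip x g = F g"
proof -
  define J where "J x = ip x x - 2 * F x" for x
  \<comment> \<open>No sign of \<open>C\<close> is known, hence its absolute value; the bound is 2 F
    x <= 2 sqrt (|C| ip x x) <= |C| + ip x x.\<close>
  have J_lower: "- \<bar>C\<bar> \<le> J x" if x: "x \<in> V" for x
  proof -
    have a: "(F x)\<^sup>2 \<le> \<bar>C\<bar> * ip x x"
      using bdd[OF x] ip_nonneg[OF x] by (smt (verit) mult_right_mono)
    have "(2 * F x)\<^sup>2 \<le> (\<bar>C\<bar> + ip x x)\<^sup>2"
    proof -
      have "(\<bar>C\<bar> + ip x x)\<^sup>2 - 4 * (\<bar>C\<bar> * ip x x) = (\<bar>C\<bar> - ip x x)\<^sup>2"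
        by (simp add: power2_eq_square algebra_simps)
      then have "4 * (\<bar>C\<bar> * ip x x) \<le> (\<bar>C\<bar> + ip x x)\<^sup>2" by (smt (verit) zero_le_power2)
      then show ?thesis using a by (simp add: power_mult_distrib)
    qed
    then have "2 * F x \<le> \<bar>C\<bar> + ip x x" by (rule power2_le_imp_le) (use ip_nonneg[OF x] in simp)
    then show ?thesis by (simp add: J_def)
  qed
  define m where "m = (INF x\<in>V. J x)"
  have bb: "bdd_below (J ` V)" using J_lower by (auto intro!: bdd_belowI)
  have m_le: "m \<le> J x" if "x \<in> V" for x unfolding m_def using bb that by (rule cINF_lower)
  have "\<exists>x\<in>V. J x < m + 1 / real (Suc n)" for n
    using cINF_less_iff[OF nonempty bb, of "m + 1 / real (Suc n)"] unfolding m_def by simp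
  then obtain X where X: "\<And>n. X n \<in> V" "\<And>n. J (X n) < m + 1 / real (Suc n)" by metis
  have J_comb: "J (comb x c y) = J x + 2 * c * (ip x y - F y) + c\<^sup>2 * ip y y"
    if "x \<in> V" "y \<in> V" for x y c
    using that by (simp add: J_def ip_comb_self lin algebra_simps)
  \<comment> \<open>The midpoint of \<open>x\<close> and \<open>y\<close> is
    \<open>comb x (1/2) d\<close>. Twice its energy equals J x + J y - ip d d / 2 and is at least 2
    m.\<close>
  have par: "ip (comb y (-1) x) (comb y (-1) x) \<le> 2 * (J x - m) + 2 * (J y - m)"
    if x: "x \<in> V" and y: "y \<in> V" for x y
  proof -
    define d where "d = comb y (-1) x"
    have d: "d \<in> V" unfolding d_def using x y by (rule comb_in[rotated])
    have "m \<le> J (comb x (1/2) d)" using comb_in[OF x d] by (rule m_le)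
    moreover have "J (comb x (1/2) d) = J x + (ip x d - F d) + ip d d / 4"
      using J_comb[OF x d] by (simp add: power2_eq_square)
    moreover have "J y = J x + 2 * (ip x d - F d) + ip d d"
      using x y unfolding d_def
      by (simp add: J_def ip_comb ip_comb_right comb_in lin ip_sym[of y x] algebra_simps)
    ultimately have "ip d d \<le> 2 * (J x - m) + 2 * (J y - m)" by argo
    then show ?thesis unfolding d_def .
  qed
  have cau: "\<exists>N. \<forall>p\<ge>N. \<forall>n\<ge>N. ip (comb (X p) (-1) (X n)) (comb (X p) (-1) (X n)) < e" if e: "0 < e" for e
  proof -
    obtain N where N: "4 / e < real N" using reals_Archimedean2 by blast
    have small: "J (X n) - m < e / 4" if "n \<ge> N" for n
    proof -
      have "4 / e \<le> real (Suc n)" using N that by linarith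
      then have "1 / real (Suc n) \<le> e / 4"
        using e by (simp add: field_simps)
      then show ?thesis using X(2)[of n] by simp
    qed
    have "ip (comb (X p) (-1) (X n)) (comb (X p) (-1) (X n)) < e" if "p \<ge> N" "n \<ge> N" for p n
      using par[OF X(1)[of n] X(1)[of p]] small[OF that(1)] small[OF that(2)] by argo
    then show ?thesis by blast
  qed
  obtain x where x: "x \<in> V" and lim: "(\<lambda>n. ip (comb (X n) (-1) x) (comb (X n) (-1) x)) \<longlonglongrightarrow> 0"
    using complete[OF X(1) cau] by blast
  have "ip x g = F g" if g: "g \<in> V" for g
  proof -
    have ipl: "(\<lambda>n. ip (X n) g) \<longlonglongrightarrow> ip x g"
    proof -
      have "(\<lambda>n. (ip (X n) g - ip x g)\<^sup>2) \<longlonglongrightarrow> 0"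
      proof (rule tendsto_sandwich[OF _ _ tendsto_const])
        show "(\<lambda>n. ip (comb (X n) (-1) x) (comb (X n) (-1) x) * ip g g) \<longlonglongrightarrow> 0"
          using tendsto_mult_right[OF lim] by simp
        show "\<forall>\<^sub>F n in sequentially. (ip (X n) g - ip x g)\<^sup>2
            \<le> ip (comb (X n) (-1) x) (comb (X n) (-1) x) * ip g g"
          using cauchy_schwarz[OF comb_in[OF X(1) x, of _ "-1"] g] ip_comb[OF X(1) x g, of _ "-1"]
          by (intro always_eventually allI) simp
      qed auto
      then have "(\<lambda>n. sqrt ((ip (X n) g - ip x g)\<^sup>2)) \<longlonglongrightarrow> sqrt 0" by (rule tendsto_real_sqrt)
      then have "(\<lambda>n. \<bar>ip (X n) g - ip x g\<bar>) \<longlonglongrightarrow> 0" by simp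
      then show ?thesis by (simp add: LIM_zero_iff tendsto_rabs_zero_iff)
    qed
    \<comment> \<open>Limit of m <= J (X n + t g), where J (X n) exceeds m by less than 1 / Suc
      n.\<close>
    have q: "0 \<le> 2 * t * (ip x g - F g) + t\<^sup>2 * ip g g" for t
    proof (rule LIMSEQ_le_const)
      have "(\<lambda>n. 1 / real (Suc n) + 2 * t * (ip (X n) g - F g) + t\<^sup>2 * ip g g) \<longlonglongrightarrow>
          0 + 2 * t * (ip x g - F g) + t\<^sup>2 * ip g g"
        by (intro tendsto_intros ipl LIMSEQ_Suc lim_1_over_n)
      then show "(\<lambda>n. 1 / real (Suc n) + 2 * t * (ip (X n) g - F g) + t\<^sup>2 * ip g g) \<longlonglongrightarrow>
          2 * t * (ip x g - F g) + t\<^sup>2 * ip g g" by simp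
      show "\<exists>N. \<forall>n\<ge>N. 0 \<le> 1 / real (Suc n) + 2 * t * (ip (X n) g - F g) + t\<^sup>2 * ip g g"
        using m_le[OF comb_in[OF X(1) g]] X(2) J_comb[OF X(1) g] by (smt (verit))
    qed
    show ?thesis
    proof (rule ccontr)
      assume "ip x g \<noteq> F g"
      define a where "a = ip x g - F g"
      \<comment> \<open>The shift by 1 keeps the denominator of \<open>t\<close> positive when
        \<open>g\<close> is a null vector.\<close>
      define r where "r = ip g g + 1"
      define t where "t = - a / r"
      have a: "a \<noteq> 0" and p: "r \<ge> 1"
        using \<open>ip x g \<noteq> F g\<close> ip_nonneg[OF g] by (auto simp: a_def r_def)
      have "2 * t * a + t\<^sup>2 * ip g g = 2 * t * a + t\<^sup>2 * (r - 1)" by (simp add: r_def)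
      also have "\<dots> = - (a\<^sup>2 * (r + 1) / r\<^sup>2)"
        using p unfolding t_def by (simp add: field_simps power2_eq_square)
      also have "\<dots> < 0" using a p by simp
      finally show False using q[of t] by (simp add: a_def)
    qed
  qed
  then show ?thesis using x by blast
qed

text \<open>Coercivity makes (A x, A y), with A the Riesz operator of the form \<open>a\<close>, an equivalent inner product; its
  Riesz theorem yields x with A x - f orthogonal to the range of A, and testing with \<open>y = A x - f\<close> gives
  \<open>a y y = 0\<close>.\<close>

theorem lax_milgram:
  fixes a :: "'a \<Rightarrow> 'a \<Rightarrow> real" and F :: "'a \<Rightarrow> real"
  assumes a_left: "\<And>x y z c. x \<in> V \<Longrightarrow> y \<in> V \<Longrightarrow> z \<in> V \<Longrightarrow> a (comb x c y) z = a x z + c * a y z"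
    and a_right: "\<And>x y z c. x \<in> V \<Longrightarrow> y \<in> V \<Longrightarrow> z \<in> V \<Longrightarrow> a z (comb x c y) = a z x + c * a z y"
    and a_bdd: "\<And>x y. x \<in> V \<Longrightarrow> y \<in> V \<Longrightarrow> (a x y)\<^sup>2 \<le> C * ip x x * ip y y"
    and a_coer: "\<And>x. x \<in> V \<Longrightarrow> \<alpha> * ip x x \<le> a x x" and \<alpha>: "0 < \<alpha>"
    and lin: "\<And>x y c. x \<in> V \<Longrightarrow> y \<in> V \<Longrightarrow> F (comb x c y) = F x + c * F y"
    and bdd: "\<And>x. x \<in> V \<Longrightarrow> (F x)\<^sup>2 \<le> D * ip x x"
  shows "\<exists>x\<in>V. \<forall>g\<in>V. a x g = F g"
proof -
  have "\<exists>y\<in>V. \<forall>g\<in>V. ip y g = a x g" if x: "x \<in> V" for x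
    using a_right x a_bdd[OF x] by (intro riesz[where C = "C * ip x x"]) auto
  then obtain A where A: "\<And>x. x \<in> V \<Longrightarrow> A x \<in> V" "\<And>x g. x \<in> V \<Longrightarrow> g \<in> V \<Longrightarrow> ip (A x) g = a x g"
    by metis
  obtain f where f: "f \<in> V" "\<And>g. g \<in> V \<Longrightarrow> ip f g = F g" using riesz[OF lin bdd] by blast
  have lower: "\<alpha>\<^sup>2 * ip x x \<le> ip (A x) (A x)" if x: "x \<in> V" for x
  proof (cases "ip x x = 0")
    case True then show ?thesis using ip_nonneg[OF A(1)[OF x]] by simp
  next
    case False
    then have p: "ip x x > 0" using ip_nonneg[OF x] by simp
    have "\<alpha> * ip x x \<le> ip (A x) x" using a_coer[OF x] A(2)[OF x x] by simp
    then have "(\<alpha> * ip x x)\<^sup>2 \<le> (ip (A x) x)\<^sup>2" using p \<alpha> by (intro power_mono) auto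
    also have "\<dots> \<le> ip (A x) (A x) * ip x x" using A(1)[OF x] x by (rule cauchy_schwarz)
    finally have "(\<alpha>\<^sup>2 * ip x x) * ip x x \<le> ip (A x) (A x) * ip x x"
      by (simp add: power2_eq_square algebra_simps)
    then show ?thesis using p by simp
  qed
  have upper: "ip (A x) (A x) \<le> C * ip x x" if x: "x \<in> V" for x
  proof (cases "ip (A x) (A x) = 0")
    case True
    \<comment> \<open>Not immediate, since no sign of \<open>C\<close> is assumed: it follows from
      boundedness at the pair (x, x).\<close>
    have "0 \<le> C * ip x x"
    proof (cases "ip x x = 0")
      case False
      then have p: "ip x x > 0" using ip_nonneg[OF x] by simp
      have "0 \<le> (C * ip x x) * ip x x" using a_bdd[OF x x] by (smt (verit) zero_le_power2)
      then show ?thesis using p by (simp add: zero_le_mult_iff)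
    qed simp
    then show ?thesis using True by simp
  next
    case False
    then have p: "ip (A x) (A x) > 0" using ip_nonneg[OF A(1)[OF x]] by simp
    have "(ip (A x) (A x))\<^sup>2 \<le> C * ip x x * ip (A x) (A x)"
      using a_bdd[OF x A(1)[OF x]] A(2)[OF x A(1)[OF x]] by simp
    then show ?thesis using p by (simp add: power2_eq_square)
  qed
  interpret W: semi_hilbert V comb "\<lambda>x y. ip (A x) (A y)"
  proof
    show "V \<noteq> {}" by (rule nonempty)
    show "\<And>x y c. x \<in> V \<Longrightarrow> y \<in> V \<Longrightarrow> comb x c y \<in> V" by (rule comb_in)
    show "\<And>x y z c. x \<in> V \<Longrightarrow> y \<in> V \<Longrightarrow> z \<in> V \<Longrightarrow>
        ip (A (comb x c y)) (A z) = ip (A x) (A z) + c * ip (A y) (A z)"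
      by (simp add: A comb_in a_left)
    show "\<And>x y. x \<in> V \<Longrightarrow> y \<in> V \<Longrightarrow> ip (A x) (A y) = ip (A y) (A x)" using A ip_sym by blast
    show "\<And>x. x \<in> V \<Longrightarrow> 0 \<le> ip (A x) (A x)" using A ip_nonneg by blast
    fix X :: "nat \<Rightarrow> 'a"
    assume X: "\<And>n. X n \<in> V" and c: "\<And>e. 0 < e \<Longrightarrow> \<exists>N. \<forall>m\<ge>N. \<forall>n\<ge>N.
        ip (A (comb (X m) (-1) (X n))) (A (comb (X m) (-1) (X n))) < e"
    have "\<exists>N. \<forall>m\<ge>N. \<forall>n\<ge>N. ip (comb (X m) (-1) (X n)) (comb (X m) (-1) (X n)) < e" if e: "0 < e" for e
    proof -
      obtain N where N: "\<And>m n. m \<ge> N \<Longrightarrow> n \<ge> N \<Longrightarrow>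
          ip (A (comb (X m) (-1) (X n))) (A (comb (X m) (-1) (X n))) < \<alpha>\<^sup>2 * e"
        using c[of "\<alpha>\<^sup>2 * e"] e \<alpha> by auto
      have "ip (comb (X m) (-1) (X n)) (comb (X m) (-1) (X n)) < e" if mn: "m \<ge> N" "n \<ge> N" for m n
      proof -
        have "\<alpha>\<^sup>2 * ip (comb (X m) (-1) (X n)) (comb (X m) (-1) (X n)) < \<alpha>\<^sup>2 * e"
          using lower[OF comb_in[OF X X]] N[OF mn] by (rule le_less_trans)
        then show ?thesis using \<alpha> by simp
      qed
      then show ?thesis by blast
    qed
    \<comment> \<open>\<open>lower\<close> has carried the Cauchy property to the original form;
      \<open>upper\<close> carries the convergence back.\<close>
    from complete[OF X this] obtain x where x: "x \<in> V"
      and l: "(\<lambda>n. ip (comb (X n) (-1) x) (comb (X n) (-1) x)) \<longlonglongrightarrow> 0" by blast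
    have "(\<lambda>n. ip (A (comb (X n) (-1) x)) (A (comb (X n) (-1) x))) \<longlonglongrightarrow> 0"
    proof (rule tendsto_sandwich[OF _ _ tendsto_const])
      show "(\<lambda>n. C * ip (comb (X n) (-1) x) (comb (X n) (-1) x)) \<longlonglongrightarrow> 0"
        using tendsto_mult_left[OF l] by simp
    qed (use upper[OF comb_in[OF X x]] ip_nonneg[OF A(1)[OF comb_in[OF X x]]] in simp_all)
    then show "\<exists>x\<in>V. (\<lambda>n. ip (A (comb (X n) (-1) x)) (A (comb (X n) (-1) x))) \<longlonglongrightarrow> 0" using x by blast
  qed
  have "\<exists>x\<in>V. \<forall>g\<in>V. ip (A x) (A g) = ip f (A g)"
  proof (rule W.riesz)
    show "\<And>x y c. x \<in> V \<Longrightarrow> y \<in> V \<Longrightarrow> ip f (A (comb x c y)) = ip f (A x) + c * ip f (A y)"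
      using A f(1) ip_sym[OF f(1)] a_left comb_in by simp
    show "\<And>x. x \<in> V \<Longrightarrow> (ip f (A x))\<^sup>2 \<le> ip f f * ip (A x) (A x)"
      using A f(1) cauchy_schwarz by blast
  qed
  then obtain x where x: "x \<in> V" and xo: "\<And>g. g \<in> V \<Longrightarrow> ip (A x) (A g) = ip f (A g)" by blast
  define y where "y = comb (A x) (-1) f"
  have y: "y \<in> V" unfolding y_def using A(1)[OF x] f(1) by (rule comb_in)
  have "a y y = ip y (A y)" using A(2)[OF y y] ip_sym[OF A(1)[OF y] y] by simp
  also have "\<dots> = 0"
    using xo[OF y] ip_comb[OF A(1)[OF x] f(1) A(1)[OF y], of "-1"] unfolding y_def by simp
  finally have "ip y y = 0" using a_coer[OF y] \<alpha> ip_nonneg[OF y] by (smt (verit) mult_pos_pos)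
  have "a x g = F g" if g: "g \<in> V" for g
  proof -
    have "ip y g = 0" using cauchy_schwarz[OF y g] \<open>ip y y = 0\<close> by simp
    then have "ip (A x) g = ip f g"
      using ip_comb[OF A(1)[OF x] f(1) g, of "-1"] by (simp add: y_def)
    then show ?thesis using A(2)[OF x g] f(2)[OF g] by simp
  qed
  then show ?thesis using x by blast
qed

end

section \<open>Square-integrable functions\<close>

definition L2 :: "'a measure \<Rightarrow> ('a \<Rightarrow> 'b::euclidean_space) set" where
  "L2 M = {f \<in> borel_measurable M. integrable M (\<lambda>x. (norm (f x))\<^sup>2)}"

definition l2ip :: "'a measure \<Rightarrow> ('a \<Rightarrow> 'b::euclidean_space) \<Rightarrow> ('a \<Rightarrow> 'b) \<Rightarrow> real" where
  "l2ip M f g = (\<integral>x. f x \<bullet> g x \<partial>M)"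

definition lcomb :: "('a \<Rightarrow> 'b::real_vector) \<Rightarrow> real \<Rightarrow> ('a \<Rightarrow> 'b) \<Rightarrow> 'a \<Rightarrow> 'b" where
  "lcomb f c g = (\<lambda>x. f x + c *\<^sub>R g x)"

lemma L2_measurable [measurable_dest]: "f \<in> L2 M \<Longrightarrow> f \<in> borel_measurable M"
  by (simp add: L2_def)

lemma L2_integrable_square: "f \<in> L2 M \<Longrightarrow> integrable M (\<lambda>x. (norm (f x))\<^sup>2)"
  by (simp add: L2_def)

lemma zero_in_L2 [simp]: "(\<lambda>x. 0) \<in> L2 M"
  by (simp add: L2_def)

lemma L2_bound:
  fixes f :: "'a \<Rightarrow> 'b::euclidean_space" and g :: "'a \<Rightarrow> 'c::euclidean_space"
  assumes "g \<in> L2 M" "f \<in> borel_measurable M" "AE x in M. norm (f x) \<le> C * norm (g x)"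
  shows "f \<in> L2 M"
proof -
  have "integrable M (\<lambda>x. (norm (f x))\<^sup>2)"
  proof (rule Bochner_Integration.integrable_bound)
    show "integrable M (\<lambda>x. C\<^sup>2 * (norm (g x))\<^sup>2)" using L2_integrable_square[OF assms(1)] by simp
    show "(\<lambda>x. (norm (f x))\<^sup>2) \<in> borel_measurable M" using assms(2) by measurable
    show "AE x in M. norm ((norm (f x))\<^sup>2) \<le> norm (C\<^sup>2 * (norm (g x))\<^sup>2)"
      using assms(3)
    proof eventually_elim
      case (elim x)
      then have "(norm (f x))\<^sup>2 \<le> (C * norm (g x))\<^sup>2" by (intro power_mono) auto
      then show ?case by (simp add: power_mult_distrib)
    qed
  qed
  then show ?thesis using assms(2) by (simp add: L2_def)
qed

lemma L2_norm_mult_integrable: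
  assumes "f \<in> L2 M" "g \<in> L2 M"
  shows "integrable M (\<lambda>x. norm (f x) * norm (g x))"
proof (rule Bochner_Integration.integrable_bound)
  show "integrable M (\<lambda>x. (norm (f x))\<^sup>2 + (norm (g x))\<^sup>2)"
    using assms by (simp add: L2_integrable_square)
  have [measurable]: "f \<in> borel_measurable M" "g \<in> borel_measurable M" using assms by (auto simp: L2_def)
  show "(\<lambda>x. norm (f x) * norm (g x)) \<in> borel_measurable M" by measurable
  show "AE x in M. norm (norm (f x) * norm (g x)) \<le> norm ((norm (f x))\<^sup>2 + (norm (g x))\<^sup>2)"
  proof (rule AE_I2)
    fix x
    have "2 * norm (f x) * norm (g x) \<le> (norm (f x))\<^sup>2 + (norm (g x))\<^sup>2" by (rule sum_squares_bound)
    moreover have "0 \<le> norm (f x) * norm (g x)" by simp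
    ultimately have "norm (f x) * norm (g x) \<le> (norm (f x))\<^sup>2 + (norm (g x))\<^sup>2" by linarith
    then show "norm (norm (f x) * norm (g x)) \<le> norm ((norm (f x))\<^sup>2 + (norm (g x))\<^sup>2)"
      by simp
  qed
qed

lemma L2_inner_integrable:
  assumes "f \<in> L2 M" "g \<in> L2 M"
  shows "integrable M (\<lambda>x. f x \<bullet> g x)"
proof (rule Bochner_Integration.integrable_bound[OF L2_norm_mult_integrable[OF assms]])
  have [measurable]: "f \<in> borel_measurable M" "g \<in> borel_measurable M" using assms by (auto simp: L2_def)
  show "(\<lambda>x. f x \<bullet> g x) \<in> borel_measurable M" by measurable
qed (auto simp: Cauchy_Schwarz_ineq2)

lemma L2_mult_integrable:
  fixes f g :: "'a \<Rightarrow> real"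
  shows "f \<in> L2 M \<Longrightarrow> g \<in> L2 M \<Longrightarrow> integrable M (\<lambda>x. f x * g x)"
  using L2_inner_integrable[of f M g] by simp

lemma lcomb_in_L2:
  assumes "f \<in> L2 M" "g \<in> L2 M"
  shows "lcomb f c g \<in> L2 M"
proof -
  have [measurable]: "f \<in> borel_measurable M" "g \<in> borel_measurable M" using assms by (auto simp: L2_def)
  have eq: "(norm (f x + c *\<^sub>R g x))\<^sup>2 = (norm (f x))\<^sup>2 + 2 * c * (f x \<bullet> g x) + c\<^sup>2 * (norm (g x))\<^sup>2" for x
    unfolding power2_norm_eq_inner
    by (simp add: inner_add_left inner_add_right inner_commute power2_eq_square algebra_simps)
  have "integrable M (\<lambda>x. (norm (f x + c *\<^sub>R g x))\<^sup>2)"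
    unfolding eq using assms by (simp add: L2_integrable_square L2_inner_integrable)
  then show ?thesis by (simp add: L2_def lcomb_def)
qed

lemma l2ip_lcomb:
  assumes "f \<in> L2 M" "g \<in> L2 M" "h \<in> L2 M"
  shows "l2ip M (lcomb f c g) h = l2ip M f h + c * l2ip M g h"
  using L2_inner_integrable[OF assms(1,3)] L2_inner_integrable[OF assms(2,3)]
  by (simp add: l2ip_def lcomb_def inner_add_left)

lemma l2ip_sym: "l2ip M f g = l2ip M g f"
  by (simp add: l2ip_def inner_commute)

lemma l2ip_self: "l2ip M f f = (\<integral>x. (norm (f x))\<^sup>2 \<partial>M)"
  by (simp add: l2ip_def power2_norm_eq_inner)

lemma l2ip_self_nonneg: "0 \<le> l2ip M f f"
  by (simp add: l2ip_self)

text \<open>Along a subsequence with squared increments below 4^(-k), the sum of 2^k d_k^2 has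
  finite integral and so is finite almost everywhere. From 2 d_k <= 2^k d_k^2 + 2^(-k) the
  increments are then summable pointwise, without a Minkowski inequality for infinite sums. Fatou
  turns the pointwise limit into a limit in norm of the whole sequence.\<close>

theorem riesz_fischer:
  fixes X :: "nat \<Rightarrow> 'a \<Rightarrow> 'b::euclidean_space"
  assumes X: "\<And>n. X n \<in> L2 M"
    and cau: "\<And>e. 0 < e \<Longrightarrow> \<exists>N. \<forall>m\<ge>N. \<forall>n\<ge>N. l2ip M (lcomb (X m) (-1) (X n)) (lcomb (X m) (-1) (X n)) < e"
  shows "\<exists>f\<in>L2 M. (\<lambda>n. l2ip M (lcomb (X n) (-1) f) (lcomb (X n) (-1) f)) \<longlonglongrightarrow> 0"
proof -
  have [measurable]: "X n \<in> borel_measurable M" for n using X by (auto simp: L2_def)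
  have diff: "lcomb (X m) (-1) (X n) \<in> L2 M" for m n by (intro lcomb_in_L2 X)
  have nn: "(\<integral>\<^sup>+x. ennreal ((norm (X m x - X n x))\<^sup>2) \<partial>M) = ennreal (l2ip M (lcomb (X m) (-1) (X n)) (lcomb (X m) (-1) (X n)))"
    for m n
    unfolding l2ip_self using L2_integrable_square[OF diff[of m n]]
    by (subst nn_integral_eq_integral) (auto simp: lcomb_def)
  have "\<exists>N. \<forall>m\<ge>N. \<forall>n\<ge>N. l2ip M (lcomb (X m) (-1) (X n)) (lcomb (X m) (-1) (X n)) < (1/4)^k" for k
    by (rule cau) simp
  then obtain N where N: "\<And>k m n. m \<ge> N k \<Longrightarrow> n \<ge> N k \<Longrightarrow>
      l2ip M (lcomb (X m) (-1) (X n)) (lcomb (X m) (-1) (X n)) < (1/4)^k" by metis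
  \<comment> \<open>Partial sums serve as a running upper bound: both \<open>r k\<close> and
    \<open>r (Suc k)\<close> are at least \<open>N k\<close>.\<close>
  define r where "r k = (\<Sum>j\<le>k. N j)" for k
  have r: "r k \<ge> N k" "r (Suc k) \<ge> N k" for k
  proof -
    show "r k \<ge> N k" unfolding r_def by (rule member_le_sum) auto
    then show "r (Suc k) \<ge> N k" unfolding r_def by simp
  qed
  define Y where "Y k = X (r k)" for k
  have [measurable]: "Y n \<in> borel_measurable M" for n by (simp add: Y_def)
  define d where "d k x = norm (Y (Suc k) x - Y k x)" for k x
  have [measurable]: "d k \<in> borel_measurable M" for k unfolding d_def by measurable
  have "(\<integral>\<^sup>+x. (\<Sum>k. ennreal (2^k * (d k x)\<^sup>2)) \<partial>M) = (\<Sum>k. \<integral>\<^sup>+x. ennreal (2^k * (d k x)\<^sup>2) \<partial>M)"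
    by (rule nn_integral_suminf) measurable
  also have "\<dots> \<le> (\<Sum>k. ennreal ((1/2)^k))"
  proof (rule suminf_le)
    fix k
    have "(\<integral>\<^sup>+x. ennreal (2^k * (d k x)\<^sup>2) \<partial>M) = ennreal (2^k) * (\<integral>\<^sup>+x. ennreal ((norm (X (r (Suc k)) x - X (r k) x))\<^sup>2) \<partial>M)"
      by (subst nn_integral_cmult[symmetric]) (auto simp: d_def Y_def ennreal_mult)
    also have "\<dots> \<le> ennreal (2^k) * ennreal ((1/4)^k)"
      unfolding nn using N[OF r(2) r(1)] by (intro mult_left_mono ennreal_leI) (auto simp: less_imp_le)
    also have "\<dots> = ennreal ((1/2)^k)"
      by (simp add: ennreal_mult[symmetric] power_mult_distrib[symmetric])
    finally show "(\<integral>\<^sup>+x. ennreal (2^k * (d k x)\<^sup>2) \<partial>M) \<le> ennreal ((1/2)^k)" .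
  qed auto
  also have "\<dots> < \<infinity>"
    by (subst suminf_ennreal2) (auto simp: summable_geometric)
  finally have "AE x in M. (\<Sum>k. ennreal (2^k * (d k x)\<^sup>2)) \<noteq> \<infinity>"
    by (intro nn_integral_PInf_AE) auto
  then have conv: "AE x in M. convergent (\<lambda>k. Y k x)"
  proof eventually_elim
    case (elim x)
    then have s: "summable (\<lambda>k. 2^k * (d k x)\<^sup>2)" by (intro summable_suminf_not_top) auto
    have "summable (\<lambda>k. norm (Y (Suc k) x - Y k x))"
    proof (rule summable_comparison_test')
      show "summable (\<lambda>k. 2^k * (d k x)\<^sup>2 + (1/2)^k)"
        using s by (intro summable_add summable_geometric) auto
      fix k :: nat
      have "2 * (2^k * d k x) * 1 \<le> (2^k * d k x)\<^sup>2 + 1\<^sup>2" by (rule sum_squares_bound)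
      then have "2^k * (2 * d k x) \<le> 2^k * (2^k * (d k x)\<^sup>2 + (1/2)^k)"
        by (simp add: power2_eq_square algebra_simps power_one_over)
      then have "2 * d k x \<le> 2^k * (d k x)\<^sup>2 + (1/2)^k" by simp
      moreover have "0 \<le> d k x" by (simp add: d_def)
      ultimately have "d k x \<le> 2^k * (d k x)\<^sup>2 + (1/2)^k" by linarith
      then show "norm (norm (Y (Suc k) x - Y k x)) \<le> 2^k * (d k x)\<^sup>2 + (1/2)^k"
        by (simp add: d_def)
    qed
    then have "summable (\<lambda>k. Y (Suc k) x - Y k x)" by (rule summable_norm_cancel)
    then have "convergent (\<lambda>n. \<Sum>k<n. Y (Suc k) x - Y k x)" by (simp add: summable_iff_convergent)
    then have "convergent (\<lambda>n. (Y n x - Y 0 x) + Y 0 x)"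
      unfolding sum_lessThan_telescope[of "\<lambda>n. Y n x"] by (intro convergent_add convergent_const)
    then show ?case by simp
  qed
  define f where "f x = lim (\<lambda>k. Y k x)" for x
  have [measurable]: "f \<in> borel_measurable M" unfolding f_def by (rule borel_measurable_lim_metric) simp
  \<comment> \<open>The shift of the subsequence by \<open>k\<close> puts all its indices beyond
    \<open>N k\<close>, so every integral under the liminf has the same bound.\<close>
  have fatou: "(\<integral>\<^sup>+x. ennreal ((norm (X m x - f x))\<^sup>2) \<partial>M) \<le> ennreal ((1/4)^k)" if m: "m \<ge> N k" for m k
  proof -
    have "(\<integral>\<^sup>+x. ennreal ((norm (X m x - f x))\<^sup>2) \<partial>M)
        = (\<integral>\<^sup>+x. liminf (\<lambda>j. ennreal ((norm (X m x - Y (j + k) x))\<^sup>2)) \<partial>M)"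
    proof (rule nn_integral_cong_AE, use conv in eventually_elim)
      case (elim x)
      then have "(\<lambda>j. Y j x) \<longlonglongrightarrow> f x" unfolding f_def by (simp add: convergent_LIMSEQ_iff)
      then have "(\<lambda>j. Y (j + k) x) \<longlonglongrightarrow> f x" by (rule LIMSEQ_ignore_initial_segment)
      then have "(\<lambda>j. ennreal ((norm (X m x - Y (j + k) x))\<^sup>2)) \<longlonglongrightarrow> ennreal ((norm (X m x - f x))\<^sup>2)"
        by (intro tendsto_intros)
      then show ?case by (metis lim_imp_Liminf trivial_limit_sequentially)
    qed
    also have "\<dots> \<le> liminf (\<lambda>j. \<integral>\<^sup>+x. ennreal ((norm (X m x - Y (j + k) x))\<^sup>2) \<partial>M)"
      by (rule nn_integral_liminf) measurable
    also have "\<dots> \<le> liminf (\<lambda>j. ennreal ((1/4)^k))"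
    proof (rule Liminf_mono, rule always_eventually, rule allI)
      fix j
      have "r (j + k) \<ge> N k"
      proof -
        have "N k \<le> (\<Sum>i\<le>j + k. N i)" by (rule member_le_sum) auto
        then show ?thesis by (simp add: r_def)
      qed
      then show "(\<integral>\<^sup>+x. ennreal ((norm (X m x - Y (j + k) x))\<^sup>2) \<partial>M) \<le> ennreal ((1/4)^k)"
        unfolding Y_def nn using N[OF m, of "r (j + k)"] by (intro ennreal_leI) simp
    qed
    also have "\<dots> = ennreal ((1/4)^k)" by (simp add: Liminf_const)
    finally show ?thesis .
  qed
  have dL2: "lcomb (X m) (-1) f \<in> L2 M" if m: "m \<ge> N k" for m k
  proof -
    have "integrable M (\<lambda>x. (norm (X m x - f x))\<^sup>2)"
      using fatou[OF m] by (intro integrableI_bounded) (auto simp: le_less_trans)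
    then show ?thesis by (simp add: L2_def lcomb_def)
  qed
  \<comment> \<open>f = X - (X - f), a difference of two elements of \<open>L2\<close>.\<close>
  have "lcomb (X (N 0)) (-1) (lcomb (X (N 0)) (-1) f) \<in> L2 M" by (intro lcomb_in_L2 X dL2[of 0]) simp
  then have f: "f \<in> L2 M" by (simp add: lcomb_def)
  have le: "l2ip M (lcomb (X m) (-1) f) (lcomb (X m) (-1) f) \<le> (1/4)^k" if m: "m \<ge> N k" for m k
  proof -
    have "ennreal (l2ip M (lcomb (X m) (-1) f) (lcomb (X m) (-1) f)) = (\<integral>\<^sup>+x. ennreal ((norm (X m x - f x))\<^sup>2) \<partial>M)"
      unfolding l2ip_self using L2_integrable_square[OF dL2[OF m]]
      by (subst nn_integral_eq_integral) (auto simp: lcomb_def)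
    then have "ennreal (l2ip M (lcomb (X m) (-1) f) (lcomb (X m) (-1) f)) \<le> ennreal ((1/4)^k)"
      using fatou[OF m] by simp
    then show ?thesis by (subst (asm) ennreal_le_iff) auto
  qed
  have "(\<lambda>n. l2ip M (lcomb (X n) (-1) f) (lcomb (X n) (-1) f)) \<longlonglongrightarrow> 0"
  proof (rule LIMSEQ_I)
    fix e :: real assume "0 < e"
    then obtain k where k: "(1/4::real)^k < e" using real_arch_pow_inv[of e "1/4"] by auto
    show "\<exists>no. \<forall>n\<ge>no. norm (l2ip M (lcomb (X n) (-1) f) (lcomb (X n) (-1) f) - 0) < e"
      using le[of k] k
      by (intro exI[of _ "N k"]) (auto simp: l2ip_self_nonneg intro: le_less_trans)
  qed
  then show ?thesis using f by blast
qed

text \<open>Completeness is inherited from \<open>riesz_fischer\<close>, so each concrete space only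
  has to be shown closed under limits in \<open>L2\<close>.\<close>

lemma semi_hilbert_subspace:
  fixes V :: "('a \<Rightarrow> 'b::euclidean_space) set"
  assumes "V \<noteq> {}" and sub: "V \<subseteq> L2 M"
    and comb: "\<And>x y c. x \<in> V \<Longrightarrow> y \<in> V \<Longrightarrow> lcomb x c y \<in> V"
    and closed: "\<And>X f. (\<And>n::nat. X n \<in> V) \<Longrightarrow> f \<in> L2 M \<Longrightarrow>
        (\<lambda>n. l2ip M (lcomb (X n) (-1) f) (lcomb (X n) (-1) f)) \<longlonglongrightarrow> 0 \<Longrightarrow> f \<in> V"
  shows "semi_hilbert V lcomb (l2ip M)"
proof
  fix X :: "nat \<Rightarrow> 'a \<Rightarrow> 'b"
  assume X: "\<And>n. X n \<in> V" and "\<And>e. 0 < e \<Longrightarrow> \<exists>N. \<forall>m\<ge>N. \<forall>n\<ge>N.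
      l2ip M (lcomb (X m) (-1) (X n)) (lcomb (X m) (-1) (X n)) < e"
  then obtain f where "f \<in> L2 M" "(\<lambda>n. l2ip M (lcomb (X n) (-1) f) (lcomb (X n) (-1) f)) \<longlonglongrightarrow> 0"
    using riesz_fischer[of X M] sub by blast
  then show "\<exists>x\<in>V. (\<lambda>n. l2ip M (lcomb (X n) (-1) x) (lcomb (X n) (-1) x)) \<longlonglongrightarrow> 0"
    using closed[of X f, OF X] by blast
next
  show "V \<noteq> {}" by fact
  show "\<And>x y c. x \<in> V \<Longrightarrow> y \<in> V \<Longrightarrow> lcomb x c y \<in> V" by (rule comb)
  show "\<And>x y z c. x \<in> V \<Longrightarrow> y \<in> V \<Longrightarrow> z \<in> V \<Longrightarrow>
      l2ip M (lcomb x c y) z = l2ip M x z + c * l2ip M y z"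
    using sub by (intro l2ip_lcomb) auto
qed (rule l2ip_sym l2ip_self_nonneg)+

interpretation L2: semi_hilbert "L2 M" lcomb "l2ip M"
  by (rule semi_hilbert_subspace) (use zero_in_L2 in \<open>auto simp: lcomb_in_L2 simp del: zero_in_L2\<close>)

definition l2norm :: "'a measure \<Rightarrow> ('a \<Rightarrow> 'b::euclidean_space) \<Rightarrow> real" where
  "l2norm M f = sqrt (l2ip M f f)"

lemma l2norm_nonneg [simp]: "0 \<le> l2norm M f"
  by (simp add: l2norm_def l2ip_self_nonneg)

lemma l2norm_square: "(l2norm M f)\<^sup>2 = l2ip M f f"
  by (simp add: l2norm_def l2ip_self_nonneg)

lemma l2ip_le_norm:
  assumes "f \<in> L2 M" "g \<in> L2 M"
  shows "\<bar>l2ip M f g\<bar> \<le> l2norm M f * l2norm M g"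
proof -
  have "sqrt ((l2ip M f g)\<^sup>2) \<le> sqrt (l2ip M f f * l2ip M g g)"
    using L2.cauchy_schwarz[OF assms] by (rule real_sqrt_le_mono)
  then show ?thesis by (simp add: l2norm_def real_sqrt_mult)
qed

lemma l2norm_triangle:
  assumes "f \<in> L2 M" "g \<in> L2 M"
  shows "l2norm M (lcomb f c g) \<le> l2norm M f + \<bar>c\<bar> * l2norm M g"
proof (rule power2_le_imp_le)
  have "(l2norm M (lcomb f c g))\<^sup>2 = (l2norm M f)\<^sup>2 + 2 * c * l2ip M f g + (c * l2norm M g)\<^sup>2"
    using L2.ip_comb_self[OF assms] by (simp add: l2norm_square power_mult_distrib)
  also have "2 * c * l2ip M f g \<le> 2 * \<bar>c\<bar> * (l2norm M f * l2norm M g)"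
  proof -
    have "c * l2ip M f g \<le> \<bar>c\<bar> * \<bar>l2ip M f g\<bar>" by (metis abs_ge_self abs_mult)
    also have "\<dots> \<le> \<bar>c\<bar> * (l2norm M f * l2norm M g)"
      using l2ip_le_norm[OF assms] by (intro mult_left_mono) auto
    finally show ?thesis by simp
  qed
  finally show "(l2norm M (lcomb f c g))\<^sup>2 \<le> (l2norm M f + \<bar>c\<bar> * l2norm M g)\<^sup>2"
    by (simp add: power2_sum power_mult_distrib algebra_simps)
qed simp

section \<open>Smooth functions supported in a closed ball\<close>

text \<open>The flat function exp (-1/t), extended by 0. The extra power of t makes the family
  closed under differentiation up to linear combinations.\<close>

definition expk :: "nat \<Rightarrow> real \<Rightarrow> real" where
  "expk k t = (if 0 < t then exp (- 1 / t) / t ^ k else 0)"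

lemma has_real_derivative_expk:
  "(expk k has_real_derivative expk (k + 2) t - real k * expk (k + 1) t) (at t)"
proof -
  consider "t < 0" | "t = 0" | "t > 0" by linarith
  then show ?thesis
  proof cases
    case 1
    have "((\<lambda>_. 0) has_real_derivative 0) (at t)" by simp
    then have "(expk k has_real_derivative 0) (at t)"
      by (rule has_field_derivative_transform_within_open[of _ _ _ "{..<0}"]) (use 1 in \<open>auto simp: expk_def\<close>)
    then show ?thesis using 1 by (simp add: expk_def)
  next
    case 2
    \<comment> \<open>The difference quotient at 0 from the right is y^(k+1) / exp y with y = 1/h,
      so exponential growth wins for every \<open>k\<close>.\<close>
    have l: "((\<lambda>h. (inverse h) ^ (k + 1) / exp (inverse h)) \<longlongrightarrow> 0) (at_right (0::real))"
      by (rule filterlim_compose[OF tendsto_power_div_exp_0 filterlim_inverse_at_top_right])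
    have r: "((\<lambda>h. expk k h / h) \<longlongrightarrow> 0) (at_right 0)"
      using l by (rule Lim_transform_eventually)
        (auto simp: eventually_at_filter expk_def exp_minus field_simps)
    have "((\<lambda>h. expk k h / h) \<longlongrightarrow> 0) (at_left 0)"
      by (rule Lim_transform_eventually[OF tendsto_const])
        (auto simp: eventually_at_filter expk_def)
    then have "((\<lambda>h. expk k h / h) \<longlongrightarrow> 0) (at 0)" using r by (simp add: filterlim_split_at)
    then have "(expk k has_real_derivative 0) (at 0)"
      by (simp add: DERIV_def expk_def)
    then show ?thesis using 2 by (simp add: expk_def)
  next
    case 3
    have k: "real k * t ^ (k - Suc 0) = real k * t ^ k / t" using 3 by (cases k) auto
    have "((\<lambda>t. exp (- 1 / t) / t ^ k) has_real_derivative
        (exp (- 1 / t) * (1 / t\<^sup>2) * t ^ k - exp (- 1 / t) * (real k * t ^ (k - Suc 0))) / (t ^ k * t ^ k)) (at t)"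
      using 3 by (auto intro!: derivative_eq_intros simp: power2_eq_square)
    also have "(exp (- 1 / t) * (1 / t\<^sup>2) * t ^ k - exp (- 1 / t) * (real k * t ^ (k - Suc 0))) / (t ^ k * t ^ k)
        = expk (k + 2) t - real k * expk (k + 1) t"
      unfolding k using 3 by (simp add: expk_def field_simps power2_eq_square)
    finally have "((\<lambda>t. exp (- 1 / t) / t ^ k) has_real_derivative expk (k + 2) t - real k * expk (k + 1) t) (at t)" .
    then show ?thesis
      by (rule has_field_derivative_transform_within_open[of _ _ _ "{0<..}"]) (use 3 in \<open>auto simp: expk_def\<close>)
  qed
qed

text \<open>A class of smooth functions containing the polynomials and a bump function, and visibly closed under
  differentiation; it replaces general smooth functions wherever test functions have to be constructed.\<close>

inductive elem_smooth :: "(real^3 \<Rightarrow> real) \<Rightarrow> bool" where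
  linear: "bounded_linear f \<Longrightarrow> elem_smooth f"
| const: "elem_smooth (\<lambda>x. c)"
| add: "elem_smooth f \<Longrightarrow> elem_smooth g \<Longrightarrow> elem_smooth (\<lambda>x. f x + g x)"
| mult: "elem_smooth f \<Longrightarrow> elem_smooth g \<Longrightarrow> elem_smooth (\<lambda>x. f x * g x)"
| bump: "elem_smooth f \<Longrightarrow> elem_smooth (\<lambda>x. expk k (f x))"

lemma elem_smooth_cmult: "elem_smooth f \<Longrightarrow> elem_smooth (\<lambda>x. c * f x)"
  by (rule elem_smooth.mult[OF elem_smooth.const])

lemma elem_smooth_diff: "elem_smooth f \<Longrightarrow> elem_smooth g \<Longrightarrow> elem_smooth (\<lambda>x. f x - g x)"
  using elem_smooth.add[OF _ elem_smooth_cmult[of g "-1"], of f] by simp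

lemma elem_smooth_sum: "(\<And>i. i \<in> I \<Longrightarrow> elem_smooth (f i)) \<Longrightarrow> elem_smooth (\<lambda>x. \<Sum>i\<in>I. f i x)"
  by (induction I rule: infinite_finite_induct) (auto intro: elem_smooth.const elem_smooth.add)

lemma elem_smooth_nth: "elem_smooth (\<lambda>x. x $ i)"
  by (intro elem_smooth.linear bounded_linear_vec_nth)

lemma elem_smooth_has_derivative:
  "elem_smooth f \<Longrightarrow> \<exists>f'. (\<forall>x. (f has_derivative f' x) (at x)) \<and> (\<forall>v. elem_smooth (\<lambda>x. f' x v))"
proof (induction rule: elem_smooth.induct)
  case (linear f)
  then show ?case
    by (intro exI[of _ "\<lambda>_. f"]) (auto intro: bounded_linear_imp_has_derivative elem_smooth.const)
next
  case (const c)
  show ?case by (intro exI[of _ "\<lambda>_ _. 0"]) (auto intro: elem_smooth.const)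
next
  case (add f g)
  then obtain f' g' where "\<And>x. (f has_derivative f' x) (at x)" "\<And>v. elem_smooth (\<lambda>x. f' x v)"
    "\<And>x. (g has_derivative g' x) (at x)" "\<And>v. elem_smooth (\<lambda>x. g' x v)" by blast
  then show ?case
    by (intro exI[of _ "\<lambda>x v. f' x v + g' x v"]) (auto intro: has_derivative_add elem_smooth.add)
next
  case (mult f g)
  then obtain f' g' where "\<And>x. (f has_derivative f' x) (at x)" "\<And>v. elem_smooth (\<lambda>x. f' x v)"
    "\<And>x. (g has_derivative g' x) (at x)" "\<And>v. elem_smooth (\<lambda>x. g' x v)" by blast
  then show ?case using mult.hyps
    by (intro exI[of _ "\<lambda>x v. f x * g' x v + f' x v * g x"])
      (auto intro!: has_derivative_mult elem_smooth.add elem_smooth.mult)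
next
  case (bump f k)
  then obtain f' where f': "\<And>x. (f has_derivative f' x) (at x)" "\<And>v. elem_smooth (\<lambda>x. f' x v)" by blast
  have "((\<lambda>x. expk k (f x)) has_derivative
      (\<lambda>v. (expk (k + 2) (f x) - real k * expk (k + 1) (f x)) * f' x v)) (at x)" for x
    using has_derivative_compose[OF f'(1) has_real_derivative_expk[THEN has_field_derivative_imp_has_derivative]] .
  moreover have "elem_smooth (\<lambda>x. (expk (k + 2) (f x) - real k * expk (k + 1) (f x)) * f' x v)" for v
    by (intro elem_smooth.mult f' elem_smooth_diff elem_smooth_cmult elem_smooth.bump bump.hyps)
  ultimately show ?case by (intro exI[of _ "\<lambda>x v. (expk (k + 2) (f x) - real k * expk (k + 1) (f x)) * f' x v"]) blast
qed

lemma elem_smooth_frechet: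
  assumes "elem_smooth f"
  shows "(f has_derivative frechet_derivative f (at x)) (at x)"
    and "elem_smooth (\<lambda>x. frechet_derivative f (at x) v)"
proof -
  obtain f' where f': "\<And>x. (f has_derivative f' x) (at x)" "\<And>v. elem_smooth (\<lambda>x. f' x v)"
    using elem_smooth_has_derivative[OF assms] by blast
  have "frechet_derivative f (at x) = f' x" for x
    using frechet_derivative_at[OF f'(1)] by simp
  then show "(f has_derivative frechet_derivative f (at x)) (at x)"
    "elem_smooth (\<lambda>x. frechet_derivative f (at x) v)" using f' by simp_all
qed

text \<open>The class is its own coinduction invariant: its members are differentiable and their
  directional derivatives belong to it again.\<close>

lemma elem_smooth_imp_smooth: "elem_smooth f \<Longrightarrow> smooth_fun f"
proof (coinduction arbitrary: f)
  case smooth_fun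
  then show ?case using elem_smooth_frechet[OF smooth_fun] by (auto simp: differentiable_def)
qed

lemma elem_smooth_continuous: "elem_smooth f \<Longrightarrow> continuous_on S f"
  by (meson continuous_at_imp_continuous_on elem_smooth_frechet(1) has_derivative_continuous)

lemma elem_smooth_scale: "elem_smooth f \<Longrightarrow> elem_smooth (\<lambda>x. f (c *\<^sub>R x))"
proof (induction rule: elem_smooth.induct)
  case (linear f)
  then show ?case by (intro elem_smooth.linear bounded_linear_compose[OF linear] bounded_linear_scaleR_right)
qed (auto intro: elem_smooth.intros)

lemma elem_smooth_polynomial: "real_polynomial_function p \<Longrightarrow> elem_smooth p"
  by (induction rule: real_polynomial_function.induct) (auto intro: elem_smooth.intros)

text \<open>The support is recorded by a radius instead of a compact set. Replacing x by c x with c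
  >= 1 then preserves the property with the same \<open>r\<close>, which the dilation argument
  relies on.\<close>

definition ball_test :: "real \<Rightarrow> (real^3 \<Rightarrow> real) \<Rightarrow> bool" where
  "ball_test r \<phi> \<longleftrightarrow> elem_smooth \<phi> \<and> (\<forall>x. r \<le> norm x \<longrightarrow> \<phi> x = 0)"

lemma ball_test_test_fun:
  assumes "ball_test r \<phi>" "r < 1" shows "test_fun \<phi>"
  unfolding test_fun_def
proof
  show "smooth_fun \<phi>" using assms by (simp add: ball_test_def elem_smooth_imp_smooth)
  show "\<exists>K. compact K \<and> K \<subseteq> ball 0 1 \<and> (\<forall>x. x \<notin> K \<longrightarrow> \<phi> x = 0)"
    by (rule exI[of _ "cball 0 r"]) (use assms in \<open>auto simp: ball_test_def\<close>)
qed

lemma ball_test_mult: "ball_test r \<phi> \<Longrightarrow> elem_smooth f \<Longrightarrow> ball_test r (\<lambda>x. f x * \<phi> x)"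
  by (auto simp: ball_test_def intro: elem_smooth.mult)

lemma ball_test_scale:
  assumes "ball_test r \<phi>" "1 \<le> c" "0 \<le> r" shows "ball_test r (\<lambda>x. \<phi> (c *\<^sub>R x))"
proof -
  have "r \<le> c * norm x" if "r \<le> norm x" for x :: "real^3"
    using mult_mono[OF assms(2) that] assms(2,3) by simp
  then show ?thesis using assms by (auto simp: ball_test_def elem_smooth_scale)
qed

lemma ball_test_lcomb: "ball_test r \<phi> \<Longrightarrow> ball_test r \<psi> \<Longrightarrow> ball_test r (lcomb \<phi> c \<psi>)"
  unfolding ball_test_def lcomb_def by (auto intro!: elem_smooth.add elem_smooth_cmult)

lemma ball_test_bump: "0 < r \<Longrightarrow> ball_test r (\<lambda>x. expk 0 (r\<^sup>2 - (norm x)\<^sup>2))"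
proof -
  assume r: "0 < r"
  have "elem_smooth (\<lambda>x. expk 0 (r\<^sup>2 - (\<Sum>i\<in>UNIV. x $ i * x $ i)))"
    by (intro elem_smooth.bump elem_smooth_diff elem_smooth.const elem_smooth_sum elem_smooth.mult elem_smooth_nth)
  moreover have "(norm x)\<^sup>2 = (\<Sum>i\<in>UNIV. x $ i * x $ i)" for x :: "real^3"
    by (simp add: power2_norm_eq_inner inner_vec_def)
  ultimately have "elem_smooth (\<lambda>x. expk 0 (r\<^sup>2 - (norm x)\<^sup>2))" by simp
  moreover have "expk 0 (r\<^sup>2 - (norm x)\<^sup>2) = 0" if "r \<le> norm x" for x :: "real^3"
    using power_mono[OF that less_imp_le[OF r], of 2] by (simp add: expk_def)
  ultimately show ?thesis by (simp add: ball_test_def)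
qed

section \<open>Density of test functions in the square-integrable functions on a ball\<close>

lemma continuous_lebesgue_measurable:
  fixes f :: "'a::euclidean_space \<Rightarrow> 'b::euclidean_space"
  assumes "continuous_on UNIV f" shows "f \<in> borel_measurable lebesgue"
proof (rule measurable_completion)
  show "f \<in> borel_measurable lborel" using borel_measurable_continuous_onI[OF assms] by simp
qed

lemma indicator_cball_L2: "(indicator (cball 0 r) :: 'a::euclidean_space \<Rightarrow> real) \<in> L2 lebesgue"
proof -
  have "integrable lebesgue (indicator (cball 0 r) :: 'a \<Rightarrow> real)"
    using emeasure_bounded_finite[of "cball (0::'a) r"] by (intro integrable_real_indicator) auto
  moreover have "(\<lambda>x. (norm (indicator (cball 0 r) x :: real))\<^sup>2) = (indicator (cball (0::'a) r) :: 'a \<Rightarrow> real)"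
    by (auto simp: indicator_def)
  ultimately show ?thesis unfolding L2_def by (simp only: mem_Collect_eq) (auto dest: borel_measurable_integrable)
qed

lemma continuous_bounded_support_L2:
  fixes f :: "'a::euclidean_space \<Rightarrow> real"
  assumes "continuous_on UNIV f" "\<And>x. x \<notin> cball 0 r \<Longrightarrow> f x = 0"
  shows "f \<in> L2 lebesgue"
proof -
  have m: "f \<in> borel_measurable lebesgue"
    using assms(1) by (rule continuous_lebesgue_measurable)
  have "bounded (f ` cball 0 r)"
    by (intro compact_imp_bounded compact_continuous_image continuous_on_subset[OF assms(1)]) auto
  then obtain B where B: "\<And>x. x \<in> cball 0 r \<Longrightarrow> \<bar>f x\<bar> \<le> B"
      unfolding bounded_iff by (metis image_eqI real_norm_def)
  show ?thesis
  proof (rule L2_bound[OF _ m])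
    show "(indicator (cball 0 r) :: 'a \<Rightarrow> real) \<in> L2 lebesgue"
      by (rule indicator_cball_L2)
    show "AE x in lebesgue. norm (f x) \<le> B * norm (indicator (cball 0 r) x :: real)"
      using assms(2) B by (intro AE_I2) (auto simp: indicator_def)
  qed
qed

lemma ball_test_L2: "ball_test r \<phi> \<Longrightarrow> \<phi> \<in> L2 lebesgue"
  by (rule continuous_bounded_support_L2[where r = r]) (auto simp: ball_test_def elem_smooth_continuous)

text \<open>Bounded support lets Stone-Weierstrass extend the orthogonality to all continuous
  functions. Continuous functions converging almost everywhere to the sign of \<open>F\<close> then
  show that the integral of |F| is 0.\<close>

lemma AE_zero_if_orthogonal_to_polynomials:
  fixes F :: "'a::euclidean_space \<Rightarrow> real"
  assumes F: "integrable lebesgue F" and supp: "\<And>x. x \<notin> cball 0 r \<Longrightarrow> F x = 0"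
    and orth: "\<And>p. real_polynomial_function p \<Longrightarrow> (\<integral>x. F x * p x \<partial>lebesgue) = 0"
  shows "AE x in lebesgue. F x = 0"
proof -
  have mF [measurable]: "F \<in> borel_measurable lebesgue" using F by simp
  have int: "integrable lebesgue (\<lambda>x. F x * g x)" if g: "continuous_on UNIV g" for g
  proof -
    have "bounded (g ` cball 0 r)"
      by (intro compact_imp_bounded compact_continuous_image continuous_on_subset[OF g]) auto
    then obtain B where B: "\<And>x. x \<in> cball 0 r \<Longrightarrow> \<bar>g x\<bar> \<le> B"
      unfolding bounded_iff by (metis image_eqI real_norm_def)
    have [measurable]: "g \<in> borel_measurable lebesgue"
      using g by (rule continuous_lebesgue_measurable)
    show ?thesis
    proof (rule Bochner_Integration.integrable_bound)
      show "integrable lebesgue (\<lambda>x. B * F x)" using F by simp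
      show "AE x in lebesgue. norm (F x * g x) \<le> norm (B * F x)"
      proof (rule AE_I2)
        fix x show "norm (F x * g x) \<le> norm (B * F x)"
        proof (cases "x \<in> cball 0 r")
          case True
          have "\<bar>g x\<bar> \<le> \<bar>B\<bar>" using B[OF True] by linarith
          then show ?thesis using mult_right_mono[of "\<bar>g x\<bar>" "\<bar>B\<bar>" "\<bar>F x\<bar>"]
            by (simp add: abs_mult mult.commute)
        qed (use supp in simp)
      qed
    qed measurable
  qed
  have zero: "(\<integral>x. F x * g x \<partial>lebesgue) = 0" if g: "continuous_on UNIV g" for g
  proof -
    define A where "A = (\<integral>x. \<bar>F x\<bar> \<partial>lebesgue)"
    have "\<bar>\<integral>x. F x * g x \<partial>lebesgue\<bar> \<le> e" if e: "0 < e" for e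
    proof -
      have A: "0 \<le> A" by (simp add: A_def)
      obtain p where p: "real_polynomial_function p" "\<And>x. x \<in> cball 0 r \<Longrightarrow> \<bar>g x - p x\<bar> < e / (A + 1)"
        using Stone_Weierstrass_real_polynomial_function[OF compact_cball continuous_on_subset[OF g], of 0 r "e / (A + 1)"]
          e A by auto
      have cp: "continuous_on UNIV p" using p(1)
        by (simp add: continuous_on_polymonial_function real_polynomial_function_eq)
      have "(\<integral>x. F x * g x \<partial>lebesgue) = (\<integral>x. F x * g x \<partial>lebesgue) - (\<integral>x. F x * p x \<partial>lebesgue)"
        using orth[OF p(1)] by simp
      also have "\<dots> = (\<integral>x. F x * g x - F x * p x \<partial>lebesgue)" using int[OF g] int[OF cp] by simp
      finally have "\<bar>\<integral>x. F x * g x \<partial>lebesgue\<bar> \<le> (\<integral>x. \<bar>F x * g x - F x * p x\<bar> \<partial>lebesgue)"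
        using integral_abs_bound by metis
      also have "\<dots> \<le> (\<integral>x. e / (A + 1) * \<bar>F x\<bar> \<partial>lebesgue)"
      proof (rule integral_mono)
        show "integrable lebesgue (\<lambda>x. \<bar>F x * g x - F x * p x\<bar>)" using int[OF g] int[OF cp] by simp
        show "integrable lebesgue (\<lambda>x. e / (A + 1) * \<bar>F x\<bar>)" using F by simp
        fix x
        show "\<bar>F x * g x - F x * p x\<bar> \<le> e / (A + 1) * \<bar>F x\<bar>"
        proof (cases "x \<in> cball 0 r")
          case True
          have "\<bar>g x - p x\<bar> * \<bar>F x\<bar> \<le> e / (A + 1) * \<bar>F x\<bar>"
            using p(2)[OF True] by (intro mult_right_mono) auto
          then show ?thesis
            by (simp add: right_diff_distrib[symmetric] abs_mult mult.commute)
        qed (use supp in simp)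
      qed
      also have "\<dots> = e * (A / (A + 1))" by (simp add: A_def)
      also have "\<dots> \<le> e * 1" using A e by (intro mult_left_mono) auto
      finally show ?thesis by simp
    qed
    then have "\<bar>\<integral>x. F x * g x \<partial>lebesgue\<bar> \<le> 0" by (rule field_le_epsilon[where y = 0, simplified])
    then show ?thesis by simp
  qed
  have "(\<lambda>x. sgn (F x)) measurable_on UNIV" by (intro lebesgue_measurable_imp_measurable_on_real) auto
  then obtain N g where N: "negligible N" and g: "\<And>n. continuous_on UNIV (g n)"
    and lim: "\<And>x. x \<notin> N \<Longrightarrow> (\<lambda>n. g n x) \<longlonglongrightarrow> sgn (F x)"
    unfolding measurable_on_def by auto
  \<comment> \<open>Clamping leaves the limit \<open>sgn (F x)\<close> unchanged and makes |F| an
    integrable majorant.\<close>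
  define h where "h n x = max (-1) (min 1 (g n x))" for n x
  have h: "continuous_on UNIV (h n)" for n unfolding h_def by (intro continuous_intros g)
  have [measurable]: "h n \<in> borel_measurable lebesgue" for n
    using h by (rule continuous_lebesgue_measurable)
  have "(\<lambda>n. \<integral>x. F x * h n x \<partial>lebesgue) \<longlonglongrightarrow> (\<integral>x. \<bar>F x\<bar> \<partial>lebesgue)"
  proof (rule integral_dominated_convergence)
    show "integrable lebesgue (\<lambda>x. \<bar>F x\<bar>)" using F by simp
    show "AE x in lebesgue. (\<lambda>n. F x * h n x) \<longlonglongrightarrow> \<bar>F x\<bar>"
    proof (rule AE_I'[of N])
      show "N \<in> null_sets lebesgue" using N by (simp add: negligible_iff_null_sets)
      have "(\<lambda>n. F x * h n x) \<longlonglongrightarrow> \<bar>F x\<bar>" if "x \<notin> N" for x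
      proof -
        have "(\<lambda>n. F x * h n x) \<longlonglongrightarrow> F x * max (-1) (min 1 (sgn (F x)))"
          unfolding h_def by (intro tendsto_intros lim that)
        also have "F x * max (-1) (min 1 (sgn (F x))) = \<bar>F x\<bar>" by (simp add: sgn_real_def)
        finally show ?thesis .
      qed
      then show "{x \<in> space lebesgue. \<not> (\<lambda>n. F x * h n x) \<longlonglongrightarrow> \<bar>F x\<bar>} \<subseteq> N" by auto
    qed
    fix n
    have "\<bar>h n x\<bar> \<le> 1" for x by (auto simp: h_def)
    then show "AE x in lebesgue. norm (F x * h n x) \<le> \<bar>F x\<bar>"
      by (intro AE_I2) (simp add: abs_mult mult_left_le)
  qed measurable
  then have "(\<integral>x. \<bar>F x\<bar> \<partial>lebesgue) = 0" using zero[OF h] by (simp add: LIMSEQ_const_iff)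
  then have "AE x in lebesgue. \<bar>F x\<bar> = 0"
    by (subst integral_nonneg_eq_0_iff_AE[symmetric]) (use F in auto)
  then show ?thesis by simp
qed

text \<open>A Hilbert space argument replaces mollification. The closure \<open>V\<close> of the
  test functions satisfies the Riesz theorem, which yields the projection \<open>p\<close> of
  \<open>f\<close>; the residual \<open>d\<close> is orthogonal to all test functions, in particular
  to every polynomial times a bump \<open>\<beta>\<close> that is positive on the open ball. Hence d
  \<beta> = 0 almost everywhere, and \<open>f\<close> agrees with \<open>p\<close> on the
  ball.\<close>

lemma ball_test_dense:
  fixes f :: "real^3 \<Rightarrow> real"
  assumes r: "0 < r" and f: "f \<in> L2 lebesgue" and supp: "\<And>x. x \<notin> cball 0 r \<Longrightarrow> f x = 0" and e: "0 < e"
  shows "\<exists>\<phi>. ball_test r \<phi> \<and> l2norm lebesgue (lcomb f (-1) \<phi>) < e"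
proof -
  define V where "V = {g \<in> L2 lebesgue. \<forall>e>0. \<exists>\<phi>. ball_test r \<phi> \<and> l2norm lebesgue (lcomb g (-1) \<phi>) < e}"
  have test_V: "\<phi> \<in> V" if "ball_test r \<phi>" for \<phi>
    using that by (auto simp: V_def ball_test_L2 l2norm_def l2ip_def lcomb_def intro!: exI[of _ \<phi>])
  interpret V: semi_hilbert V lcomb "l2ip lebesgue"
  proof (rule semi_hilbert_subspace)
    show "V \<noteq> {}" using test_V[OF ball_test_bump[OF r]] by blast
    show "V \<subseteq> L2 lebesgue" by (auto simp: V_def)
    fix g h :: "real^3 \<Rightarrow> real" and c assume g: "g \<in> V" and h: "h \<in> V"
    have "\<exists>\<phi>. ball_test r \<phi> \<and> l2norm lebesgue (lcomb (lcomb g c h) (-1) \<phi>) < e" if e: "0 < e" for e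
    proof -
      have e': "0 < e / 2 / (\<bar>c\<bar> + 1)" "0 < e / 2" using e by (auto intro: divide_pos_pos)
      obtain \<phi> where \<phi>: "ball_test r \<phi>" "l2norm lebesgue (lcomb g (-1) \<phi>) < e / 2"
        using g e'(2) unfolding V_def by blast
      obtain \<psi> where \<psi>: "ball_test r \<psi>" "l2norm lebesgue (lcomb h (-1) \<psi>) < e / 2 / (\<bar>c\<bar> + 1)"
        using h e'(1) unfolding V_def by blast
      have "lcomb (lcomb g c h) (-1) (lcomb \<phi> c \<psi>) = lcomb (lcomb g (-1) \<phi>) c (lcomb h (-1) \<psi>)"
        by (simp add: lcomb_def algebra_simps)
      then have "l2norm lebesgue (lcomb (lcomb g c h) (-1) (lcomb \<phi> c \<psi>))
          \<le> l2norm lebesgue (lcomb g (-1) \<phi>) + \<bar>c\<bar> * l2norm lebesgue (lcomb h (-1) \<psi>)"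
        using g h ball_test_L2[OF \<phi>(1)] ball_test_L2[OF \<psi>(1)]
        by (auto intro!: l2norm_triangle lcomb_in_L2 simp: V_def)
      also have "\<bar>c\<bar> * l2norm lebesgue (lcomb h (-1) \<psi>) \<le> \<bar>c\<bar> * (e / 2 / (\<bar>c\<bar> + 1))"
        using \<psi>(2) by (intro mult_left_mono) auto
      also have "\<bar>c\<bar> * (e / 2 / (\<bar>c\<bar> + 1)) \<le> e / 2" using e by (simp add: field_simps)
      finally have "l2norm lebesgue (lcomb (lcomb g c h) (-1) (lcomb \<phi> c \<psi>)) < e" using \<phi>(2) by simp
      then show ?thesis using ball_test_lcomb[OF \<phi>(1) \<psi>(1)] by blast
    qed
    then show "lcomb g c h \<in> V" using g h by (auto simp: V_def lcomb_in_L2)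
  next
    fix X g assume X: "\<And>n::nat. X n \<in> V" and g: "g \<in> L2 lebesgue"
      and l: "(\<lambda>n. l2ip lebesgue (lcomb (X n) (-1) g) (lcomb (X n) (-1) g)) \<longlonglongrightarrow> 0"
    have l': "(\<lambda>n. l2norm lebesgue (lcomb (X n) (-1) g)) \<longlonglongrightarrow> 0"
      using tendsto_real_sqrt[OF l] by (simp add: l2norm_def)
    have "\<exists>\<phi>. ball_test r \<phi> \<and> l2norm lebesgue (lcomb g (-1) \<phi>) < e" if e: "0 < e" for e
    proof -
      have e2: "0 < e / 2" using e by simp
      obtain n where n: "l2norm lebesgue (lcomb (X n) (-1) g) < e / 2"
        using order_tendstoD(2)[OF l' e2] by (auto simp: eventually_sequentially)
      obtain \<phi> where \<phi>: "ball_test r \<phi>" "l2norm lebesgue (lcomb (X n) (-1) \<phi>) < e / 2"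
        using X e2 unfolding V_def by blast
      have "lcomb g (-1) \<phi> = lcomb (lcomb (X n) (-1) \<phi>) (-1) (lcomb (X n) (-1) g)"
        by (simp add: lcomb_def algebra_simps)
      then have "l2norm lebesgue (lcomb g (-1) \<phi>)
          \<le> l2norm lebesgue (lcomb (X n) (-1) \<phi>) + \<bar>-1\<bar> * l2norm lebesgue (lcomb (X n) (-1) g)"
        using X[of n] g ball_test_L2[OF \<phi>(1)]
        by (simp only:) (intro l2norm_triangle lcomb_in_L2, auto simp: V_def)
      then show ?thesis using n \<phi> by auto
    qed
    then show "g \<in> V" using g by (simp add: V_def)
  qed
  have "\<exists>p\<in>V. \<forall>g\<in>V. l2ip lebesgue p g = l2ip lebesgue f g"
  proof (rule V.riesz)
    fix x y :: "real^3 \<Rightarrow> real" and c assume "x \<in> V" "y \<in> V"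
    then show "l2ip lebesgue f (lcomb x c y) = l2ip lebesgue f x + c * l2ip lebesgue f y"
      using f by (intro L2.ip_comb_right) (auto simp: V_def)
  next
    fix x assume "x \<in> V"
    then show "(l2ip lebesgue f x)\<^sup>2 \<le> l2ip lebesgue f f * l2ip lebesgue x x"
      using f by (intro L2.cauchy_schwarz) (auto simp: V_def)
  qed
  then obtain p where p: "p \<in> V" and po: "\<And>g. g \<in> V \<Longrightarrow> l2ip lebesgue p g = l2ip lebesgue f g" by blast
  have pL: "p \<in> L2 lebesgue" using p by (simp add: V_def)
  define d where "d = lcomb f (-1) p"
  have d: "d \<in> L2 lebesgue" unfolding d_def by (intro lcomb_in_L2 f pL)
  have dz: "l2ip lebesgue d \<phi> = 0" if "ball_test r \<phi>" for \<phi>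
    using po[OF test_V[OF that]] l2ip_lcomb[OF f pL ball_test_L2[OF that], of "-1"] by (simp add: d_def)
  define \<beta> where "\<beta> x = expk 0 (r\<^sup>2 - (norm x)\<^sup>2)" for x :: "real^3"
  have \<beta>: "ball_test r \<beta>" unfolding \<beta>_def by (rule ball_test_bump[OF r])
  have "AE x in lebesgue. d x * \<beta> x = 0"
  proof (rule AE_zero_if_orthogonal_to_polynomials[of _ r])
    show "integrable lebesgue (\<lambda>x. d x * \<beta> x)" by (intro L2_mult_integrable d ball_test_L2[OF \<beta>])
    show "d x * \<beta> x = 0" if "x \<notin> cball 0 r" for x using \<beta> that by (auto simp: ball_test_def)
    fix q :: "real^3 \<Rightarrow> real" assume "real_polynomial_function q"
    from dz[OF ball_test_mult[OF \<beta> elem_smooth_polynomial[OF this]]]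
    show "(\<integral>x. d x * \<beta> x * q x \<partial>lebesgue) = 0" by (simp add: l2ip_def mult_ac)
  qed
  moreover have "AE x in lebesgue. x \<notin> sphere (0::real^3) r"
    using negligible_sphere[of "0::real^3" r]
    by (intro AE_not_in) (simp add: negligible_iff_null_sets)
  ultimately have fp: "AE x in lebesgue. x \<in> cball 0 r \<longrightarrow> f x = p x"
  proof eventually_elim
    case (elim x)
    show ?case
    proof
      assume "x \<in> cball 0 r"
      then have "norm x < r" using elim(2) by auto
      then have "(norm x)\<^sup>2 < r\<^sup>2" by (intro power_strict_mono) auto
      then have "\<beta> x \<noteq> 0" by (simp add: \<beta>_def expk_def)
      then show "f x = p x" using elim(1) by (simp add: d_def lcomb_def)
    qed
  qed
  obtain \<phi> where \<phi>: "ball_test r \<phi>" "l2norm lebesgue (lcomb p (-1) \<phi>) < e"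
    using p e unfolding V_def by blast
  \<comment> \<open>\<open>f\<close> and \<open>p\<close> have been compared only on the ball.
    Outside it both \<open>f\<close> and \<open>\<phi>\<close> vanish, so the integrands are still
    ordered.\<close>
  have "l2norm lebesgue (lcomb f (-1) \<phi>) \<le> l2norm lebesgue (lcomb p (-1) \<phi>)"
    unfolding l2norm_def l2ip_self
  proof (intro real_sqrt_le_mono integral_mono_AE L2_integrable_square lcomb_in_L2 f pL ball_test_L2[OF \<phi>(1)])
    show "AE x in lebesgue. (norm (lcomb f (-1) \<phi> x))\<^sup>2 \<le> (norm (lcomb p (-1) \<phi> x))\<^sup>2"
      using fp
    proof eventually_elim
      case (elim x)
      show ?case
      proof (cases "x \<in> cball 0 r")
        case True then show ?thesis using elim by (simp add: lcomb_def)
      next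
        case False
        then have "\<phi> x = 0" using \<phi>(1) by (simp add: ball_test_def)
        then show ?thesis using supp[OF False] by (simp add: lcomb_def)
      qed
    qed
  qed
  then show ?thesis using \<phi> by (intro exI[of _ \<phi>]) simp
qed

section \<open>Dilations and the radial derivative\<close>

lemma
  fixes f :: "'a::euclidean_space \<Rightarrow> real"
  assumes c: "0 < c"
  shows measurable_dilation: "f \<in> borel_measurable lebesgue \<Longrightarrow> (\<lambda>x. f (c *\<^sub>R x)) \<in> borel_measurable lebesgue"
    and integrable_dilation: "integrable lebesgue f \<Longrightarrow> integrable lebesgue (\<lambda>x. f (c *\<^sub>R x))"
    and integral_dilation: "integrable lebesgue f \<Longrightarrow>
      (\<integral>x. f x \<partial>lebesgue) = c ^ DIM('a) * (\<integral>x. f (c *\<^sub>R x) \<partial>lebesgue)"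
proof -
  define T where "T = (\<lambda>x. c *\<^sub>R x :: 'a)"
  have T: "(\<lambda>x. 0 + (\<Sum>j\<in>Basis. (c * (x \<bullet> j)) *\<^sub>R j)) = T"
    unfolding scaleR_scaleR[symmetric] scaleR_sum_right[symmetric] euclidean_representation T_def by simp
  have mT [measurable]: "T \<in> lebesgue \<rightarrow>\<^sub>M lebesgue"
    using lebesgue_affine_measurable[of "\<lambda>_::'a. c" 0, unfolded T] c by simp
  have leb: "lebesgue = density (distr lebesgue lebesgue T) (\<lambda>_. ennreal (c ^ DIM('a)))"
    using lebesgue_affine_euclidean[of "\<lambda>_::'a. c" 0, unfolded T] c by (simp add: ennreal_power)
  show m: "f \<in> borel_measurable lebesgue \<Longrightarrow> (\<lambda>x. f (c *\<^sub>R x)) \<in> borel_measurable lebesgue"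
    using measurable_compose[OF mT, of f borel] by (simp add: T_def)
  assume i: "integrable lebesgue f"
  then have mf [measurable]: "f \<in> borel_measurable lebesgue" by simp
  have "integrable (density (distr lebesgue lebesgue T) (\<lambda>_. ennreal (c ^ DIM('a)))) f"
    using i leb by simp
  then have "integrable (distr lebesgue lebesgue T) (\<lambda>x. c ^ DIM('a) * f x)"
    using c by (subst (asm) integrable_density) auto
  then have "integrable lebesgue (\<lambda>x. c ^ DIM('a) * f (T x))"
    by (subst (asm) integrable_distr_eq) auto
  then show "integrable lebesgue (\<lambda>x. f (c *\<^sub>R x))" using c by (simp add: T_def)
  have "(\<integral>x. f x \<partial>lebesgue) = (\<integral>x. f x \<partial>density (distr lebesgue lebesgue T) (\<lambda>_. ennreal (c ^ DIM('a))))"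
    using leb by simp
  also have "\<dots> = (\<integral>x. c ^ DIM('a) * f x \<partial>distr lebesgue lebesgue T)"
    using c by (subst integral_density) auto
  also have "\<dots> = (\<integral>x. c ^ DIM('a) * f (T x) \<partial>lebesgue)" by (subst integral_distr) auto
  finally show "(\<integral>x. f x \<partial>lebesgue) = c ^ DIM('a) * (\<integral>x. f (c *\<^sub>R x) \<partial>lebesgue)"
    by (simp add: T_def)
qed

lemma L2_dilation:
  fixes f :: "'a::euclidean_space \<Rightarrow> real"
  assumes "0 < c" "f \<in> L2 lebesgue"
  shows "(\<lambda>x. f (c *\<^sub>R x)) \<in> L2 lebesgue"
  using assms measurable_dilation[OF assms(1), of f] integrable_dilation[OF assms(1), of "\<lambda>x. (norm (f x))\<^sup>2"]
  by (simp add: L2_def)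

lemma l2norm_dilation_le:
  fixes f :: "'a::euclidean_space \<Rightarrow> real"
  assumes c: "1 \<le> c" and f: "f \<in> L2 lebesgue"
  shows "l2norm lebesgue (\<lambda>x. f (c *\<^sub>R x)) \<le> l2norm lebesgue f"
proof -
  have "1 * (\<integral>x. (norm (f (c *\<^sub>R x)))\<^sup>2 \<partial>lebesgue) \<le> c ^ DIM('a) * (\<integral>x. (norm (f (c *\<^sub>R x)))\<^sup>2 \<partial>lebesgue)"
    using c by (intro mult_right_mono) (auto simp: one_le_power)
  also have "\<dots> = (\<integral>x. (norm (f x))\<^sup>2 \<partial>lebesgue)"
    using integral_dilation[of c "\<lambda>x. (norm (f x))\<^sup>2"] c L2_integrable_square[OF f] by simp
  finally show ?thesis by (simp add: l2norm_def l2ip_self)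
qed

text \<open>The mean value inequality bounds every difference quotient by \<open>B\<close>, so
  dominated convergence applies along each sequence of increments tending to 0.\<close>

lemma has_real_derivative_integral:
  fixes f f' :: "real \<Rightarrow> 'a \<Rightarrow> real"
  assumes t0: "t0 \<in> {a<..<b}"
    and f: "\<And>t. t \<in> {a<..<b} \<Longrightarrow> integrable M (f t)"
    and f': "\<And>t x. t \<in> {a<..<b} \<Longrightarrow> ((\<lambda>t. f t x) has_real_derivative f' t x) (at t)"
    and B: "integrable M B" "\<And>t x. t \<in> {a<..<b} \<Longrightarrow> \<bar>f' t x\<bar> \<le> B x"
  shows "((\<lambda>t. \<integral>x. f t x \<partial>M) has_real_derivative (\<integral>x. f' t0 x \<partial>M)) (at t0)"
  unfolding DERIV_def tendsto_at_iff_sequentially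
proof (intro allI impI)
  fix X :: "nat \<Rightarrow> real" assume X0: "\<forall>i. X i \<in> UNIV - {0}" and X: "X \<longlonglongrightarrow> 0"
  have "(\<lambda>i. t0 + X i) \<longlonglongrightarrow> t0 + 0" by (intro tendsto_intros X)
  then have "\<forall>\<^sub>F i in sequentially. t0 + X i \<in> {a<..<b}"
    using t0 by (intro topological_tendstoD) auto
  then obtain N where N: "\<And>i. i \<ge> N \<Longrightarrow> t0 + X i \<in> {a<..<b}" by (auto simp: eventually_sequentially)
  \<comment> \<open>Dropping the first \<open>N\<close> terms keeps \<open>t0 + Y i\<close> inside
    the interval for all \<open>i\<close>, as the majorant requires.\<close>
  define Y where "Y i = X (i + N)" for i
  have Y: "Y \<longlonglongrightarrow> 0" unfolding Y_def using X by (rule LIMSEQ_ignore_initial_segment)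
  have Y0: "Y i \<noteq> 0" and Yin: "t0 + Y i \<in> {a<..<b}" for i using X0 N by (auto simp: Y_def)
  define q where "q i x = (f (t0 + Y i) x - f t0 x) / Y i" for i x
  have qi: "integrable M (q i)" for i
    unfolding q_def using f[OF Yin] f[OF t0] by simp
  have lim: "(\<lambda>i. q i x) \<longlonglongrightarrow> f' t0 x" for x
  proof -
    have "((\<lambda>h. (f (t0 + h) x - f t0 x) / h) \<longlongrightarrow> f' t0 x) (at 0)" using f'[OF t0] by (simp add: DERIV_def)
    then show ?thesis
      unfolding q_def using Y Y0
      by (intro filterlim_compose[of "\<lambda>h. (f (t0 + h) x - f t0 x) / h" _ "at 0" Y]) (auto simp: filterlim_at)
  qed
  have "(\<lambda>i. \<integral>x. q i x \<partial>M) \<longlonglongrightarrow> (\<integral>x. f' t0 x \<partial>M)"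
  proof (rule integral_dominated_convergence[where w = B])
    show "f' t0 \<in> borel_measurable M" by (rule borel_measurable_LIMSEQ_real[OF lim]) (use qi in auto)
    fix i
    show "AE x in M. norm (q i x) \<le> B x"
    proof (rule AE_I2)
      fix x
      have "norm (f (t0 + Y i) x - f t0 x) \<le> B x * norm (t0 + Y i - t0)"
        by (rule field_differentiable_bound[where S = "{a<..<b}" and f' = "\<lambda>t. f' t x"])
          (use f' B(2) Yin t0 in \<open>auto intro: has_field_derivative_at_within\<close>)
      then show "norm (q i x) \<le> B x" using Y0[of i] by (simp add: q_def divide_le_eq)
    qed
  qed (use qi B lim in auto)
  moreover have "(\<integral>x. q i x \<partial>M) = ((\<integral>x. f (t0 + Y i) x \<partial>M) - (\<integral>x. f t0 x \<partial>M)) / Y i" for i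
    unfolding q_def using f[OF Yin] f[OF t0] by simp
  ultimately have "(\<lambda>i. ((\<integral>x. f (t0 + X (i + N)) x \<partial>M) - (\<integral>x. f t0 x \<partial>M)) / X (i + N)) \<longlonglongrightarrow> (\<integral>x. f' t0 x \<partial>M)"
    by (simp add: Y_def)
  then have "(\<lambda>i. ((\<integral>x. f (t0 + X i) x \<partial>M) - (\<integral>x. f t0 x \<partial>M)) / X i) \<longlonglongrightarrow> (\<integral>x. f' t0 x \<partial>M)"
    by (rule LIMSEQ_offset)
  then show "((\<lambda>h. ((\<integral>x. f (t0 + h) x \<partial>M) - (\<integral>x. f t0 x \<partial>M)) / h) \<circ> X) \<longlonglongrightarrow> (\<integral>x. f' t0 x \<partial>M)"
    by (simp add: o_def)
qed

text \<open>The divergence of the vector field x \<phi>(x); the factor 3 is the divergence of x in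
  dimension three.\<close>

definition div_radial :: "(real^3 \<Rightarrow> real) \<Rightarrow> real^3 \<Rightarrow> real" where
  "div_radial \<phi> x = 3 * \<phi> x + frechet_derivative \<phi> (at x) x"

lemma frechet_radial_eq_sum:
  assumes "elem_smooth \<phi>"
  shows "frechet_derivative \<phi> (at x) x = (\<Sum>i\<in>UNIV. x $ i * frechet_derivative \<phi> (at x) (axis i 1))"
proof -
  interpret bounded_linear "frechet_derivative \<phi> (at x)"
    using elem_smooth_frechet(1)[OF assms] by (rule has_derivative_bounded_linear)
  have "frechet_derivative \<phi> (at x) x = frechet_derivative \<phi> (at x) (\<Sum>i\<in>UNIV. x $ i *\<^sub>R axis i 1)"
    using basis_expansion[of x] by (simp add: scalar_mult_eq_scaleR)
  then show ?thesis by (simp add: sum scaleR)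
qed

lemma elem_smooth_div_radial:
  assumes "elem_smooth \<phi>" shows "elem_smooth (div_radial \<phi>)"
proof -
  have "div_radial \<phi> = (\<lambda>x. 3 * \<phi> x + (\<Sum>i\<in>UNIV. x $ i * frechet_derivative \<phi> (at x) (axis i 1)))"
    by (auto simp: div_radial_def frechet_radial_eq_sum[OF assms])
  then show ?thesis
    by (auto intro!: elem_smooth.add elem_smooth_cmult assms elem_smooth_sum elem_smooth.mult elem_smooth_nth
        elem_smooth_frechet)
qed

lemma has_derivative_dilation:
  assumes "elem_smooth \<phi>"
  shows "((\<lambda>x. \<phi> (c *\<^sub>R x)) has_derivative (\<lambda>v. frechet_derivative \<phi> (at (c *\<^sub>R x)) (c *\<^sub>R v))) (at x)"
proof -
  have "((\<lambda>x. c *\<^sub>R x) has_derivative (\<lambda>v. c *\<^sub>R v)) (at x)" by (auto intro!: derivative_eq_intros)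
  from has_derivative_compose[OF this elem_smooth_frechet(1)[OF assms]] show ?thesis .
qed

lemma div_radial_dilation:
  "elem_smooth \<phi> \<Longrightarrow> div_radial (\<lambda>x. \<phi> (c *\<^sub>R x)) x = div_radial \<phi> (c *\<^sub>R x)"
  using frechet_derivative_at[OF has_derivative_dilation[of \<phi> c x]] by (simp add: div_radial_def) metis

text \<open>The power t^3 is the Jacobian of the dilation. With it, \<open>div_radial\<close> is the
  infinitesimal generator of the dilations, so dilating \<open>u\<close> in an integral against
  \<phi> produces exactly the expression in a weak radial derivative.\<close>

lemma has_real_derivative_dilation:
  assumes "elem_smooth \<phi>"
  shows "((\<lambda>t. t ^ 3 * \<phi> (t *\<^sub>R x)) has_real_derivative t\<^sup>2 * div_radial \<phi> (t *\<^sub>R x)) (at t)"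
proof -
  have "((\<lambda>t. \<phi> (t *\<^sub>R x)) has_derivative (\<lambda>h. frechet_derivative \<phi> (at (t *\<^sub>R x)) (h *\<^sub>R x))) (at t)"
    by (rule has_derivative_compose[OF _ elem_smooth_frechet(1)[OF assms]]) (auto intro!: derivative_eq_intros)
  moreover have "frechet_derivative \<phi> (at (t *\<^sub>R x)) (h *\<^sub>R x) = frechet_derivative \<phi> (at (t *\<^sub>R x)) x * h" for h
    using linear_scale[OF has_derivative_linear[OF elem_smooth_frechet(1)[OF assms]]]
    by (simp add: mult.commute)
  ultimately have d: "((\<lambda>t. \<phi> (t *\<^sub>R x)) has_real_derivative frechet_derivative \<phi> (at (t *\<^sub>R x)) x) (at t)"
    by (simp add: has_field_derivative_def)
  have "frechet_derivative \<phi> (at (t *\<^sub>R x)) (t *\<^sub>R x) = t * frechet_derivative \<phi> (at (t *\<^sub>R x)) x"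
    using linear_scale[OF has_derivative_linear[OF elem_smooth_frechet(1)[OF assms]]] by simp
  then show ?thesis
    by (auto intro!: derivative_eq_intros d simp: div_radial_def algebra_simps power2_eq_square power3_eq_cube)
qed

text \<open>The relation \<open>weak\<close> below says that D is the weak radial derivative of u. Difference quotients of u along dilations
  then converge weakly to it, and \<open>a\<^sup>2 - b\<^sup>2 \<ge> 2 (a - b) b\<close> turns this weak convergence into an inequality for
  \<open>u\<^sup>2\<close>, without any strong approximation of u by smooth functions.\<close>

context
  fixes r :: real and u D :: "real^3 \<Rightarrow> real"
  assumes r: "0 < r"
    and u: "u \<in> L2 lebesgue" and u_supp: "\<And>x. x \<notin> cball 0 r \<Longrightarrow> u x = 0"
    and D: "D \<in> L2 lebesgue"
    and weak: "\<And>\<phi>. ball_test r \<phi> \<Longrightarrow> (\<integral>x. u x * div_radial \<phi> x \<partial>lebesgue) = - (\<integral>x. D x * \<phi> x \<partial>lebesgue)"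
begin

lemma u_integrable: "integrable lebesgue (\<lambda>x. \<bar>u x\<bar>)"
proof -
  have "u x * indicator (cball 0 r) x = u x" for x
    using u_supp[of x] by (cases "x \<in> cball 0 r") auto
  then have "(\<lambda>x. u x * indicator (cball 0 r) x) = u" by blast
  then have "integrable lebesgue u" using L2_mult_integrable[OF u indicator_cball_L2[of r]] by simp
  then show ?thesis by simp
qed

text \<open>Only the smoothness of \<phi> and the bounded support of \<open>u\<close> matter here,
  so the parameter may go below 1 and the derivative at t = 1 is two-sided. For t < 3 the argument
  \<open>t x\<close> stays in the ball of radius 3 r, where \<open>B\<close> bounds
  \<open>div_radial \<phi>\<close>; the factor 9 bounds t^2.\<close>

lemma has_real_derivative_dilated_pairing:
  assumes \<phi>: "ball_test r \<phi>" and t: "t \<in> {1/2<..<3}"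
  shows "((\<lambda>t. \<integral>x. u x * (t ^ 3 * \<phi> (t *\<^sub>R x)) \<partial>lebesgue) has_real_derivative
      (\<integral>x. u x * (t\<^sup>2 * div_radial \<phi> (t *\<^sub>R x)) \<partial>lebesgue)) (at t)"
proof -
  have e: "elem_smooth \<phi>" using \<phi> by (simp add: ball_test_def)
  have "bounded (div_radial \<phi> ` cball 0 (3 * r))"
    by (intro compact_imp_bounded compact_continuous_image elem_smooth_continuous elem_smooth_div_radial e) auto
  then obtain B where B: "\<And>x. x \<in> cball 0 (3 * r) \<Longrightarrow> \<bar>div_radial \<phi> x\<bar> \<le> B"
    unfolding bounded_iff by (metis image_eqI real_norm_def)
  have B0: "0 \<le> B" using B[of 0] r by auto
  show ?thesis
  proof (rule has_real_derivative_integral[OF t, where B = "\<lambda>x. \<bar>u x\<bar> * (9 * B)"])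
    fix t :: real and x :: "real^3" assume t: "t \<in> {1/2<..<3}"
    show "((\<lambda>t. u x * (t ^ 3 * \<phi> (t *\<^sub>R x))) has_real_derivative u x * (t\<^sup>2 * div_radial \<phi> (t *\<^sub>R x))) (at t)"
      by (intro DERIV_cmult has_real_derivative_dilation e)
    show "\<bar>u x * (t\<^sup>2 * div_radial \<phi> (t *\<^sub>R x))\<bar> \<le> \<bar>u x\<bar> * (9 * B)"
    proof (cases "x \<in> cball 0 r")
      case True
      have "norm (t *\<^sub>R x) \<le> 3 * r" unfolding norm_scaleR using t True by (intro mult_mono) auto
      then have "\<bar>div_radial \<phi> (t *\<^sub>R x)\<bar> \<le> B" by (intro B) simp
      moreover have "t\<^sup>2 \<le> 3\<^sup>2" using t by (intro power_mono) auto
      ultimately have "t\<^sup>2 * \<bar>div_radial \<phi> (t *\<^sub>R x)\<bar> \<le> 9 * B" using B0 by (intro mult_mono) auto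
      then show ?thesis by (simp add: abs_mult mult_left_mono)
    qed (use u_supp in simp)
  next
    show "integrable lebesgue (\<lambda>x. \<bar>u x\<bar> * (9 * B))" using u_integrable by (rule integrable_mult_left)
    fix t :: real assume t: "t \<in> {1/2<..<3}"
    have "(\<lambda>x. \<phi> (t *\<^sub>R x)) \<in> L2 lebesgue" using t by (intro L2_dilation ball_test_L2[OF \<phi>]) auto
    from integrable_mult_right[OF L2_mult_integrable[OF u this], of "t ^ 3"]
    show "integrable lebesgue (\<lambda>x. u x * (t ^ 3 * \<phi> (t *\<^sub>R x)))" by (simp add: mult_ac)
  qed
qed

text \<open>The restriction t >= 1 makes the dilated test function vanish outside the ball of radius
  \<open>r\<close> again, hence admissible in \<open>weak\<close>.\<close>

lemma dilated_pairing_derivative_eq: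
  assumes \<phi>: "ball_test r \<phi>" and t: "1 \<le> t"
  shows "(\<integral>x. u x * (t\<^sup>2 * div_radial \<phi> (t *\<^sub>R x)) \<partial>lebesgue) = - t\<^sup>2 * (\<integral>x. D x * \<phi> (t *\<^sub>R x) \<partial>lebesgue)"
proof -
  have e: "elem_smooth \<phi>" using \<phi> by (simp add: ball_test_def)
  have "(\<integral>x. u x * (t\<^sup>2 * div_radial \<phi> (t *\<^sub>R x)) \<partial>lebesgue)
      = (\<integral>x. t\<^sup>2 * (u x * div_radial (\<lambda>x. \<phi> (t *\<^sub>R x)) x) \<partial>lebesgue)"
    by (simp add: div_radial_dilation[OF e] mult_ac)
  also have "\<dots> = t\<^sup>2 * (\<integral>x. u x * div_radial (\<lambda>x. \<phi> (t *\<^sub>R x)) x \<partial>lebesgue)" by simp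
  finally show ?thesis using weak[OF ball_test_scale[OF \<phi> t]] r by simp
qed

lemma dilated_pairing:
  assumes "f \<in> L2 lebesgue" "0 < t"
  shows "(\<integral>x. u ((1 / t) *\<^sub>R x) * f x \<partial>lebesgue) = (\<integral>x. u x * (t ^ 3 * f (t *\<^sub>R x)) \<partial>lebesgue)"
proof -
  have "integrable lebesgue (\<lambda>x. u ((1 / t) *\<^sub>R x) * f x)"
    using assms by (intro L2_mult_integrable L2_dilation u) auto
  from integral_dilation[OF assms(2) this]
  have "(\<integral>x. u ((1 / t) *\<^sub>R x) * f x \<partial>lebesgue) = t ^ 3 * (\<integral>x. u x * f (t *\<^sub>R x) \<partial>lebesgue)"
    using assms(2) by simp
  also have "\<dots> = (\<integral>x. t ^ 3 * (u x * f (t *\<^sub>R x)) \<partial>lebesgue)" by simp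
  finally show ?thesis by (simp add: mult_ac)
qed

abbreviation dilation_diff :: "real \<Rightarrow> real^3 \<Rightarrow> real" where
  "dilation_diff t \<equiv> lcomb (\<lambda>x. u ((1 / t) *\<^sub>R x)) (-1) u"

lemma dilation_diff_L2: "0 < t \<Longrightarrow> dilation_diff t \<in> L2 lebesgue"
  by (intro lcomb_in_L2 L2_dilation u) auto

text \<open>By change of variables the pairing is an increment of \<open>N\<close>, estimated by the
  mean value inequality; 4 bounds z^2 on [1, 2], and dilating \<phi> by z >= 1 does not increase its
  norm.\<close>

lemma dilation_diff_test_bound:
  assumes \<phi>: "ball_test r \<phi>" and t: "1 \<le> t" "t \<le> 2"
  shows "\<bar>l2ip lebesgue (dilation_diff t) \<phi>\<bar> \<le> 4 * (t - 1) * l2norm lebesgue D * l2norm lebesgue \<phi>"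
proof -
  note \<phi>L = ball_test_L2[OF \<phi>]
  define N where "N t = (\<integral>x. u x * (t ^ 3 * \<phi> (t *\<^sub>R x)) \<partial>lebesgue)" for t
  have "norm (N t - N 1) \<le> (4 * l2norm lebesgue D * l2norm lebesgue \<phi>) * norm (t - 1)"
  proof (rule field_differentiable_bound[where S = "{1..2}"])
    fix z :: real assume z: "z \<in> {1..2}"
    show "(N has_field_derivative - z\<^sup>2 * l2ip lebesgue D (\<lambda>x. \<phi> (z *\<^sub>R x))) (at z within {1..2})"
      using has_real_derivative_dilated_pairing[OF \<phi>, of z] dilated_pairing_derivative_eq[OF \<phi>, of z] z
      unfolding N_def l2ip_def by (auto intro: has_field_derivative_at_within)
    have "\<bar>l2ip lebesgue D (\<lambda>x. \<phi> (z *\<^sub>R x))\<bar> \<le> l2norm lebesgue D * l2norm lebesgue (\<lambda>x. \<phi> (z *\<^sub>R x))"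
      using z by (intro l2ip_le_norm D L2_dilation \<phi>L) auto
    also have "\<dots> \<le> l2norm lebesgue D * l2norm lebesgue \<phi>"
      using z by (intro mult_left_mono l2norm_dilation_le \<phi>L) auto
    finally have "\<bar>l2ip lebesgue D (\<lambda>x. \<phi> (z *\<^sub>R x))\<bar> \<le> l2norm lebesgue D * l2norm lebesgue \<phi>" .
    moreover have "z\<^sup>2 \<le> 2\<^sup>2" using z by (intro power_mono) auto
    ultimately have "z\<^sup>2 * \<bar>l2ip lebesgue D (\<lambda>x. \<phi> (z *\<^sub>R x))\<bar> \<le> 2\<^sup>2 * (l2norm lebesgue D * l2norm lebesgue \<phi>)"
      by (intro mult_mono) auto
    then show "norm (- z\<^sup>2 * l2ip lebesgue D (\<lambda>x. \<phi> (z *\<^sub>R x))) \<le> 4 * l2norm lebesgue D * l2norm lebesgue \<phi>"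
      by (simp add: abs_mult)
  qed (use t in auto)
  moreover have "l2ip lebesgue (dilation_diff t) \<phi> = N t - N 1"
    using l2ip_lcomb[OF L2_dilation[OF _ u] u \<phi>L, of "1 / t" "-1"] dilated_pairing[OF \<phi>L, of t] t
    by (simp add: N_def l2ip_def)
  moreover have eq: "(4 * l2norm lebesgue D * l2norm lebesgue \<phi>) * norm (t - 1) = 4 * (t - 1) * l2norm lebesgue D * l2norm lebesgue \<phi>"
    using t by simp
  ultimately show ?thesis unfolding eq by (simp only: real_norm_def)
qed

text \<open>This bounds the difference quotients as functionals, uniformly in \<open>t\<close>. The
  uniformity is what carries their weak limit from test functions to the non-smooth function
  \<open>u P\<close> below.\<close>

lemma dilation_diff_bound:
  assumes f: "f \<in> L2 lebesgue" "\<And>x. x \<notin> cball 0 r \<Longrightarrow> f x = 0" and t: "1 \<le> t" "t \<le> 2"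
  shows "\<bar>l2ip lebesgue (dilation_diff t) f\<bar> \<le> 4 * (t - 1) * l2norm lebesgue D * l2norm lebesgue f"
proof (rule field_le_epsilon)
  define d where "d = dilation_diff t"
  define A where "A = 4 * (t - 1) * l2norm lebesgue D"
  have d: "d \<in> L2 lebesgue" unfolding d_def using t by (intro dilation_diff_L2) auto
  have A: "0 \<le> A" using t by (simp add: A_def)
  fix e :: real assume e: "0 < e"
  \<comment> \<open>Replacing \<open>f\<close> by \<phi> costs at most
    (\<open>l2norm lebesgue d\<close> + A) e'; the added 1 keeps the denominator positive.\<close>
  define e' where "e' = e / (l2norm lebesgue d + A + 1)"
  have pos: "0 < l2norm lebesgue d + A + 1" using A l2norm_nonneg[of lebesgue d] by linarith
  have e': "0 < e'" using e pos by (simp add: e'_def)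
  obtain \<phi> where \<phi>: "ball_test r \<phi>" "l2norm lebesgue (lcomb f (-1) \<phi>) < e'"
    using ball_test_dense[OF r f e'] by blast
  note \<phi>L = ball_test_L2[OF \<phi>(1)]
  have dL: "lcomb f (-1) \<phi> \<in> L2 lebesgue" by (intro lcomb_in_L2 f \<phi>L)
  have eq: "l2ip lebesgue d f = l2ip lebesgue d \<phi> + l2ip lebesgue d (lcomb f (-1) \<phi>)"
    using L2.ip_comb_right[OF f(1) \<phi>L d, of "-1"] by simp
  have "\<bar>l2ip lebesgue d (lcomb f (-1) \<phi>)\<bar> \<le> l2norm lebesgue d * e'"
    using l2ip_le_norm[OF d dL] \<phi>(2) l2norm_nonneg[of lebesgue d] by (meson less_imp_le mult_left_mono order_trans)
  moreover have "\<bar>l2ip lebesgue d \<phi>\<bar> \<le> A * (l2norm lebesgue f + e')"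
  proof -
    have "l2norm lebesgue \<phi> \<le> l2norm lebesgue f + \<bar>-1\<bar> * l2norm lebesgue (lcomb f (-1) \<phi>)"
      using l2norm_triangle[OF f(1) dL, of "-1"] by (simp add: lcomb_def)
    then have "l2norm lebesgue \<phi> \<le> l2norm lebesgue f + e'" using \<phi>(2) by simp
    then show ?thesis
      using dilation_diff_test_bound[OF \<phi>(1) t] mult_left_mono[OF _ A] unfolding d_def A_def
      by (meson order_trans)
  qed
  ultimately have "\<bar>l2ip lebesgue d f\<bar> \<le> A * l2norm lebesgue f + (l2norm lebesgue d + A) * e'"
    unfolding eq by (simp add: algebra_simps)
  also have "(l2norm lebesgue d + A) * e' \<le> (l2norm lebesgue d + A + 1) * e'"
    using e' by (intro mult_right_mono) auto
  also have "\<dots> = e" using pos by (simp add: e'_def)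
  finally show "\<bar>l2ip lebesgue (dilation_diff t) f\<bar> \<le> 4 * (t - 1) * l2norm lebesgue D * l2norm lebesgue f + e"
    by (simp add: d_def A_def)
qed

text \<open>The weighted energy J t of the dilated function u(x/t) is differentiable at 1 after the
  dilation is moved onto the smooth weight, with derivative the integral of u^2 div (x P). Its
  difference quotients for t > 1 dominate twice those of \<open>u\<close> tested against
  \<open>u P\<close>, and these tend to minus the pairing of \<open>D\<close> with
  \<open>u P\<close>.\<close>

theorem weak_radial_energy_inequality:
  fixes P P' :: "real \<Rightarrow> real"
  assumes P': "\<And>t. (P has_real_derivative P' t) (at t)" "continuous_on UNIV P'"
    and P_nonneg: "\<And>t. 0 \<le> P t" and P_supp: "\<And>t. r\<^sup>2 \<le> t \<Longrightarrow> P t = 0"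
  shows "- (\<integral>x. (u x)\<^sup>2 * (3 * P ((norm x)\<^sup>2) + 2 * (norm x)\<^sup>2 * P' ((norm x)\<^sup>2)) \<partial>lebesgue)
      \<le> 2 * (\<integral>x. D x * (u x * P ((norm x)\<^sup>2)) \<partial>lebesgue)"
proof -
  define I where "I = (\<integral>x. (u x)\<^sup>2 * (3 * P ((norm x)\<^sup>2) + 2 * (norm x)\<^sup>2 * P' ((norm x)\<^sup>2)) \<partial>lebesgue)"
  define f where "f x = u x * P ((norm x)\<^sup>2)" for x
  have cP: "continuous_on S P" for S
    using P'(1) by (meson DERIV_isCont continuous_at_imp_continuous_on)
  have usq: "integrable lebesgue (\<lambda>x. (u x)\<^sup>2)" using L2_integrable_square[OF u] by simp
  have "bounded (P ` {0..9 * r\<^sup>2})" "bounded (P' ` {0..9 * r\<^sup>2})"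
    by (intro compact_imp_bounded compact_continuous_image cP continuous_on_subset[OF P'(2)]; simp)+
  then obtain B1 B2 where B1: "\<And>t. t \<in> {0..9 * r\<^sup>2} \<Longrightarrow> \<bar>P t\<bar> \<le> B1" and B2: "\<And>t. t \<in> {0..9 * r\<^sup>2} \<Longrightarrow> \<bar>P' t\<bar> \<le> B2"
    unfolding bounded_iff by (metis image_eqI real_norm_def)
  have B0: "0 \<le> B1" "0 \<le> B2" using B1[of 0] B2[of 0] by auto
  have Pm [measurable]: "(\<lambda>x::real^3. P (c * (norm x)\<^sup>2)) \<in> borel_measurable lebesgue" for c
    by (intro continuous_lebesgue_measurable continuous_on_compose2[OF cP[of UNIV]] continuous_intros) auto
  have um [measurable]: "u \<in> borel_measurable lebesgue" using u by (simp add: L2_def)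
  have f: "f \<in> L2 lebesgue"
  proof (rule L2_bound[OF u, where C = B1])
    show "f \<in> borel_measurable lebesgue" using Pm[of 1] unfolding f_def by simp
    show "AE x in lebesgue. norm (f x) \<le> B1 * norm (u x)"
    proof (rule AE_I2)
      fix x :: "real^3"
      have "(norm x)\<^sup>2 \<le> 9 * r\<^sup>2" if "norm x \<le> r"
      proof -
        have "(norm x)\<^sup>2 \<le> r\<^sup>2" using power_mono[OF that, of 2] by simp
        then show ?thesis using zero_le_power2[of r] by linarith
      qed
      then have "\<bar>P ((norm x)\<^sup>2)\<bar> * \<bar>u x\<bar> \<le> B1 * \<bar>u x\<bar>"
        using B1[of "(norm x)\<^sup>2"] u_supp[of x] by (cases "norm x \<le> r") (auto intro!: mult_right_mono)
      then show "norm (f x) \<le> B1 * norm (u x)" by (simp add: f_def abs_mult mult.commute)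
    qed
  qed
  have f_supp: "f x = 0" if "x \<notin> cball 0 r" for x using u_supp[OF that] by (simp add: f_def)
  define J where "J t = (\<integral>x. (u x)\<^sup>2 * (t ^ 3 * P (t\<^sup>2 * (norm x)\<^sup>2)) \<partial>lebesgue)" for t
  have Ji: "integrable lebesgue (\<lambda>x. (u x)\<^sup>2 * (t ^ 3 * P (t\<^sup>2 * (norm x)\<^sup>2)))" if t: "t \<in> {1/2<..<3}" for t
  proof (rule Bochner_Integration.integrable_bound)
    show "integrable lebesgue (\<lambda>x. (t ^ 3 * B1) * (u x)\<^sup>2)" using usq by simp
    show "AE x in lebesgue. norm ((u x)\<^sup>2 * (t ^ 3 * P (t\<^sup>2 * (norm x)\<^sup>2))) \<le> norm ((t ^ 3 * B1) * (u x)\<^sup>2)"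
    proof (rule AE_I2)
      fix x :: "real^3"
      have "t\<^sup>2 * (norm x)\<^sup>2 \<le> 3\<^sup>2 * r\<^sup>2" if "norm x \<le> r"
        using that t by (intro mult_mono power_mono) auto
      then have "(u x)\<^sup>2 * \<bar>P (t\<^sup>2 * (norm x)\<^sup>2)\<bar> \<le> (u x)\<^sup>2 * B1"
        using B1[of "t\<^sup>2 * (norm x)\<^sup>2"] u_supp[of x] by (cases "norm x \<le> r") (auto intro: mult_left_mono)
      from mult_left_mono[OF this, of "t ^ 3"]
      show "norm ((u x)\<^sup>2 * (t ^ 3 * P (t\<^sup>2 * (norm x)\<^sup>2))) \<le> norm ((t ^ 3 * B1) * (u x)\<^sup>2)"
        using t B0 by (simp add: abs_mult mult_ac)
    qed
  qed measurable
  have J1: "(J has_real_derivative I) (at 1)"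
  proof -
    have "(J has_real_derivative (\<integral>x. (u x)\<^sup>2 * (3 * 1\<^sup>2 * P (1\<^sup>2 * (norm x)\<^sup>2)
        + 1 ^ 3 * (2 * 1 * (norm x)\<^sup>2 * P' (1\<^sup>2 * (norm x)\<^sup>2))) \<partial>lebesgue)) (at 1)"
      unfolding J_def
    \<comment> \<open>On the support of \<open>u\<close> and for t < 3: 3 t^2 and t^3 are at most
      27, and 2 t |x|^2 is at most 6 r^2.\<close>
    proof (rule has_real_derivative_integral[where a = "1/2" and b = 3 and B = "\<lambda>x. (27 * B1 + 27 * (6 * r\<^sup>2 * B2)) * (u x)\<^sup>2"])
      fix t :: real and x :: "real^3" assume t: "t \<in> {1/2<..<3}"
      have "((\<lambda>t. P (t\<^sup>2 * (norm x)\<^sup>2)) has_real_derivative P' (t\<^sup>2 * (norm x)\<^sup>2) * (2 * t * (norm x)\<^sup>2)) (at t)"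
        by (rule DERIV_chain2[OF P'(1)]) (auto intro!: derivative_eq_intros)
      then have "((\<lambda>t. t ^ 3 * P (t\<^sup>2 * (norm x)\<^sup>2)) has_real_derivative
          (3 * t\<^sup>2 * P (t\<^sup>2 * (norm x)\<^sup>2) + t ^ 3 * (2 * t * (norm x)\<^sup>2 * P' (t\<^sup>2 * (norm x)\<^sup>2)))) (at t)"
        by (auto intro!: derivative_eq_intros simp: mult_ac)
      then show "((\<lambda>t. (u x)\<^sup>2 * (t ^ 3 * P (t\<^sup>2 * (norm x)\<^sup>2))) has_real_derivative
          (u x)\<^sup>2 * (3 * t\<^sup>2 * P (t\<^sup>2 * (norm x)\<^sup>2) + t ^ 3 * (2 * t * (norm x)\<^sup>2 * P' (t\<^sup>2 * (norm x)\<^sup>2)))) (at t)"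
        by (rule DERIV_cmult)
      show "\<bar>(u x)\<^sup>2 * (3 * t\<^sup>2 * P (t\<^sup>2 * (norm x)\<^sup>2) + t ^ 3 * (2 * t * (norm x)\<^sup>2 * P' (t\<^sup>2 * (norm x)\<^sup>2)))\<bar>
          \<le> (27 * B1 + 27 * (6 * r\<^sup>2 * B2)) * (u x)\<^sup>2"
      proof (cases "norm x \<le> r")
        case True
        have n: "(norm x)\<^sup>2 \<le> r\<^sup>2" using True by (intro power_mono) auto
        have t2: "t\<^sup>2 \<le> 3\<^sup>2" and t3: "t ^ 3 \<le> 3 ^ 3" using t by (auto intro!: power_mono simp del: power_numeral)
        have "t\<^sup>2 * (norm x)\<^sup>2 \<le> 3\<^sup>2 * r\<^sup>2" using n t2 by (intro mult_mono) auto
        then have m: "t\<^sup>2 * (norm x)\<^sup>2 \<in> {0..9 * r\<^sup>2}" by simp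
        have "\<bar>3 * t\<^sup>2 * P (t\<^sup>2 * (norm x)\<^sup>2)\<bar> = (3 * t\<^sup>2) * \<bar>P (t\<^sup>2 * (norm x)\<^sup>2)\<bar>" by (simp add: abs_mult)
        also have "\<dots> \<le> (3 * 3\<^sup>2) * B1" using B1[OF m] t2 by (intro mult_mono) auto
        finally have a: "\<bar>3 * t\<^sup>2 * P (t\<^sup>2 * (norm x)\<^sup>2)\<bar> \<le> 27 * B1" by simp
        have "\<bar>t ^ 3 * (2 * t * (norm x)\<^sup>2 * P' (t\<^sup>2 * (norm x)\<^sup>2))\<bar>
            = t ^ 3 * (2 * t * (norm x)\<^sup>2 * \<bar>P' (t\<^sup>2 * (norm x)\<^sup>2)\<bar>)" using t by (simp add: abs_mult)
        also have "\<dots> \<le> 3 ^ 3 * (2 * 3 * r\<^sup>2 * B2)"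
          using B2[OF m] t3 t n B0 by (intro mult_mono mult_nonneg_nonneg) auto
        finally have b: "\<bar>t ^ 3 * (2 * t * (norm x)\<^sup>2 * P' (t\<^sup>2 * (norm x)\<^sup>2))\<bar> \<le> 27 * (6 * r\<^sup>2 * B2)" by simp
        have "\<bar>3 * t\<^sup>2 * P (t\<^sup>2 * (norm x)\<^sup>2) + t ^ 3 * (2 * t * (norm x)\<^sup>2 * P' (t\<^sup>2 * (norm x)\<^sup>2))\<bar>
            \<le> 27 * B1 + 27 * (6 * r\<^sup>2 * B2)" using a b by linarith
        from mult_left_mono[OF this, of "(u x)\<^sup>2"] show ?thesis by (simp add: abs_mult mult.commute)
      qed (use u_supp in simp)
    qed (use Ji usq in auto)
    then show ?thesis by (simp add: I_def)
  qed
  define \<tau> where "\<tau> n = 1 + inverse (real (Suc n))" for n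
  have \<tau>: "1 < \<tau> n" "\<tau> n \<le> 2" for n by (auto simp: \<tau>_def inverse_eq_divide)
  have \<tau>lim: "filterlim (\<lambda>n. \<tau> n - 1) (at 0) sequentially"
    unfolding filterlim_at \<tau>_def using LIMSEQ_inverse_real_of_nat by auto
  have quot: "(\<lambda>n. (F (\<tau> n) - F 1) / (\<tau> n - 1)) \<longlonglongrightarrow> F'" if "(F has_real_derivative F') (at 1)" for F :: "real \<Rightarrow> real" and F'
    using filterlim_compose[OF that[unfolded DERIV_def] \<tau>lim] by simp
  \<comment> \<open>After substitution the left side is the integral of (v^2 - u^2) P with v(x) =
    u(x/t). Nonnegativity of \<open>P\<close> allows v^2 - u^2 to be replaced by 2 (v - u)
    u.\<close>
  have key: "J t - J 1 \<ge> 2 * l2ip lebesgue (dilation_diff t) f" if t: "1 < t" "t \<le> 2" for t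
  proof -
    define v where "v x = u ((1 / t) *\<^sub>R x)" for x
    have v: "v \<in> L2 lebesgue" unfolding v_def using t by (intro L2_dilation u) auto
    have Jt: "integrable lebesgue (\<lambda>x. (v x)\<^sup>2 * P ((norm x)\<^sup>2))" "(\<integral>x. (v x)\<^sup>2 * P ((norm x)\<^sup>2) \<partial>lebesgue) = J t"
    proof -
      have Pn: "P (t\<^sup>2 * (norm ((1 / t) *\<^sub>R x))\<^sup>2) = P ((norm x)\<^sup>2)" for x :: "real^3"
        using t by (simp add: power_mult_distrib power_divide)
      have i: "integrable lebesgue (\<lambda>x. (u x)\<^sup>2 * (t ^ 3 * P (t\<^sup>2 * (norm x)\<^sup>2)))" using t by (intro Ji) auto
      have "integrable lebesgue (\<lambda>x. (v x)\<^sup>2 * (t ^ 3 * P ((norm x)\<^sup>2)))"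
        using integrable_dilation[OF _ i, of "1 / t"] t unfolding Pn v_def by simp
      then have "integrable lebesgue (\<lambda>x. (1 / t ^ 3) * ((v x)\<^sup>2 * (t ^ 3 * P ((norm x)\<^sup>2))))"
        by (rule integrable_mult_right)
      then show "integrable lebesgue (\<lambda>x. (v x)\<^sup>2 * P ((norm x)\<^sup>2))" using t by simp
      have "J t = (1 / t) ^ 3 * (\<integral>x. (v x)\<^sup>2 * (t ^ 3 * P ((norm x)\<^sup>2)) \<partial>lebesgue)"
        using integral_dilation[OF _ i, of "1 / t"] t unfolding Pn v_def J_def by simp
      also have "\<dots> = (\<integral>x. (1 / t) ^ 3 * ((v x)\<^sup>2 * (t ^ 3 * P ((norm x)\<^sup>2))) \<partial>lebesgue)" by simp
      also have "\<dots> = (\<integral>x. (v x)\<^sup>2 * P ((norm x)\<^sup>2) \<partial>lebesgue)"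
        using t by (intro Bochner_Integration.integral_cong) (auto simp: power_divide)
      finally show "(\<integral>x. (v x)\<^sup>2 * P ((norm x)\<^sup>2) \<partial>lebesgue) = J t" by simp
    qed
    have J1': "integrable lebesgue (\<lambda>x. (u x)\<^sup>2 * P ((norm x)\<^sup>2))" "(\<integral>x. (u x)\<^sup>2 * P ((norm x)\<^sup>2) \<partial>lebesgue) = J 1"
      using Ji[of 1] by (simp_all add: J_def)
    have df: "integrable lebesgue (\<lambda>x. dilation_diff t x * f x)"
      using t by (intro L2_mult_integrable dilation_diff_L2 f) auto
    have "2 * l2ip lebesgue (dilation_diff t) f = (\<integral>x. 2 * (dilation_diff t x * f x) \<partial>lebesgue)"
      by (simp add: l2ip_def)
    also have "\<dots> \<le> (\<integral>x. (v x)\<^sup>2 * P ((norm x)\<^sup>2) - (u x)\<^sup>2 * P ((norm x)\<^sup>2) \<partial>lebesgue)"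
    proof (rule integral_mono)
      fix x
      have "2 * ((v x - u x) * u x) \<le> (v x)\<^sup>2 - (u x)\<^sup>2"
        using zero_le_power2[of "v x - u x"] by (simp add: power2_eq_square algebra_simps)
      from mult_right_mono[OF this P_nonneg[of "(norm x)\<^sup>2"]]
      show "2 * (dilation_diff t x * f x) \<le> (v x)\<^sup>2 * P ((norm x)\<^sup>2) - (u x)\<^sup>2 * P ((norm x)\<^sup>2)"
        by (simp add: lcomb_def v_def f_def algebra_simps)
    qed (use df Jt(1) J1'(1) in auto)
    also have "\<dots> = J t - J 1" using Jt J1' by simp
    finally show ?thesis .
  qed
  have "- 2 * l2ip lebesgue D f \<le> I"
  proof (rule field_le_epsilon)
    define A where "A = l2norm lebesgue D"
    have A: "0 \<le> A" by (simp add: A_def)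
    fix e :: real assume e: "0 < e"
    \<comment> \<open>Replacing \<open>f\<close> by \<phi> costs 8 A e' in the doubled difference
      quotient and 2 A e' in twice the pairing with \<open>D\<close>; the 1 covers A = 0.\<close>
    define e' where "e' = e / (10 * A + 1)"
    have e': "0 < e'" using e A by (simp add: e'_def)
    obtain \<phi> where \<phi>: "ball_test r \<phi>" "l2norm lebesgue (lcomb f (-1) \<phi>) < e'"
      using ball_test_dense[OF r f f_supp e'] by blast
    note \<phi>L = ball_test_L2[OF \<phi>(1)]
    define g where "g = lcomb f (-1) \<phi>"
    have g: "g \<in> L2 lebesgue" unfolding g_def by (intro lcomb_in_L2 f \<phi>L)
    have g_supp: "g x = 0" if "x \<notin> cball 0 r" for x
      using f_supp[OF that] \<phi>(1) that by (simp add: g_def lcomb_def ball_test_def)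
    define N where "N t = (\<integral>x. u x * (t ^ 3 * \<phi> (t *\<^sub>R x)) \<partial>lebesgue)" for t
    have "(N has_real_derivative - l2ip lebesgue D \<phi>) (at 1)"
      using has_real_derivative_dilated_pairing[OF \<phi>(1), of 1] dilated_pairing_derivative_eq[OF \<phi>(1), of 1]
      unfolding N_def l2ip_def by simp
    from quot[OF this] have Nlim: "(\<lambda>n. 2 * ((N (\<tau> n) - N 1) / (\<tau> n - 1)) - 8 * A * e') \<longlonglongrightarrow> 2 * (- l2ip lebesgue D \<phi>) - 8 * A * e'"
      by (intro tendsto_intros)
    have "2 * (- l2ip lebesgue D \<phi>) - 8 * A * e' \<le> I"
    proof (rule LIMSEQ_le[OF Nlim quot[OF J1]], intro exI allI impI)
      fix n :: nat
      have t: "1 < \<tau> n" "\<tau> n \<le> 2" "0 < \<tau> n" using \<tau>[of n] by linarith+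
      have dL: "dilation_diff (\<tau> n) \<in> L2 lebesgue" by (rule dilation_diff_L2[OF t(3)])
      have 1: "l2ip lebesgue (dilation_diff (\<tau> n)) \<phi> = N (\<tau> n) - N 1"
        using l2ip_lcomb[OF L2_dilation[OF _ u] u \<phi>L, of "1 / \<tau> n" "-1"] dilated_pairing[OF \<phi>L, of "\<tau> n"] t
        by (simp add: N_def l2ip_def)
      have 2: "l2ip lebesgue (dilation_diff (\<tau> n)) f = l2ip lebesgue (dilation_diff (\<tau> n)) \<phi> + l2ip lebesgue (dilation_diff (\<tau> n)) g"
        using L2.ip_comb_right[OF f \<phi>L dL, of "-1"] by (simp add: g_def)
      have "\<bar>l2ip lebesgue (dilation_diff (\<tau> n)) g\<bar> \<le> 4 * (\<tau> n - 1) * A * l2norm lebesgue g"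
        unfolding A_def using t by (intro dilation_diff_bound g g_supp) auto
      also have "\<dots> \<le> 4 * (\<tau> n - 1) * A * e'" using \<phi>(2) A t by (intro mult_left_mono) (auto simp: g_def)
      finally have 3: "- (4 * A * e') * (\<tau> n - 1) \<le> l2ip lebesgue (dilation_diff (\<tau> n)) g" by (simp add: algebra_simps)
      have "2 * (N (\<tau> n) - N 1) - 8 * A * e' * (\<tau> n - 1) \<le> J (\<tau> n) - J 1"
        using key[OF t(1,2)] 1 2 3 by simp
      then have "(2 * (N (\<tau> n) - N 1) - 8 * A * e' * (\<tau> n - 1)) / (\<tau> n - 1) \<le> (J (\<tau> n) - J 1) / (\<tau> n - 1)"
        using t by (intro divide_right_mono) auto
      then show "2 * ((N (\<tau> n) - N 1) / (\<tau> n - 1)) - 8 * A * e' \<le> (J (\<tau> n) - J 1) / (\<tau> n - 1)"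
        using t by (simp add: diff_divide_distrib)
    qed
    moreover have "\<bar>l2ip lebesgue D g\<bar> \<le> A * e'"
    proof -
      have "\<bar>l2ip lebesgue D g\<bar> \<le> A * l2norm lebesgue g" unfolding A_def by (rule l2ip_le_norm[OF D g])
      also have "\<dots> \<le> A * e'" using \<phi>(2) A by (intro mult_left_mono) (auto simp: g_def)
      finally show ?thesis .
    qed
    moreover have "l2ip lebesgue D f = l2ip lebesgue D \<phi> + l2ip lebesgue D g"
      using L2.ip_comb_right[OF f \<phi>L D, of "-1"] by (simp add: g_def)
    ultimately have "- 2 * l2ip lebesgue D f \<le> I + 10 * A * e'" by linarith
    also have "10 * A * e' \<le> (10 * A + 1) * e'" using e' by (intro mult_right_mono) auto
    also have "\<dots> = e" using A by (simp add: e'_def)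
    finally show "- 2 * l2ip lebesgue D f \<le> I + e" by simp
  qed
  then show ?thesis by (simp add: I_def l2ip_def f_def)
qed

end

section \<open>The weighted spaces\<close>

definition wdens :: "real \<Rightarrow> real^3 \<Rightarrow> real" where
  "wdens s q = indicator Omega q * wt s q"

definition wmeas :: "real \<Rightarrow> (real^3) measure" where
  "wmeas s = density lebesgue (\<lambda>q. ennreal (wdens s q))"

text \<open>On the unit sphere the weight is 0 powr s, which is 0 for every \<open>s\<close>, so the
  closed and the open ball give the same density.\<close>

lemma wdens_eq: "wdens s q = (if norm q < 1 then wt s q else 0)"
  by (auto simp: wdens_def Omega_def indicator_def wt_def)

lemma wdens_nonneg [simp]: "0 \<le> wdens s q"
  by (simp add: wdens_def wt_def)

lemma norm_square_less_one: "norm q < 1 \<Longrightarrow> (norm q)\<^sup>2 < 1" for q :: "'a::real_normed_vector"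
  by (simp add: power_less_one_iff)

lemma wt_pos: "norm q < 1 \<Longrightarrow> 0 < wt s q"
  using norm_square_less_one[of q] by (simp add: wt_def)

lemma lebesgue_measurable_id [measurable]: "(\<lambda>q::real^3. q) \<in> borel_measurable lebesgue"
  by (rule continuous_lebesgue_measurable) simp

lemma wt_measurable [measurable]: "wt s \<in> borel_measurable lebesgue"
  unfolding wt_def by measurable

lemma Omega_measurable [measurable]: "Omega \<in> sets lebesgue"
  by (simp add: Omega_def)

lemma wdens_measurable [measurable]: "wdens s \<in> borel_measurable lebesgue"
  unfolding wdens_def by measurable

lemma sets_wmeas [simp, measurable_cong]: "sets (wmeas s) = sets lebesgue"
  by (simp add: wmeas_def)

lemma space_wmeas [simp]: "space (wmeas s) = UNIV"
  by (simp add: wmeas_def)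

lemma measurable_wmeas [simp]: "borel_measurable (wmeas s) = borel_measurable lebesgue"
  by (rule measurable_cong_sets) auto

lemma AE_wmeas: "AE q in wmeas s. norm q < 1"
  unfolding wmeas_def by (subst AE_density) (auto simp: wdens_eq)

lemma integrable_wmeas:
  fixes f :: "real^3 \<Rightarrow> real"
  shows "f \<in> borel_measurable lebesgue \<Longrightarrow> integrable (wmeas s) f \<longleftrightarrow> integrable lebesgue (\<lambda>q. wdens s q * f q)"
  unfolding wmeas_def by (subst integrable_density) auto

lemma integral_wmeas:
  fixes f :: "real^3 \<Rightarrow> real"
  shows "f \<in> borel_measurable lebesgue \<Longrightarrow> (\<integral>q. f q \<partial>wmeas s) = (\<integral>q. wdens s q * f q \<partial>lebesgue)"
  unfolding wmeas_def by (subst integral_density) auto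

lemma L2_wmeas_iff:
  fixes f :: "real^3 \<Rightarrow> 'b::euclidean_space"
  shows "f \<in> L2 (wmeas s) \<longleftrightarrow> f \<in> borel_measurable lebesgue \<and>
     (\<integral>\<^sup>+ q. indicator Omega q * ennreal ((norm (f q))\<^sup>2 * wt s q) \<partial>lebesgue) < \<infinity>"
proof (cases "f \<in> borel_measurable lebesgue")
  case True
  note [measurable] = True
  have eq: "ennreal (norm (wdens s q * (norm (f q))\<^sup>2)) = indicator Omega q * ennreal ((norm (f q))\<^sup>2 * wt s q)" for q
    by (auto simp: wdens_def indicator_def wt_def abs_mult mult.commute)
  have m: "(\<lambda>q. (norm (f q))\<^sup>2) \<in> borel_measurable lebesgue" by measurable
  have "f \<in> L2 (wmeas s) \<longleftrightarrow> integrable lebesgue (\<lambda>q. wdens s q * (norm (f q))\<^sup>2)"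
    using True integrable_wmeas[OF m] by (simp add: L2_def)
  also have "\<dots> \<longleftrightarrow> (\<integral>\<^sup>+ q. ennreal (norm (wdens s q * (norm (f q))\<^sup>2)) \<partial>lebesgue) < \<infinity>"
    unfolding integrable_iff_bounded by simp
  finally show ?thesis unfolding eq using True by simp
qed (simp add: L2_def)

lemma L2w_iff: "L2w s u \<longleftrightarrow> u \<in> L2 (wmeas s)"
  by (simp add: L2w_def L2_wmeas_iff)

lemma L2wv_iff: "L2wv s G \<longleftrightarrow> G \<in> L2 (wmeas s)"
  by (simp add: L2wv_def L2_wmeas_iff)

text \<open>Both sides are the same Bochner integral with the density written inside or outside, so
  measurability suffices. The identity can therefore be used for the convection term before any
  integrability is discussed.\<close>

lemma winner_eq:
  assumes "u \<in> borel_measurable lebesgue" "v \<in> borel_measurable lebesgue"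
  shows "winner s u v = l2ip (wmeas s) u v"
  using assms by (auto simp: winner_def set_lebesgue_integral_def l2ip_def integral_wmeas wdens_def mult_ac
      intro!: Bochner_Integration.integral_cong)

lemma winnerv_eq:
  assumes [measurable]: "u \<in> borel_measurable lebesgue" "v \<in> borel_measurable lebesgue"
  shows "winnerv s u v = l2ip (wmeas s) u v"
  using assms by (auto simp: winnerv_def set_lebesgue_integral_def l2ip_def integral_wmeas wdens_def mult_ac
      intro!: Bochner_Integration.integral_cong)

lemma L2_Pair_iff:
  fixes u :: "'a \<Rightarrow> 'b::euclidean_space" and G :: "'a \<Rightarrow> 'c::euclidean_space"
  shows "(\<lambda>q. (u q, G q)) \<in> L2 M \<longleftrightarrow> u \<in> L2 M \<and> G \<in> L2 M"
proof
  assume *: "(\<lambda>q. (u q, G q)) \<in> L2 M"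
  have m: "u \<in> borel_measurable M" "G \<in> borel_measurable M"
    using measurable_compose[OF L2_measurable[OF *], of fst borel] measurable_compose[OF L2_measurable[OF *], of snd borel]
    by (auto simp: borel_prod[symmetric])
  show "u \<in> L2 M \<and> G \<in> L2 M"
    using m by (auto intro!: L2_bound[OF *, where C = 1] AE_I2 simp: norm_Pair real_le_rsqrt)
next
  assume "u \<in> L2 M \<and> G \<in> L2 M"
  then show "(\<lambda>q. (u q, G q)) \<in> L2 M"
    by (auto simp: L2_def norm_Pair)
qed

lemma l2ip_Pair:
  assumes "u \<in> L2 M" "v \<in> L2 M" "G \<in> L2 M" "H \<in> L2 M"
  shows "l2ip M (\<lambda>q. (u q, G q)) (\<lambda>q. (v q, H q)) = l2ip M u v + l2ip M G H"
  using L2_inner_integrable[OF assms(1,2)] L2_inner_integrable[OF assms(3,4)]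
  by (simp add: l2ip_def inner_prod_def)

lemma one_in_L2_wmeas: "0 \<le> s \<Longrightarrow> (\<lambda>q. 1 :: real) \<in> L2 (wmeas s)"
proof -
  assume s: "0 \<le> s"
  have "integrable lebesgue (wdens s)"
  proof (rule Bochner_Integration.integrable_bound)
    show "integrable lebesgue (indicator Omega :: real^3 \<Rightarrow> real)"
      using emeasure_bounded_finite[of "cball (0::real^3) 1"] unfolding Omega_def by (intro integrable_real_indicator) auto
    have "wt s q \<le> 1" if "norm q < 1" for q
      using norm_square_less_one[OF that] s unfolding wt_def by (intro powr_le1) auto
    then show "AE q in lebesgue. norm (wdens s q) \<le> norm (indicator Omega q :: real)"
      using wt_pos[of _ s] by (intro AE_I2) (auto simp: wdens_eq Omega_def indicator_def less_imp_le)
  qed measurable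
  then show ?thesis by (simp add: L2_def integrable_wmeas)
qed

text \<open>Weak gradients are tested without weight, the space is weighted. On a compact subset of
  the open ball the weight is bounded below, so dividing \<eta> by it gives an element of the
  weighted \<open>L2\<close>, and the unweighted pairing becomes a weighted inner product.\<close>

lemma local_pairing:
  fixes \<eta> u :: "real^3 \<Rightarrow> real"
  assumes s: "0 \<le> s" and K: "compact K" "K \<subseteq> ball 0 1"
    and \<eta>: "\<eta> \<in> borel_measurable lebesgue" "\<forall>x\<in>K. \<bar>\<eta> x\<bar> \<le> B" "\<forall>x. x \<notin> K \<longrightarrow> \<eta> x = 0"
  shows "(\<lambda>q. \<eta> q / wt s q) \<in> L2 (wmeas s)"
    and "u \<in> L2 (wmeas s) \<Longrightarrow> integrable lebesgue (\<lambda>q. u q * \<eta> q)"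
    and "u \<in> L2 (wmeas s) \<Longrightarrow> (\<integral>q. u q * \<eta> q \<partial>lebesgue) = l2ip (wmeas s) u (\<lambda>q. \<eta> q / wt s q)"
    and "u \<in> L2 (wmeas s) \<Longrightarrow> (LINT q : ball 0 1 | lebesgue. u q * \<eta> q) = l2ip (wmeas s) u (\<lambda>q. \<eta> q / wt s q)"
proof -
  have "\<exists>c>0. \<forall>x\<in>K. c \<le> wt s x"
  proof (cases "K = {}")
    case False
    have "continuous_on K (wt s)"
      unfolding wt_def using K(2) by (intro continuous_intros) (auto dest!: norm_square_less_one subsetD)
    from continuous_attains_inf[OF K(1) False this] obtain x where "x \<in> K" "\<And>y. y \<in> K \<Longrightarrow> wt s x \<le> wt s y" by blast
    then show ?thesis using wt_pos[of x s] K(2) by (intro exI[of _ "wt s x"]) auto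
  qed (auto intro: exI[of _ 1])
  then obtain c where c: "0 < c" "\<And>x. x \<in> K \<Longrightarrow> c \<le> wt s x" by blast
  show k: "(\<lambda>q. \<eta> q / wt s q) \<in> L2 (wmeas s)"
  proof (rule L2_bound[OF one_in_L2_wmeas[OF s], where C = "\<bar>B\<bar> / c"])
    show "(\<lambda>q. \<eta> q / wt s q) \<in> borel_measurable (wmeas s)" using \<eta>(1) by simp
    have "\<bar>\<eta> q / wt s q\<bar> \<le> \<bar>B\<bar> / c" for q
    proof (cases "q \<in> K")
      case True
      then show ?thesis using c(1) c(2)[OF True] \<eta>(2) True by (auto intro!: frac_le)
    qed (use \<eta>(3) c in simp)
    then show "AE q in wmeas s. norm (\<eta> q / wt s q) \<le> \<bar>B\<bar> / c * norm (1::real)" by simp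
  qed
  assume u: "u \<in> L2 (wmeas s)"
  then have um: "u \<in> borel_measurable lebesgue" using L2_measurable[OF u] by simp
  have eq: "wdens s q * (u q * (\<eta> q / wt s q)) = u q * \<eta> q" for q
    using \<eta>(3) wt_pos[of q s] K(2) by (cases "q \<in> K") (auto simp: wdens_eq)
  have eqi: "indicator (ball 0 1) q * (u q * \<eta> q) = u q * \<eta> q" for q
    using \<eta>(3) K(2) by (cases "q \<in> K") (auto simp: indicator_def)
  have m: "(\<lambda>q. u q * (\<eta> q / wt s q)) \<in> borel_measurable lebesgue" using um \<eta>(1) by simp
  show "integrable lebesgue (\<lambda>q. u q * \<eta> q)"
    using L2_mult_integrable[OF u k] unfolding integrable_wmeas[OF m] eq .
  show i: "(\<integral>q. u q * \<eta> q \<partial>lebesgue) = l2ip (wmeas s) u (\<lambda>q. \<eta> q / wt s q)"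
    using integral_wmeas[OF m, of s] unfolding eq by (simp add: l2ip_def)
  show "(LINT q : ball 0 1 | lebesgue. u q * \<eta> q) = l2ip (wmeas s) u (\<lambda>q. \<eta> q / wt s q)"
    unfolding i[symmetric] set_lebesgue_integral_def real_scaleR_def eqi ..
qed

lemma L2_wmeas_loc_int:
  assumes "0 \<le> s" "u \<in> L2 (wmeas s)" shows "loc_int u"
  unfolding loc_int_def
proof (intro allI impI)
  fix K :: "(real^3) set" assume K: "compact K \<and> K \<subseteq> ball 0 1"
  then have "K \<in> sets lebesgue" by (simp add: borel_compact)
  then have "integrable lebesgue (\<lambda>q. u q * indicator K q)"
    using K assms by (intro local_pairing(2)[where K = K and s = s and B = 1]) (auto simp: indicator_def)
  then show "set_integrable lebesgue K u" by (simp add: set_integrable_def mult.commute)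
qed

section \<open>The weighted Sobolev space as a closed subspace\<close>

lemma smooth_fun_continuous: "smooth_fun \<phi> \<Longrightarrow> continuous_on S \<phi>"
  by (meson continuous_at_imp_continuous_on differentiable_imp_continuous_within smooth_fun.cases)

lemma smooth_fun_frechet: "smooth_fun \<phi> \<Longrightarrow> smooth_fun (\<lambda>x. frechet_derivative \<phi> (at x) v)"
  by (erule smooth_fun.cases) simp

lemma test_fun_bounds:
  assumes "test_fun \<phi>"
  obtains K B where "compact K" "K \<subseteq> ball 0 1"
    "\<phi> \<in> borel_measurable lebesgue" "\<And>x. x \<in> K \<Longrightarrow> \<bar>\<phi> x\<bar> \<le> B" "\<And>x. x \<notin> K \<Longrightarrow> \<phi> x = 0"
    "(\<lambda>x. frechet_derivative \<phi> (at x) v) \<in> borel_measurable lebesgue"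
    "\<And>x. x \<in> K \<Longrightarrow> \<bar>frechet_derivative \<phi> (at x) v\<bar> \<le> B"
    "\<And>x. x \<notin> K \<Longrightarrow> frechet_derivative \<phi> (at x) v = 0"
proof -
  obtain K where sm: "smooth_fun \<phi>" and K: "compact K" "K \<subseteq> ball 0 1" and z: "\<And>x. x \<notin> K \<Longrightarrow> \<phi> x = 0"
    using assms unfolding test_fun_def by blast
  let ?d = "\<lambda>x. frechet_derivative \<phi> (at x) v"
  have c: "continuous_on S \<phi>" "continuous_on S ?d" for S
    using sm by (intro smooth_fun_continuous smooth_fun_frechet; assumption)+
  have "bounded (\<phi> ` K)" "bounded (?d ` K)"
    by (intro compact_imp_bounded compact_continuous_image c K)+
  then obtain B1 B2 where "\<And>x. x \<in> K \<Longrightarrow> \<bar>\<phi> x\<bar> \<le> B1" "\<And>x. x \<in> K \<Longrightarrow> \<bar>?d x\<bar> \<le> B2"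
    unfolding bounded_iff by (metis (no_types, lifting) image_eqI real_norm_def)
  then have B: "\<And>x. x \<in> K \<Longrightarrow> \<bar>\<phi> x\<bar> \<le> max B1 B2" "\<And>x. x \<in> K \<Longrightarrow> \<bar>?d x\<bar> \<le> max B1 B2"
    by (meson le_max_iff_disj)+
  have dz: "?d x = 0" if x: "x \<notin> K" for x
  proof -
    have "((\<lambda>_. 0) has_derivative (\<lambda>_. 0)) (at x)" by simp
    then have "(\<phi> has_derivative (\<lambda>_. 0)) (at x)"
      by (rule has_derivative_transform_within_open[of _ _ _ _ "- K"])
        (use x z compact_imp_closed[OF K(1)] in \<open>auto simp: open_Compl\<close>)
    then have "(\<lambda>_. 0) = frechet_derivative \<phi> (at x)" by (rule frechet_derivative_at)
    then show ?thesis by metis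
  qed
  show ?thesis
    using that[OF K continuous_lebesgue_measurable[OF c(1)] B(1) z continuous_lebesgue_measurable[OF c(2)] B(2) dz] by blast
qed

text \<open>The gradient is the second component of each element, so the Sobolev inner product is
  simply \<open>l2ip\<close> of functions with values in R x R^3, and \<open>riesz_fischer\<close>
  applies to it directly.\<close>

definition H1_space :: "real \<Rightarrow> (real^3 \<Rightarrow> real \<times> (real^3)) set" where
  "H1_space s = {f \<in> L2 (wmeas s). weak_grad (\<lambda>q. fst (f q)) (\<lambda>q. snd (f q))}"

lemma H1w_iff: "H1w s u G \<longleftrightarrow> (\<lambda>q. (u q, G q)) \<in> H1_space s"
  by (auto simp: H1w_def H1_space_def L2w_iff L2wv_iff L2_Pair_iff)

lemma L2_fst_snd:
  assumes "f \<in> L2 M"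
  shows "(\<lambda>q. fst (f q)) \<in> L2 M" "(\<lambda>q. snd (f q)) \<in> L2 M"
  using assms L2_Pair_iff[of "\<lambda>q. fst (f q)" "\<lambda>q. snd (f q)" M] by simp_all

text \<open>Testing a weak gradient against \<open>\<phi>\<close> in direction i is orthogonality to a fixed element of the weighted
  \<open>L\<^sup>2\<close> space, so that \<open>H\<^sup>1\<^sub>s\<close> is an orthogonal complement and hence closed.\<close>

definition grad_kernel :: "real \<Rightarrow> (real^3 \<Rightarrow> real) \<Rightarrow> 3 \<Rightarrow> real^3 \<Rightarrow> real \<times> (real^3)" where
  "grad_kernel s \<phi> i q = (frechet_derivative \<phi> (at q) (axis i 1) / wt s q, (\<phi> q / wt s q) *\<^sub>R axis i 1)"

lemma L2_nth:
  fixes G :: "'a \<Rightarrow> real^3"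
  assumes "G \<in> L2 M" shows "(\<lambda>x. G x $ i) \<in> L2 M"
proof (rule L2_bound[OF assms, where C = 1])
  show "(\<lambda>x. G x $ i) \<in> borel_measurable M"
    by (intro measurable_compose[OF L2_measurable[OF assms]] borel_measurable_continuous_onI continuous_intros)
qed (simp add: component_le_norm_cart)

lemma grad_kernel:
  assumes s: "0 \<le> s" and \<phi>: "test_fun \<phi>"
  shows "grad_kernel s \<phi> i \<in> L2 (wmeas s)"
    and "f \<in> L2 (wmeas s) \<Longrightarrow> l2ip (wmeas s) f (grad_kernel s \<phi> i)
      = (LINT x : ball 0 1 | lebesgue. fst (f x) * frechet_derivative \<phi> (at x) (axis i 1))
        + (LINT x : ball 0 1 | lebesgue. snd (f x) $ i * \<phi> x)"
proof -
  obtain K B where K: "compact K" "K \<subseteq> ball 0 1"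
    and p: "\<phi> \<in> borel_measurable lebesgue" "\<And>x. x \<in> K \<Longrightarrow> \<bar>\<phi> x\<bar> \<le> B" "\<And>x. x \<notin> K \<Longrightarrow> \<phi> x = 0"
    and d: "(\<lambda>x. frechet_derivative \<phi> (at x) (axis i 1)) \<in> borel_measurable lebesgue"
      "\<And>x. x \<in> K \<Longrightarrow> \<bar>frechet_derivative \<phi> (at x) (axis i 1)\<bar> \<le> B"
      "\<And>x. x \<notin> K \<Longrightarrow> frechet_derivative \<phi> (at x) (axis i 1) = 0"
    using test_fun_bounds[OF \<phi>, of "axis i 1"] by blast
  have p': "\<forall>x\<in>K. \<bar>\<phi> x\<bar> \<le> B" "\<forall>x. x \<notin> K \<longrightarrow> \<phi> x = 0" using p by auto
  have d': "\<forall>x\<in>K. \<bar>frechet_derivative \<phi> (at x) (axis i 1)\<bar> \<le> B"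
    "\<forall>x. x \<notin> K \<longrightarrow> frechet_derivative \<phi> (at x) (axis i 1) = 0" using d by auto
  note P = local_pairing[OF s K p(1) p'] and Q = local_pairing[OF s K d(1) d']
  have ax: "(\<lambda>q. (\<phi> q / wt s q) *\<^sub>R axis i 1 :: real^3) \<in> L2 (wmeas s)"
    using p(1) by (intro L2_bound[OF P(1), where C = 1]) auto
  show "grad_kernel s \<phi> i \<in> L2 (wmeas s)"
    unfolding grad_kernel_def[abs_def] L2_Pair_iff using Q(1) ax by simp
  assume f: "f \<in> L2 (wmeas s)"
  have "l2ip (wmeas s) (\<lambda>q. snd (f q)) (\<lambda>q. (\<phi> q / wt s q) *\<^sub>R axis i 1)
      = l2ip (wmeas s) (\<lambda>q. snd (f q) $ i) (\<lambda>q. \<phi> q / wt s q)"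
    by (simp add: l2ip_def inner_axis mult.commute)
  then show "l2ip (wmeas s) f (grad_kernel s \<phi> i)
      = (LINT x : ball 0 1 | lebesgue. fst (f x) * frechet_derivative \<phi> (at x) (axis i 1))
        + (LINT x : ball 0 1 | lebesgue. snd (f x) $ i * \<phi> x)"
    using l2ip_Pair[OF L2_fst_snd(1)[OF f] Q(1) L2_fst_snd(2)[OF f] ax]
      P(4)[OF L2_nth[OF L2_fst_snd(2)[OF f]]] Q(4)[OF L2_fst_snd(1)[OF f]]
    by (simp add: grad_kernel_def[abs_def])
qed

lemma H1_space_iff:
  assumes s: "0 \<le> s"
  shows "f \<in> H1_space s \<longleftrightarrow> f \<in> L2 (wmeas s) \<and>
    (\<forall>\<phi> i. test_fun \<phi> \<longrightarrow> l2ip (wmeas s) f (grad_kernel s \<phi> i) = 0)"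
proof (cases "f \<in> L2 (wmeas s)")
  case True
  have "loc_int (\<lambda>q. fst (f q))" "loc_int (\<lambda>q. snd (f q) $ i)" for i
    using True by (auto intro!: L2_wmeas_loc_int[OF s] L2_nth L2_fst_snd)
  then show ?thesis
    using True grad_kernel(2)[OF s _ True] by (auto simp: H1_space_def weak_grad_def eq_neg_iff_add_eq_0)
qed (simp add: H1_space_def)

lemma semi_hilbert_H1:
  assumes s: "0 \<le> s" shows "semi_hilbert (H1_space s) lcomb (l2ip (wmeas s))"
proof (rule semi_hilbert_subspace)
  have "(\<lambda>q. 0) \<in> H1_space s" by (auto simp: H1_space_iff[OF s] l2ip_def)
  then show "H1_space s \<noteq> {}" by blast
  show "H1_space s \<subseteq> L2 (wmeas s)" by (auto simp: H1_space_def)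
  show "lcomb x c y \<in> H1_space s" if "x \<in> H1_space s" "y \<in> H1_space s" for x y c
    using that grad_kernel(1)[OF s] by (auto simp: H1_space_iff[OF s] lcomb_in_L2 l2ip_lcomb)
  fix X f assume X: "\<And>n::nat. X n \<in> H1_space s" and f: "f \<in> L2 (wmeas s)"
    and l: "(\<lambda>n. l2ip (wmeas s) (lcomb (X n) (-1) f) (lcomb (X n) (-1) f)) \<longlonglongrightarrow> 0"
  have "l2ip (wmeas s) f (grad_kernel s \<phi> i) = 0" if \<phi>: "test_fun \<phi>" for \<phi> i
  proof -
    let ?k = "grad_kernel s \<phi> i"
    have k: "?k \<in> L2 (wmeas s)" by (rule grad_kernel(1)[OF s \<phi>])
    have XL: "X n \<in> L2 (wmeas s)" for n using X by (simp add: H1_space_def)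
    have "(l2ip (wmeas s) f ?k)\<^sup>2 \<le> l2ip (wmeas s) (lcomb (X n) (-1) f) (lcomb (X n) (-1) f) * l2ip (wmeas s) ?k ?k" for n
    proof -
      \<comment> \<open>Every \<open>X n\<close> is orthogonal to the kernel, so only the distance
        from \<open>X n\<close> to \<open>f\<close> contributes.\<close>
      have "l2ip (wmeas s) (lcomb (X n) (-1) f) ?k = - l2ip (wmeas s) f ?k"
        using X[of n] \<phi> l2ip_lcomb[OF XL f k, of n "-1"] by (simp add: H1_space_iff[OF s])
      then show ?thesis using L2.cauchy_schwarz[OF lcomb_in_L2[OF XL f] k, of n "-1"] by simp
    qed
    then have "(l2ip (wmeas s) f ?k)\<^sup>2 \<le> 0 * l2ip (wmeas s) ?k ?k"
      by (intro LIMSEQ_le_const[OF tendsto_mult_right[OF l]]) auto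
    then show ?thesis by simp
  qed
  then show "f \<in> H1_space s" using f by (simp add: H1_space_iff[OF s])
qed

section \<open>A Hardy inequality and the convection term\<close>

text \<open>The boundary weight \<open>(1 - |q|\<^sup>2) powr (s - 1)\<close> is regularised by the factor
  \<open>(cutoff \<delta> w)\<^sup>2\<close> with \<open>w = 1 - |q|\<^sup>2\<close>, which vanishes for \<open>w \<le> \<delta>\<close> and keeps it continuously differentiable.\<close>

definition cutoff :: "real \<Rightarrow> real \<Rightarrow> real" where
  "cutoff \<delta> w = max 0 (1 - \<delta> / w)"

text \<open>This is the regularised weight (\<open>cutoff \<delta> w\<close>)^2 w^(s-1), rewritten
  so that it makes sense for every real w: the \<open>max\<close> keeps the base of the power at
  least \<delta>, also for the negative w that occur outside the unit ball.\<close>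

definition pcut :: "real \<Rightarrow> real \<Rightarrow> real \<Rightarrow> real" where
  "pcut s \<delta> w = (max 0 (w - \<delta>))\<^sup>2 * max \<delta> w powr (s - 3)"

definition pcut' :: "real \<Rightarrow> real \<Rightarrow> real \<Rightarrow> real" where
  "pcut' s \<delta> w = 2 * max 0 (w - \<delta>) * max \<delta> w powr (s - 3)
     + (max 0 (w - \<delta>))\<^sup>2 * ((s - 3) * max \<delta> w powr (s - 4))"

lemma has_real_derivative_pos_part_square:
  "((\<lambda>x. (max 0 (x - c))\<^sup>2) has_real_derivative 2 * max 0 (w - c)) (at (w::real))"
proof -
  consider "w < c" | "w = c" | "w > c" by linarith
  then show ?thesis
  proof cases
    case 1
    have "((\<lambda>_. 0) has_real_derivative 0) (at w)" by simp
    then have "((\<lambda>x. (max 0 (x - c))\<^sup>2) has_real_derivative 0) (at w)"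
      by (rule has_field_derivative_transform_within_open[of _ _ _ "{..<c}"]) (use 1 in auto)
    then show ?thesis using 1 by simp
  next
    case 2
    have "((\<lambda>h. (max 0 h)\<^sup>2 / h) \<longlongrightarrow> 0) (at (0::real))"
    proof (rule Lim_null_comparison)
      show "\<forall>\<^sub>F h in at (0::real). norm ((max 0 h)\<^sup>2 / h) \<le> \<bar>h\<bar>"
        by (intro always_eventually allI) (auto simp: max_def power2_eq_square)
      show "((\<lambda>h. \<bar>h\<bar>) \<longlongrightarrow> 0) (at (0::real))" by (rule tendsto_rabs_zero) simp
    qed
    then show ?thesis using 2 by (simp add: DERIV_def)
  next
    case 3
    have "((\<lambda>x. (x - c)\<^sup>2) has_real_derivative 2 * (w - c)) (at w)" by (auto intro!: derivative_eq_intros)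
    then have "((\<lambda>x. (max 0 (x - c))\<^sup>2) has_real_derivative 2 * (w - c)) (at w)"
      by (rule has_field_derivative_transform_within_open[of _ _ _ "{c<..}"]) (use 3 in auto)
    then show ?thesis using 3 by simp
  qed
qed

lemma has_real_derivative_pcut:
  assumes \<delta>: "0 < \<delta>"
  shows "(pcut s \<delta> has_real_derivative pcut' s \<delta> w) (at w)"
proof (cases "w < \<delta>")
  case True
  have "((\<lambda>_. 0) has_real_derivative 0) (at w)" by simp
  then have "(pcut s \<delta> has_real_derivative 0) (at w)"
    by (rule has_field_derivative_transform_within_open[of _ _ _ "{..<\<delta>}"]) (use True in \<open>auto simp: pcut_def\<close>)
  then show ?thesis using True by (simp add: pcut'_def)
next
  case False
  then have w: "0 < w" using \<delta> by simp
  have "((\<lambda>x. x powr (s - 3)) has_real_derivative (s - 3) * w powr (s - 3 - 1)) (at w)"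
    using w by (rule has_real_derivative_powr)
  from DERIV_mult[OF has_real_derivative_pos_part_square this]
  have "((\<lambda>x. (max 0 (x - \<delta>))\<^sup>2 * x powr (s - 3)) has_real_derivative pcut' s \<delta> w) (at w)"
    by (rule DERIV_cong) (use False in \<open>simp add: pcut'_def max_def algebra_simps\<close>)
  then show ?thesis
    by (rule has_field_derivative_transform_within_open[of _ _ _ "{0<..}"])
      (use w in \<open>auto simp: pcut_def max_def\<close>)
qed

lemma continuous_pcut': "0 < \<delta> \<Longrightarrow> continuous_on UNIV (pcut' s \<delta>)"
  unfolding pcut'_def by (intro continuous_intros) auto

lemma cutoff_le:
  assumes "0 < \<delta>" "0 < w"
  shows "0 \<le> cutoff \<delta> w" "cutoff \<delta> w \<le> 1" "(cutoff \<delta> w)\<^sup>2 \<le> cutoff \<delta> w"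
    "cutoff \<delta> w / w \<le> 1 / \<delta>"
proof -
  show 1: "0 \<le> cutoff \<delta> w" "cutoff \<delta> w \<le> 1" using assms by (auto simp: cutoff_def)
  then show "(cutoff \<delta> w)\<^sup>2 \<le> cutoff \<delta> w" by (simp add: power2_eq_square mult_left_le)
  show "cutoff \<delta> w / w \<le> 1 / \<delta>"
  proof (cases "w \<le> \<delta>")
    case True then show ?thesis using assms by (simp add: cutoff_def max_def divide_le_eq)
  next
    case False then show ?thesis using assms 1 by (intro frac_le) auto
  qed
qed

text \<open>Where the cutoff \<theta> is positive, \<theta> = 1 - \<delta>/w has derivative (1 -
  \<theta>)/w. The product rule for \<theta>^2 w^(s-1) then gives w^(s-2) (2 \<theta> (1 - \<theta>)
  + (s-1) \<theta>^2), which is the second formula.\<close>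

lemma pcut_eq:
  assumes \<delta>: "0 < \<delta>" and w: "0 < w"
  shows "pcut s \<delta> w = w powr s * ((cutoff \<delta> w)\<^sup>2 / w)"
    and "pcut' s \<delta> w = w powr s * ((2 * cutoff \<delta> w + (s - 3) * (cutoff \<delta> w)\<^sup>2) / w\<^sup>2)"
proof -
  have p3: "w powr (s - 3) = w powr s / w ^ 3" and p4: "w powr (s - 4) = w powr s / w ^ 4"
    using w by (simp_all add: powr_diff)
  have eq: "max 0 (w - \<delta>) = w * cutoff \<delta> w" "max \<delta> w = w \<or> cutoff \<delta> w = 0"
    using w by (auto simp: cutoff_def max_def field_simps)
  show "pcut s \<delta> w = w powr s * ((cutoff \<delta> w)\<^sup>2 / w)"
    using eq(2) w unfolding pcut_def eq(1)
    by (auto simp: p3 power2_eq_square power3_eq_cube field_simps)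
  show "pcut' s \<delta> w = w powr s * ((2 * cutoff \<delta> w + (s - 3) * (cutoff \<delta> w)\<^sup>2) / w\<^sup>2)"
    using eq(2) w unfolding pcut'_def eq(1)
    by (auto simp: p3 p4 power2_eq_square power3_eq_cube power4_eq_xxxx field_simps)
qed

lemma H1_test_integral:
  assumes s: "0 \<le> s" and f: "f \<in> H1_space s" and \<phi>: "test_fun \<phi>"
  shows "integrable lebesgue (\<lambda>x. fst (f x) * frechet_derivative \<phi> (at x) (axis i 1))"
    and "integrable lebesgue (\<lambda>x. snd (f x) $ i * \<phi> x)"
    and "(\<integral>x. fst (f x) * frechet_derivative \<phi> (at x) (axis i 1) \<partial>lebesgue) = - (\<integral>x. snd (f x) $ i * \<phi> x \<partial>lebesgue)"
proof -
  obtain K B where K: "compact K" "K \<subseteq> ball 0 1"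
    and p: "\<phi> \<in> borel_measurable lebesgue" "\<And>x. x \<in> K \<Longrightarrow> \<bar>\<phi> x\<bar> \<le> B" "\<And>x. x \<notin> K \<Longrightarrow> \<phi> x = 0"
    and d: "(\<lambda>x. frechet_derivative \<phi> (at x) (axis i 1)) \<in> borel_measurable lebesgue"
      "\<And>x. x \<in> K \<Longrightarrow> \<bar>frechet_derivative \<phi> (at x) (axis i 1)\<bar> \<le> B"
      "\<And>x. x \<notin> K \<Longrightarrow> frechet_derivative \<phi> (at x) (axis i 1) = 0"
    using test_fun_bounds[OF \<phi>, of "axis i 1"] by blast
  have p': "\<forall>x\<in>K. \<bar>\<phi> x\<bar> \<le> B" "\<forall>x. x \<notin> K \<longrightarrow> \<phi> x = 0" using p by auto
  have d': "\<forall>x\<in>K. \<bar>frechet_derivative \<phi> (at x) (axis i 1)\<bar> \<le> B"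
    "\<forall>x. x \<notin> K \<longrightarrow> frechet_derivative \<phi> (at x) (axis i 1) = 0" using d by auto
  note P = local_pairing[OF s K p(1) p'] and Q = local_pairing[OF s K d(1) d']
  have L: "(\<lambda>q. fst (f q)) \<in> L2 (wmeas s)" "(\<lambda>q. snd (f q) $ i) \<in> L2 (wmeas s)"
    using f by (auto simp: H1_space_def intro: L2_fst_snd L2_nth)
  show "integrable lebesgue (\<lambda>x. fst (f x) * frechet_derivative \<phi> (at x) (axis i 1))"
    "integrable lebesgue (\<lambda>x. snd (f x) $ i * \<phi> x)" using P(2)[OF L(2)] Q(2)[OF L(1)] by simp_all
  have "(LINT x : ball 0 1 | lebesgue. fst (f x) * frechet_derivative \<phi> (at x) (axis i 1))
        = - (LINT x : ball 0 1 | lebesgue. snd (f x) $ i * \<phi> x)"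
    using f \<phi> by (simp add: H1_space_def weak_grad_def)
  then show "(\<integral>x. fst (f x) * frechet_derivative \<phi> (at x) (axis i 1) \<partial>lebesgue) = - (\<integral>x. snd (f x) $ i * \<phi> x \<partial>lebesgue)"
    using P(3,4)[OF L(2)] Q(3,4)[OF L(1)] by simp
qed

text \<open>On a ball of radius r < 1 the weight is at least (1 - r^2)^s. Restriction thus leads
  from the weighted space to the unweighted setting of the dilation argument.\<close>

lemma L2_wmeas_restrict:
  fixes g :: "real^3 \<Rightarrow> real"
  assumes s: "0 \<le> s" and g: "g \<in> L2 (wmeas s)" and r: "r < 1"
  shows "(\<lambda>x. indicator (cball 0 r) x * g x) \<in> L2 lebesgue"
proof -
  have gm [measurable]: "g \<in> borel_measurable lebesgue" using L2_measurable[OF g] by simp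
  have [measurable]: "cball (0::real^3) r \<in> sets lebesgue" by simp
  have m: "(\<lambda>x. (g x)\<^sup>2) \<in> borel_measurable lebesgue" by measurable
  define c where "c = (1 - r\<^sup>2) powr s"
  have i: "integrable lebesgue (\<lambda>x. wdens s x * (g x)\<^sup>2)"
    using L2_integrable_square[OF g] integrable_wmeas[OF m, of s] by simp
  have "integrable lebesgue (\<lambda>x. (norm (indicator (cball 0 r) x * g x))\<^sup>2)"
  proof (rule Bochner_Integration.integrable_bound)
    show "integrable lebesgue (\<lambda>x. (1 / c) * (wdens s x * (g x)\<^sup>2))" using i by (rule integrable_mult_right)
    show "AE x in lebesgue. norm ((norm (indicator (cball 0 r) x * g x))\<^sup>2) \<le> norm ((1 / c) * (wdens s x * (g x)\<^sup>2))"
    proof (rule AE_I2)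
      fix x :: "real^3"
      show "norm ((norm (indicator (cball 0 r) x * g x))\<^sup>2) \<le> norm ((1 / c) * (wdens s x * (g x)\<^sup>2))"
      proof (cases "norm x \<le> r")
        case True
        then have r0: "0 \<le> r" using norm_ge_zero[of x] by linarith
        have r2: "0 < 1 - r\<^sup>2" using power_strict_mono[OF r r0, of 2] by simp
        have "(norm x)\<^sup>2 \<le> r\<^sup>2" using True by (intro power_mono) auto
        then have "c \<le> wt s x" using r2 s unfolding c_def wt_def by (intro powr_mono2) auto
        then have "c \<le> wdens s x" using True r by (simp add: wdens_eq)
        moreover have "0 < c" using r2 by (simp add: c_def)
        ultimately have "1 \<le> wdens s x / c" by simp
        from mult_right_mono[OF this, of "(g x)\<^sup>2"] show ?thesis
          using True \<open>0 < c\<close> by (simp add: abs_mult)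
      qed simp
    qed
  qed measurable
  then show ?thesis by (simp add: L2_def)
qed

lemma L2_linear_field:
  fixes G T :: "real^3 \<Rightarrow> real^3"
  assumes G: "G \<in> L2 (wmeas s)" and T: "continuous_on UNIV T" "\<And>q. norm (T q) \<le> C * norm q" and C: "0 \<le> C"
  shows "(\<lambda>q. T q \<bullet> G q) \<in> L2 (wmeas s)" "l2norm (wmeas s) (\<lambda>q. T q \<bullet> G q) \<le> C * l2norm (wmeas s) G"
proof -
  have [measurable]: "G \<in> borel_measurable lebesgue" using L2_measurable[OF G] by simp
  have [measurable]: "T \<in> borel_measurable lebesgue" by (rule continuous_lebesgue_measurable[OF T(1)])
  have ae: "AE q in wmeas s. \<bar>T q \<bullet> G q\<bar> \<le> C * norm (G q)"
    using AE_wmeas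
  proof eventually_elim
    case (elim q)
    have "\<bar>T q \<bullet> G q\<bar> \<le> norm (T q) * norm (G q)" by (rule Cauchy_Schwarz_ineq2)
    also have "\<dots> \<le> (C * norm q) * norm (G q)" by (intro mult_right_mono T) auto
    also have "\<dots> \<le> (C * 1) * norm (G q)" using elim C by (intro mult_right_mono mult_left_mono) auto
    finally show ?case by simp
  qed
  show 1: "(\<lambda>q. T q \<bullet> G q) \<in> L2 (wmeas s)"
    by (rule L2_bound[OF G, where C = C]) (use ae in auto)
  have "l2norm (wmeas s) (\<lambda>q. T q \<bullet> G q) \<le> sqrt (\<integral>q. C\<^sup>2 * (norm (G q))\<^sup>2 \<partial>wmeas s)"
    unfolding l2norm_def l2ip_self
  proof (intro real_sqrt_le_mono integral_mono_AE L2_integrable_square 1 integrable_mult_right G)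
    show "AE q in wmeas s. (norm (T q \<bullet> G q))\<^sup>2 \<le> C\<^sup>2 * (norm (G q))\<^sup>2"
      using ae
    proof eventually_elim
      case (elim q)
      then have "\<bar>T q \<bullet> G q\<bar>\<^sup>2 \<le> (C * norm (G q))\<^sup>2" by (rule power_mono) simp
      then show ?case by (simp add: power_mult_distrib)
    qed
  qed
  also have "\<dots> = C * l2norm (wmeas s) G" using C by (simp add: l2norm_def l2ip_self real_sqrt_mult)
  finally show "l2norm (wmeas s) (\<lambda>q. T q \<bullet> G q) \<le> C * l2norm (wmeas s) G" .
qed

lemma L2_radial:
  fixes G :: "real^3 \<Rightarrow> real^3"
  assumes "G \<in> L2 (wmeas s)"
  shows "(\<lambda>q. q \<bullet> G q) \<in> L2 (wmeas s)" "l2norm (wmeas s) (\<lambda>q. q \<bullet> G q) \<le> l2norm (wmeas s) G"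
  using L2_linear_field[OF assms, of "\<lambda>q. q" 1] by auto

text \<open>This is \<open>weak_radial_energy_inequality\<close> for the weight \<open>pcut\<close>,
  composed with w = 1 - |q|^2; the chain rule for w produces the factor -2 |q|^2 = -2 (1 -
  w).\<close>

lemma H1_cutoff_energy:
  assumes s: "0 \<le> s" and f: "f \<in> H1_space s" and \<delta>: "0 < \<delta>" "\<delta> < 1"
  defines "w \<equiv> \<lambda>q::real^3. 1 - (norm q)\<^sup>2"
  defines "\<theta> \<equiv> \<lambda>q. cutoff \<delta> (w q)"
  shows "- (\<integral>q. (fst (f q))\<^sup>2 * (3 * (\<theta> q)\<^sup>2 / w q
        - 2 * (1 - w q) * (2 * \<theta> q + (s - 3) * (\<theta> q)\<^sup>2) / (w q)\<^sup>2) \<partial>wmeas s)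
      \<le> 2 * (\<integral>q. (q \<bullet> snd (f q)) * fst (f q) * ((\<theta> q)\<^sup>2 / w q) \<partial>wmeas s)"
proof -
  \<comment> \<open>The sphere of radius \<open>r\<close> is where w = \<delta>, so the cutoff
    vanishes between it and the unit sphere.\<close>
  define r where "r = sqrt (1 - \<delta>)"
  have r: "0 < r" "r < 1" "r\<^sup>2 = 1 - \<delta>" using \<delta> by (auto simp: r_def)
  have fL: "(\<lambda>q. fst (f q)) \<in> L2 (wmeas s)" "(\<lambda>q. snd (f q)) \<in> L2 (wmeas s)"
    using f by (auto simp: H1_space_def intro: L2_fst_snd)
  have [measurable]: "(\<lambda>q. fst (f q)) \<in> borel_measurable lebesgue" "(\<lambda>q. snd (f q)) \<in> borel_measurable lebesgue"
    using fL[THEN L2_measurable] by simp_all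
  \<comment> \<open>The sharp truncation creates no boundary term in \<open>weak\<close>: the test
    functions vanish for |x| >= r.\<close>
  define u where "u x = indicator (cball 0 r) x * fst (f x)" for x
  define D where "D x = indicator (cball 0 r) x * (x \<bullet> snd (f x))" for x
  have u: "u \<in> L2 lebesgue" and D: "D \<in> L2 lebesgue"
    unfolding u_def D_def using fL by (auto intro!: L2_wmeas_restrict[OF s _ r(2)] L2_radial)
  have weak: "(\<integral>x. u x * div_radial \<phi> x \<partial>lebesgue) = - (\<integral>x. D x * \<phi> x \<partial>lebesgue)" if \<phi>: "ball_test r \<phi>" for \<phi>
  proof -
    have e: "elem_smooth \<phi>" using \<phi> by (simp add: ball_test_def)
    \<comment> \<open>Testing the i-th weak derivative with x_i \<phi> and summing over i assembles
      \<open>div_radial \<phi>\<close> on one side and the radial derivative on the other.\<close>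
    define \<psi> where "\<psi> i x = x $ i * \<phi> x" for i x
    have \<psi>: "test_fun (\<psi> i)" for i
      unfolding \<psi>_def by (rule ball_test_test_fun[OF ball_test_mult[OF \<phi> elem_smooth_nth] r(2)])
    have d: "frechet_derivative (\<psi> i) (at x) (axis i 1) = \<phi> x + x $ i * frechet_derivative \<phi> (at x) (axis i 1)" for i x
    proof -
      have "((\<lambda>x. x $ i) has_derivative (\<lambda>x. x $ i)) (at x)"
        by (intro bounded_linear_imp_has_derivative bounded_linear_vec_nth)
      from has_derivative_mult[OF this elem_smooth_frechet(1)[OF e]]
      have "(\<psi> i has_derivative (\<lambda>v. x $ i * frechet_derivative \<phi> (at x) v + v $ i * \<phi> x)) (at x)"
        unfolding \<psi>_def .
      from frechet_derivative_at[OF this, symmetric] show ?thesis by simp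
    qed
    have "div_radial \<phi> x = (\<Sum>i\<in>UNIV. frechet_derivative (\<psi> i) (at x) (axis i 1))" for x
      unfolding d by (simp add: sum.distrib div_radial_def frechet_radial_eq_sum[OF e])
    moreover have "u x * div_radial \<phi> x = fst (f x) * div_radial \<phi> x" for x
    proof (cases "x \<in> cball 0 r")
      case False
      have "((\<lambda>_. 0) has_derivative (\<lambda>_. 0)) (at x)" by simp
      then have "(\<phi> has_derivative (\<lambda>_. 0)) (at x)"
        by (rule has_derivative_transform_within_open[of _ _ _ _ "- cball 0 r"])
          (use False \<phi> in \<open>auto simp: ball_test_def\<close>)
      then have "(\<lambda>_. 0) = frechet_derivative \<phi> (at x)" by (rule frechet_derivative_at)
      then have "frechet_derivative \<phi> (at x) x = 0" by metis
      then show ?thesis using False \<phi> by (simp add: div_radial_def ball_test_def)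
    qed (simp add: u_def)
    ultimately have "(\<integral>x. u x * div_radial \<phi> x \<partial>lebesgue)
        = (\<integral>x. (\<Sum>i\<in>UNIV. fst (f x) * frechet_derivative (\<psi> i) (at x) (axis i 1)) \<partial>lebesgue)"
      by (simp add: sum_distrib_left)
    also have "\<dots> = (\<Sum>i\<in>UNIV. - (\<integral>x. snd (f x) $ i * \<psi> i x \<partial>lebesgue))"
      using H1_test_integral[OF s f \<psi>] by (subst Bochner_Integration.integral_sum) auto
    also have "\<dots> = - (\<integral>x. (\<Sum>i\<in>UNIV. snd (f x) $ i * \<psi> i x) \<partial>lebesgue)"
      using H1_test_integral(2)[OF s f \<psi>] by (subst Bochner_Integration.integral_sum) (auto simp: sum_negf)
    finally have eq: "(\<integral>x. u x * div_radial \<phi> x \<partial>lebesgue) = - (\<integral>x. (\<Sum>i\<in>UNIV. snd (f x) $ i * \<psi> i x) \<partial>lebesgue)" .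
    have "(\<Sum>i\<in>UNIV. snd (f x) $ i * \<psi> i x) = D x * \<phi> x" for x
    proof (cases "x \<in> cball 0 r")
      case True
      then show ?thesis by (simp add: D_def \<psi>_def inner_vec_def sum_distrib_left mult_ac)
    next
      case False
      then show ?thesis using \<phi> by (simp add: D_def \<psi>_def ball_test_def)
    qed
    then show ?thesis using eq by simp
  qed
  define P where "P t = pcut s \<delta> (1 - t)" for t
  define P' where "P' t = - pcut' s \<delta> (1 - t)" for t
  have main: "- (\<integral>x. (u x)\<^sup>2 * (3 * P ((norm x)\<^sup>2) + 2 * (norm x)\<^sup>2 * P' ((norm x)\<^sup>2)) \<partial>lebesgue)
      \<le> 2 * (\<integral>x. D x * (u x * P ((norm x)\<^sup>2)) \<partial>lebesgue)"
  proof (rule weak_radial_energy_inequality[OF r(1) u _ D weak])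
    show "(P has_real_derivative P' t) (at t)" for t
      unfolding P_def P'_def
      by (rule DERIV_cong[OF DERIV_chain2[OF has_real_derivative_pcut[OF \<delta>(1)]]]) (auto intro!: derivative_eq_intros)
    show "continuous_on UNIV P'" unfolding P'_def
      by (intro continuous_intros continuous_on_compose2[OF continuous_pcut'[OF \<delta>(1)]]) auto
  qed (use r(3) in \<open>auto simp: P_def pcut_def u_def\<close>)
  have PP: "P ((norm x)\<^sup>2) = wt s x * ((\<theta> x)\<^sup>2 / w x)"
    "P' ((norm x)\<^sup>2) = - wt s x * ((2 * \<theta> x + (s - 3) * (\<theta> x)\<^sup>2) / (w x)\<^sup>2)" if "norm x < 1" for x
    using pcut_eq[OF \<delta>(1), of "w x" s] norm_square_less_one[OF that]
    by (simp_all add: P_def P'_def \<theta>_def w_def wt_def)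
  have \<theta>0: "\<theta> x = 0" if "x \<notin> cball 0 r" "norm x < 1" for x
  proof -
    have "r\<^sup>2 \<le> (norm x)\<^sup>2" using that r by (intro power_mono) auto
    then have "w x \<le> \<delta>" using r(3) by (simp add: w_def)
    moreover have "0 < w x" using norm_square_less_one[OF that(2)] by (simp add: w_def)
    ultimately show ?thesis by (simp add: \<theta>_def cutoff_def max_def le_divide_eq)
  qed
  have e1: "(u x)\<^sup>2 * (3 * P ((norm x)\<^sup>2) + 2 * (norm x)\<^sup>2 * P' ((norm x)\<^sup>2))
      = wdens s x * ((fst (f x))\<^sup>2 * (3 * (\<theta> x)\<^sup>2 / w x
        - 2 * (1 - w x) * (2 * \<theta> x + (s - 3) * (\<theta> x)\<^sup>2) / (w x)\<^sup>2))"
    and e2: "D x * (u x * P ((norm x)\<^sup>2)) = wdens s x * ((x \<bullet> snd (f x)) * fst (f x) * ((\<theta> x)\<^sup>2 / w x))" for x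
  proof -
    consider "norm x \<ge> 1" | "norm x < 1" "x \<notin> cball 0 r" | "norm x < 1" "x \<in> cball 0 r" by fastforce
    then have "(u x)\<^sup>2 * (3 * P ((norm x)\<^sup>2) + 2 * (norm x)\<^sup>2 * P' ((norm x)\<^sup>2))
      = wdens s x * ((fst (f x))\<^sup>2 * (3 * (\<theta> x)\<^sup>2 / w x
        - 2 * (1 - w x) * (2 * \<theta> x + (s - 3) * (\<theta> x)\<^sup>2) / (w x)\<^sup>2)) \<and>
      D x * (u x * P ((norm x)\<^sup>2)) = wdens s x * ((x \<bullet> snd (f x)) * fst (f x) * ((\<theta> x)\<^sup>2 / w x))"
    proof cases
      case 1 then show ?thesis using r by (simp add: u_def wdens_eq)
    next
      case 2 then show ?thesis using \<theta>0[OF 2(2,1)] by (simp add: u_def)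
    next
      case 3
      have nw: "(norm x)\<^sup>2 = 1 - w x" by (simp add: w_def)
      have uD: "u x = fst (f x)" "D x = x \<bullet> snd (f x)" "wdens s x = wt s x"
        using 3 by (simp_all add: u_def D_def wdens_eq)
      have "wt s x * (3 * (\<theta> x)\<^sup>2 / w x - 2 * (1 - w x) * (2 * \<theta> x + (s - 3) * (\<theta> x)\<^sup>2) / (w x)\<^sup>2)
          = 3 * (wt s x * ((\<theta> x)\<^sup>2 / w x)) + 2 * (1 - w x) * (- wt s x * ((2 * \<theta> x + (s - 3) * (\<theta> x)\<^sup>2) / (w x)\<^sup>2))"
        by (simp add: algebra_simps diff_divide_distrib add_divide_distrib)
      then have "3 * P ((norm x)\<^sup>2) + 2 * (norm x)\<^sup>2 * P' ((norm x)\<^sup>2)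
          = wt s x * (3 * (\<theta> x)\<^sup>2 / w x - 2 * (1 - w x) * (2 * \<theta> x + (s - 3) * (\<theta> x)\<^sup>2) / (w x)\<^sup>2)"
        unfolding PP[OF 3(1)] by (simp add: nw)
      then show ?thesis unfolding uD PP(1)[OF 3(1)] by (simp add: mult_ac)
    qed
    then show "(u x)\<^sup>2 * (3 * P ((norm x)\<^sup>2) + 2 * (norm x)\<^sup>2 * P' ((norm x)\<^sup>2))
      = wdens s x * ((fst (f x))\<^sup>2 * (3 * (\<theta> x)\<^sup>2 / w x
        - 2 * (1 - w x) * (2 * \<theta> x + (s - 3) * (\<theta> x)\<^sup>2) / (w x)\<^sup>2))"
      "D x * (u x * P ((norm x)\<^sup>2)) = wdens s x * ((x \<bullet> snd (f x)) * fst (f x) * ((\<theta> x)\<^sup>2 / w x))"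
      by blast+
  qed
  have wm [measurable]: "w \<in> borel_measurable lebesgue" unfolding w_def by measurable
  have \<theta>m [measurable]: "\<theta> \<in> borel_measurable lebesgue" unfolding \<theta>_def cutoff_def by measurable
  show ?thesis
    using main unfolding e1 e2
    by (subst (1 2) integral_wmeas) measurable
qed

section \<open>Removal of the cutoff: the Hardy bound and the sharp lower bound\<close>

lemma L2_fatou:
  fixes X :: "nat \<Rightarrow> 'a \<Rightarrow> real"
  assumes X: "\<And>n. X n \<in> L2 M" and g: "g \<in> borel_measurable M"
    and lim: "AE x in M. (\<lambda>n. X n x) \<longlonglongrightarrow> g x" and B: "\<And>n. l2ip M (X n) (X n) \<le> B"
  shows "g \<in> L2 M" "l2ip M g g \<le> B"
proof -
  have [measurable]: "X n \<in> borel_measurable M" for n using X by (auto simp: L2_def)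
  note [measurable] = g
  have "(\<integral>\<^sup>+x. ennreal ((norm (g x))\<^sup>2) \<partial>M) = (\<integral>\<^sup>+x. liminf (\<lambda>n. ennreal ((norm (X n x))\<^sup>2)) \<partial>M)"
  proof (rule nn_integral_cong_AE, use lim in eventually_elim)
    case (elim x)
    then have "(\<lambda>n. ennreal ((norm (X n x))\<^sup>2)) \<longlonglongrightarrow> ennreal ((norm (g x))\<^sup>2)" by (intro tendsto_intros)
    then show ?case by (metis lim_imp_Liminf trivial_limit_sequentially)
  qed
  also have "\<dots> \<le> liminf (\<lambda>n. \<integral>\<^sup>+x. ennreal ((norm (X n x))\<^sup>2) \<partial>M)"
    by (rule nn_integral_liminf) measurable
  also have "\<dots> \<le> liminf (\<lambda>n::nat. ennreal B)"
  proof (rule Liminf_mono, rule always_eventually, rule allI)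
    fix n
    have "(\<integral>\<^sup>+x. ennreal ((norm (X n x))\<^sup>2) \<partial>M) = ennreal (l2ip M (X n) (X n))"
      unfolding l2ip_self using L2_integrable_square[OF X[of n]] by (subst nn_integral_eq_integral) auto
    then show "(\<integral>\<^sup>+x. ennreal ((norm (X n x))\<^sup>2) \<partial>M) \<le> ennreal B" using B[of n] by (simp add: ennreal_leI)
  qed
  also have "\<dots> = ennreal B" by (simp add: Liminf_const)
  finally have le: "(\<integral>\<^sup>+x. ennreal ((norm (g x))\<^sup>2) \<partial>M) \<le> ennreal B" .
  then have i: "integrable M (\<lambda>x. (norm (g x))\<^sup>2)"
    by (intro integrableI_bounded) (auto simp: le_less_trans)
  then show "g \<in> L2 M" using g by (simp add: L2_def)
  have "0 \<le> B" using B[of 0] l2ip_self_nonneg[of M "X 0"] by linarith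
  moreover have "ennreal (l2ip M g g) \<le> ennreal B"
    unfolding l2ip_self using le i by (subst nn_integral_eq_integral[symmetric]) auto
  ultimately show "l2ip M g g \<le> B" by simp
qed

lemma l2norm_fst_snd_le:
  assumes "f \<in> L2 M"
  shows "l2norm M (\<lambda>q. fst (f q)) \<le> l2norm M f" "l2norm M (\<lambda>q. snd (f q)) \<le> l2norm M f"
proof -
  note L = L2_fst_snd[OF assms]
  have "l2ip M f f = l2ip M (\<lambda>q. fst (f q)) (\<lambda>q. fst (f q)) + l2ip M (\<lambda>q. snd (f q)) (\<lambda>q. snd (f q))"
    using l2ip_Pair[OF L(1) L(1) L(2) L(2)] by simp
  then show "l2norm M (\<lambda>q. fst (f q)) \<le> l2norm M f" "l2norm M (\<lambda>q. snd (f q)) \<le> l2norm M f"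
    unfolding l2norm_def using l2ip_self_nonneg[of M "\<lambda>q. fst (f q)"] l2ip_self_nonneg[of M "\<lambda>q. snd (f q)"]
    by (auto intro!: real_sqrt_le_mono)
qed

abbreviation hardy_quotient :: "(real^3 \<Rightarrow> real \<times> (real^3)) \<Rightarrow> real^3 \<Rightarrow> real" where
  "hardy_quotient f \<equiv> \<lambda>q. fst (f q) / (1 - (norm q)\<^sup>2)"

text \<open>The shift by 2 keeps the cutoff parameter strictly below 1 already at n = 0.\<close>

definition vanishing :: "nat \<Rightarrow> real" where
  "vanishing n = 1 / (real n + 2)"

lemma vanishing: "0 < vanishing n" "vanishing n < 1" "vanishing \<longlonglongrightarrow> 0"
proof -
  show "0 < vanishing n" "vanishing n < 1" by (auto simp: vanishing_def)
  have "(\<lambda>n. 1 / real (n + 2)) \<longlonglongrightarrow> 0" using lim_1_over_n by (rule LIMSEQ_ignore_initial_segment)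
  then show "vanishing \<longlonglongrightarrow> 0" by (simp add: vanishing_def[abs_def] add.commute)
qed

lemma cutoff_vanishing: "0 < w \<Longrightarrow> (\<lambda>n. cutoff (vanishing n) w) \<longlonglongrightarrow> 1"
proof -
  assume w: "0 < w"
  have "(\<lambda>n. max 0 (1 - vanishing n / w)) \<longlonglongrightarrow> max 0 (1 - 0 / w)"
    using w by (intro tendsto_intros vanishing) auto
  then show ?thesis by (simp add: cutoff_def)
qed

text \<open>For a = \<theta> u / w the energy inequality gives 2 (s-1) |a|^2 <= 2 (a, \<theta> D) +
  (2s+1) (a, \<theta> u), with D = q . G. Cauchy-Schwarz bounds the right side by (2s+3) |a| |f|;
  dividing by |a| leaves a bound independent of \<delta>.\<close>

theorem hardy_inequality:
  assumes s: "1 < s" and f: "f \<in> H1_space s"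
  shows "hardy_quotient f \<in> L2 (wmeas s)"
    and "l2ip (wmeas s) (hardy_quotient f) (hardy_quotient f) \<le> ((2 * s + 3) / (2 * (s - 1)))\<^sup>2 * l2ip (wmeas s) f f"
proof -
  let ?M = "wmeas s"
  define w where "w q = 1 - (norm q)\<^sup>2" for q :: "real^3"
  define u where "u q = fst (f q)" for q
  define G where "G q = snd (f q)" for q
  define D where "D q = q \<bullet> G q" for q
  have fL: "f \<in> L2 ?M" using f by (simp add: H1_space_def)
  have uL: "u \<in> L2 ?M" and GL: "G \<in> L2 ?M" using L2_fst_snd[OF fL] by (auto simp: u_def[abs_def] G_def[abs_def])
  have DL: "D \<in> L2 ?M" unfolding D_def using L2_radial(1)[OF GL] .
  have [measurable]: "u \<in> borel_measurable lebesgue" "D \<in> borel_measurable lebesgue"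
    using uL DL by (auto dest: L2_measurable)
  have wm [measurable]: "w \<in> borel_measurable lebesgue" unfolding w_def by measurable
  have wpos: "0 < w q" if "norm q < 1" for q using norm_square_less_one[OF that] by (simp add: w_def)
  have wle: "w q \<le> 1" for q by (simp add: w_def)
  define C where "C = (2 * s + 3) / (2 * (s - 1))"
  define a where "a \<delta> q = cutoff \<delta> (w q) * u q / w q" for \<delta> q
  have am: "a \<delta> \<in> borel_measurable lebesgue" for \<delta> unfolding a_def cutoff_def by measurable
  have bound: "a \<delta> \<in> L2 ?M \<and> l2ip ?M (a \<delta>) (a \<delta>) \<le> C\<^sup>2 * l2ip ?M f f" if \<delta>: "0 < \<delta>" "\<delta> < 1" for \<delta>
  proof -
    define \<theta> where "\<theta> q = cutoff \<delta> (w q)" for q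
    have [measurable]: "\<theta> \<in> borel_measurable lebesgue" unfolding \<theta>_def cutoff_def by measurable
    have \<theta>: "0 \<le> \<theta> q" "\<theta> q \<le> 1" "(\<theta> q)\<^sup>2 \<le> \<theta> q" "\<theta> q / w q \<le> 1 / \<delta>" if "norm q < 1" for q
      unfolding \<theta>_def using cutoff_le[OF \<delta>(1) wpos[OF that]] by auto
    \<comment> \<open>For fixed \<delta> the quotient is square integrable because \<theta> / w <=
      1/\<delta>. This finiteness is what later justifies dividing by the norm of
      \<open>a \<delta>\<close>.\<close>
    have aL: "a \<delta> \<in> L2 ?M"
    proof (rule L2_bound[OF uL, where C = "1 / \<delta>"])
      show "AE q in ?M. norm (a \<delta> q) \<le> 1 / \<delta> * norm (u q)"
        using AE_wmeas
      proof eventually_elim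
        case (elim q)
        have "norm (a \<delta> q) = \<theta> q / w q * norm (u q)"
          using \<theta>(1)[OF elim] wpos[OF elim] by (simp add: a_def \<theta>_def[symmetric] abs_mult)
        also have "\<dots> \<le> 1 / \<delta> * norm (u q)" using \<theta>(4)[OF elim] by (intro mult_right_mono) auto
        finally show ?case .
      qed
    qed (use am in simp)
    have cut_norm: "(\<lambda>q. \<theta> q * g q) \<in> L2 ?M \<and> l2norm ?M (\<lambda>q. \<theta> q * g q) \<le> l2norm ?M g" if g: "g \<in> L2 ?M" for g :: "real^3 \<Rightarrow> real"
    proof -
      have [measurable]: "g \<in> borel_measurable lebesgue" using L2_measurable[OF g] by simp
      have ae: "AE q in ?M. norm (\<theta> q * g q) \<le> norm (g q)"
        using AE_wmeas by eventually_elim (use \<theta> in \<open>auto simp: abs_mult intro: mult_left_le_one_le\<close>)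
      then have 1: "(\<lambda>q. \<theta> q * g q) \<in> L2 ?M" by (intro L2_bound[OF g, where C = 1]) auto
      have "l2norm ?M (\<lambda>q. \<theta> q * g q) \<le> l2norm ?M g"
        unfolding l2norm_def l2ip_self
      proof (intro real_sqrt_le_mono integral_mono_AE L2_integrable_square 1 g)
        show "AE q in ?M. (norm (\<theta> q * g q))\<^sup>2 \<le> (norm (g q))\<^sup>2"
          using ae by eventually_elim (intro power_mono, auto)
      qed
      with 1 show ?thesis by blast
    qed
    note uc = cut_norm[OF uL] and Dc = cut_norm[OF DL]
    have i1: "integrable ?M (\<lambda>q. (a \<delta> q)\<^sup>2)" using L2_integrable_square[OF aL] by simp
    have i2: "integrable ?M (\<lambda>q. a \<delta> q * (\<theta> q * u q))" using aL uc by (intro L2_mult_integrable) auto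
    have i3: "integrable ?M (\<lambda>q. a \<delta> q * (\<theta> q * D q))" using aL Dc by (intro L2_mult_integrable) auto
    define E where "E q = (u q)\<^sup>2 * (3 * (\<theta> q)\<^sup>2 / w q
        - 2 * (1 - w q) * (2 * \<theta> q + (s - 3) * (\<theta> q)\<^sup>2) / (w q)\<^sup>2)" for q
    have Em: "E \<in> borel_measurable lebesgue" unfolding E_def by measurable
    have Ei: "integrable ?M E"
    proof (rule Bochner_Integration.integrable_bound)
      show "integrable ?M (\<lambda>q. (3 / \<delta> + 2 * (2 + \<bar>s - 3\<bar>) / \<delta>\<^sup>2) * (u q)\<^sup>2)"
        using L2_integrable_square[OF uL] by simp
      show "AE q in ?M. norm (E q) \<le> norm ((3 / \<delta> + 2 * (2 + \<bar>s - 3\<bar>) / \<delta>\<^sup>2) * (u q)\<^sup>2)"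
        using AE_wmeas
      proof eventually_elim
        case (elim q)
        note t = \<theta>[OF elim] and wq = wpos[OF elim]
        have z: "\<theta> q = 0 \<or> \<delta> < w q"
          using wq \<delta> by (auto simp: \<theta>_def cutoff_def max_def field_simps)
        have "\<bar>3 * (\<theta> q)\<^sup>2 / w q - 2 * (1 - w q) * (2 * \<theta> q + (s - 3) * (\<theta> q)\<^sup>2) / (w q)\<^sup>2\<bar>
            \<le> 3 / \<delta> + 2 * (2 + \<bar>s - 3\<bar>) / \<delta>\<^sup>2"
        proof (cases "\<theta> q = 0")
          case True then show ?thesis using \<delta> by simp
        next
          case False
          then have dw: "\<delta> < w q" using z by simp
          have t2: "(\<theta> q)\<^sup>2 \<le> 1" using t by linarith
          have x1: "\<bar>3 * (\<theta> q)\<^sup>2 / w q\<bar> \<le> 3 / \<delta>"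
            using t2 dw \<delta> wq by (simp, intro frac_le) auto
          have "\<bar>2 * \<theta> q + (s - 3) * (\<theta> q)\<^sup>2\<bar> \<le> 2 * 1 + \<bar>s - 3\<bar> * 1"
          proof -
            have "\<bar>s - 3\<bar> * (\<theta> q)\<^sup>2 \<le> \<bar>s - 3\<bar> * 1" using t2 by (intro mult_left_mono) auto
            then have "\<bar>(s - 3) * (\<theta> q)\<^sup>2\<bar> \<le> \<bar>s - 3\<bar> * 1" by (simp add: abs_mult)
            then show ?thesis using t by linarith
          qed
          then have "(1 - w q) * \<bar>2 * \<theta> q + (s - 3) * (\<theta> q)\<^sup>2\<bar> \<le> 1 * (2 + \<bar>s - 3\<bar>)"
            using wle[of q] wq by (intro mult_mono) auto
          then have "2 * (1 - w q) * \<bar>2 * \<theta> q + (s - 3) * (\<theta> q)\<^sup>2\<bar> \<le> 2 * (2 + \<bar>s - 3\<bar>)"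
            by (simp only: mult.assoc)
          then have "2 * (1 - w q) * \<bar>2 * \<theta> q + (s - 3) * (\<theta> q)\<^sup>2\<bar> / (w q)\<^sup>2 \<le> 2 * (2 + \<bar>s - 3\<bar>) / \<delta>\<^sup>2"
            using dw \<delta> wq by (intro frac_le power_mono) (auto simp del: distrib_left_numeral left_diff_distrib_numeral)
          then have x2: "\<bar>2 * (1 - w q) * (2 * \<theta> q + (s - 3) * (\<theta> q)\<^sup>2) / (w q)\<^sup>2\<bar> \<le> 2 * (2 + \<bar>s - 3\<bar>) / \<delta>\<^sup>2"
            using wle[of q] by (simp add: abs_mult)
          show ?thesis using x1 x2 by linarith
        qed
        from mult_left_mono[OF this, of "(u q)\<^sup>2"] show ?case
          using \<delta> by (simp add: E_def abs_mult mult.commute)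
      qed
    qed (use Em in simp)
    have en: "- (\<integral>q. E q \<partial>?M) \<le> 2 * (\<integral>q. a \<delta> q * (\<theta> q * D q) \<partial>?M)"
      using H1_cutoff_energy[of s f \<delta>] s f \<delta>
      by (simp add: E_def u_def D_def G_def a_def w_def \<theta>_def power2_eq_square mult_ac)
    have "2 * (s - 1) * l2ip ?M (a \<delta>) (a \<delta>) = (\<integral>q. 2 * (s - 1) * (a \<delta> q)\<^sup>2 \<partial>?M)"
      by (simp add: l2ip_self)
    also have "\<dots> \<le> (\<integral>q. - E q + (2 * s + 1) * (a \<delta> q * (\<theta> q * u q)) \<partial>?M)"
    proof (rule integral_mono_AE)
      show "AE q in ?M. 2 * (s - 1) * (a \<delta> q)\<^sup>2 \<le> - E q + (2 * s + 1) * (a \<delta> q * (\<theta> q * u q))"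
        using AE_wmeas
      proof eventually_elim
        case (elim q)
        note t = \<theta>[OF elim] and wq = wpos[OF elim]
        \<comment> \<open>Equivalent to \<theta>^2 <= \<theta>: the derivative of the cutoff
          contributes with the favourable sign and may be discarded.\<close>
        have k: "(s - 1) * (\<theta> q)\<^sup>2 \<le> 2 * \<theta> q + (s - 3) * (\<theta> q)\<^sup>2" using t(3) by (simp add: algebra_simps)
        have "2 * (1 - w q) * ((s - 1) * (\<theta> q)\<^sup>2) / (w q)\<^sup>2
            \<le> 2 * (1 - w q) * (2 * \<theta> q + (s - 3) * (\<theta> q)\<^sup>2) / (w q)\<^sup>2"
          using wle[of q] by (intro divide_right_mono mult_left_mono k) auto
        from mult_left_mono[OF this, of "(u q)\<^sup>2"]
        have 1: "(u q)\<^sup>2 * (2 * (1 - w q) * ((s - 1) * (\<theta> q)\<^sup>2) / (w q)\<^sup>2) \<le> - E q + 3 * ((u q)\<^sup>2 * ((\<theta> q)\<^sup>2 / w q))"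
          by (simp add: E_def right_diff_distrib)
        have 2: "(u q)\<^sup>2 * (2 * (1 - w q) * ((s - 1) * (\<theta> q)\<^sup>2) / (w q)\<^sup>2)
            = 2 * (s - 1) * (a \<delta> q)\<^sup>2 - 2 * (s - 1) * ((u q)\<^sup>2 * ((\<theta> q)\<^sup>2 / w q))"
          using wq by (simp add: a_def \<theta>_def[symmetric] power2_eq_square field_simps)
        have 3: "a \<delta> q * (\<theta> q * u q) = (u q)\<^sup>2 * ((\<theta> q)\<^sup>2 / w q)"
          by (simp add: a_def \<theta>_def[symmetric] power2_eq_square)
        \<comment> \<open>The 3 comes from the dimension; 2 (s-1) comes from splitting (1 - w)/w^2
          into 1/w^2 - 1/w.\<close>
        have 4: "(2 * s + 1) * Z = 3 * Z + 2 * (s - 1) * Z" for Z by (simp add: algebra_simps)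
        show ?case unfolding 3 4 using 1 unfolding 2 by linarith
      qed
    qed (use i1 i2 Ei in auto)
    also have "\<dots> = - (\<integral>q. E q \<partial>?M) + (2 * s + 1) * (\<integral>q. a \<delta> q * (\<theta> q * u q) \<partial>?M)"
      using i2 Ei by simp
    also have "\<dots> \<le> 2 * l2ip ?M (a \<delta>) (\<lambda>q. \<theta> q * D q) + (2 * s + 1) * l2ip ?M (a \<delta>) (\<lambda>q. \<theta> q * u q)"
      using en by (simp add: l2ip_def)
    also have "\<dots> \<le> 2 * (l2norm ?M (a \<delta>) * l2norm ?M f) + (2 * s + 1) * (l2norm ?M (a \<delta>) * l2norm ?M f)"
    proof (intro add_mono mult_left_mono)
      have "l2norm ?M (\<lambda>q. \<theta> q * D q) \<le> l2norm ?M f"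
        using Dc L2_radial(2)[OF GL] l2norm_fst_snd_le(2)[OF fL] by (auto simp: D_def[abs_def] G_def[abs_def])
      then show "l2ip ?M (a \<delta>) (\<lambda>q. \<theta> q * D q) \<le> l2norm ?M (a \<delta>) * l2norm ?M f"
        using l2ip_le_norm[OF aL, of "\<lambda>q. \<theta> q * D q"] Dc mult_left_mono[of _ "l2norm ?M f" "l2norm ?M (a \<delta>)"]
        by (smt (verit) l2norm_nonneg)
      have "l2norm ?M (\<lambda>q. \<theta> q * u q) \<le> l2norm ?M f"
        using uc l2norm_fst_snd_le(1)[OF fL] by (auto simp: u_def[abs_def])
      then show "l2ip ?M (a \<delta>) (\<lambda>q. \<theta> q * u q) \<le> l2norm ?M (a \<delta>) * l2norm ?M f"
        using l2ip_le_norm[OF aL, of "\<lambda>q. \<theta> q * u q"] uc mult_left_mono[of _ "l2norm ?M f" "l2norm ?M (a \<delta>)"]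
        by (smt (verit) l2norm_nonneg)
    qed (use s in auto)
    also have "\<dots> = (2 * s + 3) * l2norm ?M f * l2norm ?M (a \<delta>)" by (simp add: algebra_simps)
    finally have fin: "2 * (s - 1) * (l2norm ?M (a \<delta>))\<^sup>2 \<le> (2 * s + 3) * l2norm ?M f * l2norm ?M (a \<delta>)"
      by (simp add: l2norm_square)
    have "l2norm ?M (a \<delta>) \<le> C * l2norm ?M f"
    proof (cases "l2norm ?M (a \<delta>) = 0")
      case True
      then show ?thesis using s by (simp add: C_def)
    next
      case False
      then have "0 < l2norm ?M (a \<delta>)" using l2norm_nonneg[of ?M "a \<delta>"] by linarith
      then have "2 * (s - 1) * l2norm ?M (a \<delta>) \<le> (2 * s + 3) * l2norm ?M f"
        using fin by (simp add: power2_eq_square)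
      then show ?thesis using s by (simp add: C_def field_simps)
    qed
    then have "(l2norm ?M (a \<delta>))\<^sup>2 \<le> (C * l2norm ?M f)\<^sup>2" by (intro power_mono) auto
    then show ?thesis using aL by (simp add: power_mult_distrib l2norm_square)
  qed
  have lim: "AE q in ?M. (\<lambda>n. a (vanishing n) q) \<longlonglongrightarrow> u q / w q"
    using AE_wmeas
  proof eventually_elim
    case (elim q)
    have "(\<lambda>n. cutoff (vanishing n) (w q) * u q / w q) \<longlonglongrightarrow> 1 * u q / w q"
      using wpos[OF elim] by (intro tendsto_intros cutoff_vanishing) auto
    then show ?case by (simp add: a_def)
  qed
  have gm: "(\<lambda>q. u q / w q) \<in> borel_measurable ?M" by simp
  \<comment> \<open>Nothing is yet known to dominate the cut quotients, so only Fatou, with the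
    bound uniform in \<delta>, gives the limit.\<close>
  have "(\<lambda>q. u q / w q) \<in> L2 ?M" "l2ip ?M (\<lambda>q. u q / w q) (\<lambda>q. u q / w q) \<le> C\<^sup>2 * l2ip ?M f f"
    using L2_fatou[of "\<lambda>n. a (vanishing n)" ?M "\<lambda>q. u q / w q" "C\<^sup>2 * l2ip ?M f f"] bound[OF vanishing(1,2)] gm lim by auto
  then show "hardy_quotient f \<in> L2 ?M" "l2ip ?M (hardy_quotient f) (hardy_quotient f) \<le> ((2 * s + 3) / (2 * (s - 1)))\<^sup>2 * l2ip ?M f f"
    by (simp_all add: u_def w_def C_def)
qed

text \<open>The cutoff is removed first and the pointwise estimate comes afterwards: only at
  \<theta> = 1 is the integrand exactly the quadratic in 1/w whose extremum is
  \<open>gamma_fun s\<close>. The passage to the limit rests on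
  \<open>hardy_inequality\<close>.\<close>

lemma convection_lower_bound:
  assumes s: "1 < s" and f: "f \<in> H1_space s"
  shows "- gamma_fun s * l2ip (wmeas s) (\<lambda>q. fst (f q)) (\<lambda>q. fst (f q))
    \<le> l2ip (wmeas s) (hardy_quotient f) (\<lambda>q. q \<bullet> snd (f q))"
proof -
  let ?M = "wmeas s"
  define w where "w q = 1 - (norm q)\<^sup>2" for q :: "real^3"
  define u where "u q = fst (f q)" for q
  define D where "D q = q \<bullet> snd (f q)" for q
  have fL: "f \<in> L2 ?M" using f by (simp add: H1_space_def)
  have uL: "u \<in> L2 ?M" using L2_fst_snd[OF fL] by (auto simp: u_def[abs_def])
  have DL: "D \<in> L2 ?M" using L2_radial(1)[OF L2_fst_snd(2)[OF fL]] by (auto simp: D_def[abs_def])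
  have aL: "(\<lambda>q. u q / w q) \<in> L2 ?M" using hardy_inequality(1)[OF s f] by (simp add: u_def w_def)
  have [measurable]: "u \<in> borel_measurable lebesgue" "D \<in> borel_measurable lebesgue"
    using uL DL by (auto dest: L2_measurable)
  have wm [measurable]: "w \<in> borel_measurable lebesgue" unfolding w_def by measurable
  have wpos: "0 < w q" if "norm q < 1" for q using norm_square_less_one[OF that] by (simp add: w_def)
  have wne: "w q \<noteq> 0" if "norm q < 1" for q using wpos[OF that] by simp
  have wle: "w q \<le> 1" for q by (simp add: w_def)
  define \<theta> where "\<theta> n q = cutoff (vanishing n) (w q)" for n q
  have [measurable]: "\<theta> n \<in> borel_measurable lebesgue" for n unfolding \<theta>_def cutoff_def by measurable
  have \<theta>: "0 \<le> \<theta> n q" "\<theta> n q \<le> 1" "(\<theta> n q)\<^sup>2 \<le> 1" if "norm q < 1" for n q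
    using cutoff_le[OF vanishing(1) wpos[OF that], of n] unfolding \<theta>_def by linarith+
  have \<theta>lim: "(\<lambda>n. \<theta> n q) \<longlonglongrightarrow> 1" if "norm q < 1" for q
    unfolding \<theta>_def by (rule cutoff_vanishing[OF wpos[OF that]])
  define E where "E t q = (u q)\<^sup>2 * (3 * t\<^sup>2 / w q - 2 * (1 - w q) * (2 * t + (s - 3) * t\<^sup>2) / (w q)\<^sup>2)" for t q
  \<comment> \<open>The majorant is a multiple of (u/w)^2. Since 0 < w <= 1 and 0 <= \<theta> <= 1,
    the bracket in \<open>E\<close> times w^2 is at most 3 + 2 (2 + |s-3|).\<close>
  have "(\<lambda>n. - (\<integral>q. E (\<theta> n q) q \<partial>?M)) \<longlonglongrightarrow> - (\<integral>q. E 1 q \<partial>?M)"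
  proof (intro tendsto_minus integral_dominated_convergence)
    show "E 1 \<in> borel_measurable ?M" "(\<lambda>q. E (\<theta> n q) q) \<in> borel_measurable ?M" for n
      unfolding E_def measurable_wmeas by measurable
    show "integrable ?M (\<lambda>q. (3 + 2 * (2 + \<bar>s - 3\<bar>)) * (norm (u q / w q))\<^sup>2)"
      using L2_integrable_square[OF aL] by (rule integrable_mult_right)
    show "AE q in ?M. (\<lambda>n. E (\<theta> n q) q) \<longlonglongrightarrow> E 1 q"
      using AE_wmeas unfolding E_def
      by eventually_elim (intro tendsto_intros \<theta>lim, auto dest: wne)
    fix n
    show "AE q in ?M. norm (E (\<theta> n q) q) \<le> (3 + 2 * (2 + \<bar>s - 3\<bar>)) * (norm (u q / w q))\<^sup>2"
      using AE_wmeas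
    proof eventually_elim
      case (elim q)
      note t = \<theta>[OF elim, of n] and wq = wpos[OF elim]
      define x where "x = \<theta> n q"
      have x: "0 \<le> x" "x \<le> 1" "x\<^sup>2 \<le> 1" using t by (auto simp: x_def)
      have "\<bar>s - 3\<bar> * x\<^sup>2 \<le> \<bar>s - 3\<bar> * 1" using x by (intro mult_left_mono) auto
      then have "\<bar>(s - 3) * x\<^sup>2\<bar> \<le> \<bar>s - 3\<bar>" by (simp add: abs_mult)
      then have "\<bar>2 * x + (s - 3) * x\<^sup>2\<bar> \<le> 2 + \<bar>s - 3\<bar>" using x by linarith
      then have "(1 - w q) * \<bar>2 * x + (s - 3) * x\<^sup>2\<bar> \<le> 1 * (2 + \<bar>s - 3\<bar>)"
        using wle[of q] wq by (intro mult_mono) auto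
      then have y: "\<bar>2 * (1 - w q) * (2 * x + (s - 3) * x\<^sup>2)\<bar> \<le> 2 * (2 + \<bar>s - 3\<bar>)"
        using wle[of q] by (simp only: abs_mult)
      have "3 * x\<^sup>2 * w q \<le> 3 * 1 * 1" using x wle[of q] wq by (intro mult_mono) auto
      then have z: "\<bar>3 * x\<^sup>2 * w q\<bar> \<le> 3" using wq by simp
      have "3 * x\<^sup>2 / w q - 2 * (1 - w q) * (2 * x + (s - 3) * x\<^sup>2) / (w q)\<^sup>2
          = (3 * x\<^sup>2 * w q - 2 * (1 - w q) * (2 * x + (s - 3) * x\<^sup>2)) / (w q)\<^sup>2"
        using wq by (simp add: diff_divide_distrib power2_eq_square)
      then have "E x q = (u q / w q)\<^sup>2 * (3 * x\<^sup>2 * w q - 2 * (1 - w q) * (2 * x + (s - 3) * x\<^sup>2))"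
        by (simp add: E_def power_divide)
      then have "norm (E x q) = (u q / w q)\<^sup>2 * \<bar>3 * x\<^sup>2 * w q - 2 * (1 - w q) * (2 * x + (s - 3) * x\<^sup>2)\<bar>"
        by (simp only: real_norm_def abs_mult abs_power2)
      also have "\<dots> \<le> (u q / w q)\<^sup>2 * (3 + 2 * (2 + \<bar>s - 3\<bar>))"
        by (rule mult_left_mono) (use y z in linarith, simp)
      finally show ?case by (simp add: x_def mult.commute power_divide)
    qed
  qed
  moreover have "(\<lambda>n. 2 * (\<integral>q. D q * u q * ((\<theta> n q)\<^sup>2 / w q) \<partial>?M)) \<longlonglongrightarrow> 2 * (\<integral>q. D q * u q * (1\<^sup>2 / w q) \<partial>?M)"
  proof (intro tendsto_mult tendsto_const integral_dominated_convergence)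
    show "integrable ?M (\<lambda>q. \<bar>D q * (u q / w q)\<bar>)" using integrable_abs[OF L2_mult_integrable[OF DL aL]] .
    show "AE q in ?M. (\<lambda>n. D q * u q * ((\<theta> n q)\<^sup>2 / w q)) \<longlonglongrightarrow> D q * u q * (1\<^sup>2 / w q)"
      using AE_wmeas by eventually_elim (intro tendsto_intros \<theta>lim, auto dest: wne)
    fix n
    show "AE q in ?M. norm (D q * u q * ((\<theta> n q)\<^sup>2 / w q)) \<le> \<bar>D q * (u q / w q)\<bar>"
      using AE_wmeas
    proof eventually_elim
      case (elim q)
      have "norm (D q * u q * ((\<theta> n q)\<^sup>2 / w q)) = (\<theta> n q)\<^sup>2 * \<bar>D q * (u q / w q)\<bar>" by (simp add: abs_mult)
      also have "\<dots> \<le> 1 * \<bar>D q * (u q / w q)\<bar>" using \<theta>(3)[OF elim] by (intro mult_right_mono) auto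
      finally show ?case by simp
    qed
  qed measurable
  ultimately have lim: "- (\<integral>q. E 1 q \<partial>?M) \<le> 2 * (\<integral>q. D q * u q * (1\<^sup>2 / w q) \<partial>?M)"
  proof (rule LIMSEQ_le, intro exI allI impI)
    fix n
    show "- (\<integral>q. E (\<theta> n q) q \<partial>?M) \<le> 2 * (\<integral>q. D q * u q * ((\<theta> n q)\<^sup>2 / w q) \<partial>?M)"
      using H1_cutoff_energy[OF _ f vanishing(1,2), of n] s
      by (simp add: E_def u_def D_def \<theta>_def w_def)
  qed
  have E1i: "integrable ?M (\<lambda>q. E 1 q)"
  proof -
    have eq: "AE q in ?M. E 1 q = (2 * (s - 1) + 3) * (u q * (u q / w q)) - 2 * (s - 1) * (norm (u q / w q))\<^sup>2"
      using AE_wmeas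
    proof eventually_elim
      case (elim q)
      then show ?case using wpos[OF elim] by (simp add: E_def power2_eq_square field_simps)
    qed
    have "integrable ?M (\<lambda>q. (2 * (s - 1) + 3) * (u q * (u q / w q)) - 2 * (s - 1) * (norm (u q / w q))\<^sup>2)"
      by (intro Bochner_Integration.integrable_diff integrable_mult_right L2_mult_integrable L2_integrable_square uL aL)
    then show ?thesis by (rule integrable_cong_AE_imp) (use eq in \<open>auto simp: E_def\<close>)
  qed
  have "(\<integral>q. E 1 q \<partial>?M) \<le> (\<integral>q. 2 * gamma_fun s * (norm (u q))\<^sup>2 \<partial>?M)"
  proof (rule integral_mono_AE[OF E1i])
    show "integrable ?M (\<lambda>q. 2 * gamma_fun s * (norm (u q))\<^sup>2)" using L2_integrable_square[OF uL] by simp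
    show "AE q in ?M. E 1 q \<le> 2 * gamma_fun s * (norm (u q))\<^sup>2"
      using AE_wmeas
    proof eventually_elim
      case (elim q)
      define \<sigma> where "\<sigma> = s - 1"
      define x where "x = 1 / w q"
      have \<sigma>: "0 < \<sigma>" using s by (simp add: \<sigma>_def)
      have g: "2 * gamma_fun s = 3 / 2 + \<sigma> / 2 + 9 / (8 * \<sigma>)"
        using \<sigma> by (simp add: gamma_fun_def \<sigma>_def field_simps)
      \<comment> \<open>Completing the square: (3 + 2 \<sigma>) / (4 \<sigma>) maximises the
        quadratic, and its maximum is twice \<open>gamma_fun s\<close>.\<close>
      have "0 \<le> 2 * \<sigma> * (x - (3 + 2 * \<sigma>) / (4 * \<sigma>))\<^sup>2" using \<sigma> by simp
      also have "\<dots> = 2 * gamma_fun s - ((3 + 2 * \<sigma>) * x - 2 * \<sigma> * x\<^sup>2)"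
        unfolding g using \<sigma> by (simp add: field_simps power2_eq_square)
      finally have le: "(3 + 2 * \<sigma>) * x - 2 * \<sigma> * x\<^sup>2 \<le> 2 * gamma_fun s" by simp
      have "E 1 q = (u q)\<^sup>2 * ((3 + 2 * \<sigma>) * x - 2 * \<sigma> * x\<^sup>2)"
        using wpos[OF elim] by (simp add: E_def x_def \<sigma>_def field_simps power2_eq_square)
      then show ?case using mult_left_mono[OF le, of "(u q)\<^sup>2"] by (simp add: mult.commute)
    qed
  qed
  then have "- (2 * gamma_fun s * l2ip ?M u u) \<le> - (\<integral>q. E 1 q \<partial>?M)" by (simp add: l2ip_self)
  also note lim
  also have "(\<integral>q. D q * u q * (1\<^sup>2 / w q) \<partial>?M) = l2ip ?M (hardy_quotient f) (\<lambda>q. q \<bullet> snd (f q))"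
    by (simp add: l2ip_def D_def u_def w_def mult.commute)
  finally show ?thesis by (simp add: u_def[abs_def])
qed

section \<open>The variational problem\<close>

text \<open>The singular factor 1/w is attached to the trial function instead of the test gradient,
  so that both arguments of the last inner product lie in the weighted \<open>L2\<close> by the
  Hardy bound.\<close>

definition bdf2_form :: "real \<Rightarrow> real \<Rightarrow> real \<Rightarrow> real \<Rightarrow> (real^3 \<Rightarrow> real \<times> (real^3)) \<Rightarrow> (real^3 \<Rightarrow> real \<times> (real^3)) \<Rightarrow> real" where
  "bdf2_form b De dt s f g =
     3 / (2 * dt) * l2ip (wmeas s) (\<lambda>q. fst (f q)) (\<lambda>q. fst (g q))
     + 1 / De * l2ip (wmeas s) (\<lambda>q. snd (f q)) (\<lambda>q. snd (g q))
     + (b - 2 * s) / De * l2ip (wmeas s) (hardy_quotient f) (\<lambda>q. q \<bullet> snd (g q))"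

definition bdf2_rhs :: "real \<Rightarrow> real \<Rightarrow> real^3^3 \<Rightarrow> (real^3 \<Rightarrow> real) \<Rightarrow> (real^3 \<Rightarrow> real) \<Rightarrow> (real^3 \<Rightarrow> real \<times> (real^3)) \<Rightarrow> real" where
  "bdf2_rhs dt s K hn hn1 g =
     1 / (2 * dt) * l2ip (wmeas s) (lcomb (\<lambda>q. 4 * hn q) (-1) hn1) (\<lambda>q. fst (g q))
     + l2ip (wmeas s) (lcomb (\<lambda>q. 2 * hn q) (-1) hn1) (\<lambda>q. (K *v q) \<bullet> snd (g q))"

lemma L2_cmult:
  fixes f :: "'a \<Rightarrow> real"
  shows "f \<in> L2 M \<Longrightarrow> (\<lambda>x. c * f x) \<in> L2 M"
  by (rule L2_bound[where C = "\<bar>c\<bar>"]) (auto simp: abs_mult dest: L2_measurable)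

lemma L2_matrix_field:
  fixes K :: "real^3^3"
  shows "\<exists>C\<ge>0. \<forall>s. \<forall>G\<in>L2 (wmeas s). (\<lambda>q. (K *v q) \<bullet> G q) \<in> L2 (wmeas s) \<and>
    l2norm (wmeas s) (\<lambda>q. (K *v q) \<bullet> G q) \<le> C * l2norm (wmeas s) G"
proof -
  obtain C where C: "0 < C" "\<And>q. norm (K *v q) \<le> norm q * C"
    using bounded_linear.pos_bounded[OF matrix_vector_mul_bounded_linear[of K]] by blast
  have c: "continuous_on UNIV (\<lambda>q. K *v q)"
    using matrix_vector_mul_bounded_linear[of K] by (rule linear_continuous_on)
  have n: "norm (K *v q) \<le> C * norm q" for q using C(2)[of q] by (simp add: mult.commute)
  show ?thesis
    using C(1) L2_linear_field[OF _ c n] by (intro exI[of _ C]) (simp add: less_imp_le)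
qed

lemma bdf2_eq_iff:
  assumes s: "1 < s" and h: "(\<lambda>q. (h q, G q)) \<in> H1_space s" and g: "(\<lambda>q. (g q, Gg q)) \<in> H1_space s"
    and hn: "hn \<in> L2 (wmeas s)" "hn1 \<in> L2 (wmeas s)"
  shows "bdf2_eq b De dt s K hn hn1 h G g Gg \<longleftrightarrow>
    bdf2_form b De dt s (\<lambda>q. (h q, G q)) (\<lambda>q. (g q, Gg q)) = bdf2_rhs dt s K hn hn1 (\<lambda>q. (g q, Gg q))"
proof -
  let ?M = "wmeas s"
  have hL: "h \<in> L2 ?M" "G \<in> L2 ?M" and gL: "g \<in> L2 ?M" "Gg \<in> L2 ?M"
    using h g by (auto simp: H1_space_def L2_Pair_iff)
  have KL: "(\<lambda>q. (K *v q) \<bullet> Gg q) \<in> L2 ?M" using L2_matrix_field[of K] gL(2) by blast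
  have rL: "(\<lambda>q. q \<bullet> Gg q) \<in> L2 ?M" by (rule L2_radial(1)[OF gL(2)])
  have [measurable]: "h \<in> borel_measurable lebesgue" "G \<in> borel_measurable lebesgue"
    "g \<in> borel_measurable lebesgue" "Gg \<in> borel_measurable lebesgue"
    "hn \<in> borel_measurable lebesgue" "hn1 \<in> borel_measurable lebesgue"
    "(\<lambda>q. (K *v q) \<bullet> Gg q) \<in> borel_measurable lebesgue"
    using hL gL hn KL by (auto dest: L2_measurable)
  have p: "lcomb (\<lambda>q. 4 * hn q) (-1) hn1 \<in> L2 ?M" by (intro lcomb_in_L2 L2_cmult hn)
  have "(\<lambda>q. 3 * h q - 4 * hn q + hn1 q) = lcomb (\<lambda>q. 3 * h q) (-1) (lcomb (\<lambda>q. 4 * hn q) (-1) hn1)"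
    by (simp add: lcomb_def fun_eq_iff)
  moreover have "l2ip ?M (\<lambda>q. 3 * h q) g = 3 * l2ip ?M h g" by (simp add: l2ip_def mult.assoc)
  moreover have "winner s (\<lambda>q. 3 * h q - 4 * hn q + hn1 q) g = l2ip ?M (\<lambda>q. 3 * h q - 4 * hn q + hn1 q) g"
    by (rule winner_eq) measurable
  ultimately have 1: "winner s (\<lambda>q. 3 * h q - 4 * hn q + hn1 q) g = 3 * l2ip ?M h g - l2ip ?M (lcomb (\<lambda>q. 4 * hn q) (-1) hn1) g"
    using l2ip_lcomb[OF L2_cmult[OF hL(1), of 3] p gL(1), of "-1"] by simp
  have 2: "winnerv s G Gg = l2ip ?M G Gg" by (rule winnerv_eq) measurable
  have 3: "winner s h (\<lambda>q. (q \<bullet> Gg q) / (1 - (norm q)\<^sup>2)) = l2ip ?M (\<lambda>q. h q / (1 - (norm q)\<^sup>2)) (\<lambda>q. q \<bullet> Gg q)"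
    by (subst winner_eq) (simp_all add: l2ip_def)
  have 4: "winner s (\<lambda>q. 2 * hn q - hn1 q) (\<lambda>q. (K *v q) \<bullet> Gg q)
      = l2ip ?M (lcomb (\<lambda>q. 2 * hn q) (-1) hn1) (\<lambda>q. (K *v q) \<bullet> Gg q)"
    by (subst winner_eq) (simp_all add: lcomb_def)
  show ?thesis
    unfolding bdf2_eq_def bdf2_form_def bdf2_rhs_def 1 2 3 4 fst_conv snd_conv
    by (simp add: right_diff_distrib) linarith
qed

lemma bdf2_form_lcomb:
  assumes s: "1 < s" and "f \<in> H1_space s" "f' \<in> H1_space s" "g \<in> H1_space s"
  shows "bdf2_form b De dt s (lcomb f c f') g = bdf2_form b De dt s f g + c * bdf2_form b De dt s f' g"
    and "bdf2_form b De dt s g (lcomb f c f') = bdf2_form b De dt s g f + c * bdf2_form b De dt s g f'"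
proof -
  have L: "f \<in> L2 (wmeas s)" "f' \<in> L2 (wmeas s)" "g \<in> L2 (wmeas s)"
    using assms by (auto simp: H1_space_def)
  have eqs: "(\<lambda>q. fst (lcomb f c f' q)) = lcomb (\<lambda>q. fst (f q)) c (\<lambda>q. fst (f' q))"
    "(\<lambda>q. snd (lcomb f c f' q)) = lcomb (\<lambda>q. snd (f q)) c (\<lambda>q. snd (f' q))"
    "hardy_quotient (lcomb f c f') = lcomb (hardy_quotient f) c (hardy_quotient f')"
    "(\<lambda>q. q \<bullet> snd (lcomb f c f' q)) = lcomb (\<lambda>q. q \<bullet> snd (f q)) c (\<lambda>q. q \<bullet> snd (f' q))"
    by (simp_all add: lcomb_def fun_eq_iff add_divide_distrib inner_add_right)
  note A = L2_fst_snd[OF L(1)] L2_fst_snd[OF L(2)] L2_fst_snd[OF L(3)]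
    hardy_inequality(1)[OF s assms(2)] hardy_inequality(1)[OF s assms(3)] hardy_inequality(1)[OF s assms(4)]
    L2_radial(1)[OF L2_fst_snd(2)[OF L(1)]] L2_radial(1)[OF L2_fst_snd(2)[OF L(2)]] L2_radial(1)[OF L2_fst_snd(2)[OF L(3)]]
  show "bdf2_form b De dt s (lcomb f c f') g = bdf2_form b De dt s f g + c * bdf2_form b De dt s f' g"
    unfolding bdf2_form_def eqs by (simp add: A l2ip_lcomb algebra_simps)
  show "bdf2_form b De dt s g (lcomb f c f') = bdf2_form b De dt s g f + c * bdf2_form b De dt s g f'"
    unfolding bdf2_form_def eqs by (simp add: A L2.ip_comb_right algebra_simps)
qed

lemma abs_triangle3: "\<bar>x + y + z\<bar> \<le> \<bar>x\<bar> + \<bar>y\<bar> + \<bar>z\<bar>" for x y z :: real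
  by linarith

lemma bdf2_form_bounded:
  assumes s: "1 < s" and f: "f \<in> H1_space s" and g: "g \<in> H1_space s"
  shows "\<bar>bdf2_form b De dt s f g\<bar>
    \<le> (\<bar>3 / (2 * dt)\<bar> + \<bar>1 / De\<bar> + \<bar>(b - 2 * s) / De\<bar> * ((2 * s + 3) / (2 * (s - 1))))
      * (l2norm (wmeas s) f * l2norm (wmeas s) g)"
proof -
  let ?M = "wmeas s"
  let ?H = "(2 * s + 3) / (2 * (s - 1))"
  have L: "f \<in> L2 ?M" "g \<in> L2 ?M" using f g by (auto simp: H1_space_def)
  note f' = L2_fst_snd[OF L(1)] and g' = L2_fst_snd[OF L(2)]
  have H: "0 \<le> ?H" using s by simp
  have hq: "l2norm ?M (hardy_quotient f) \<le> ?H * l2norm ?M f"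
  proof (rule power2_le_imp_le)
    show "(l2norm ?M (hardy_quotient f))\<^sup>2 \<le> (?H * l2norm ?M f)\<^sup>2"
      unfolding power_mult_distrib l2norm_square by (rule hardy_inequality(2)[OF s f])
  qed (intro mult_nonneg_nonneg H l2norm_nonneg)
  have 1: "\<bar>l2ip ?M (\<lambda>q. fst (f q)) (\<lambda>q. fst (g q))\<bar> \<le> l2norm ?M f * l2norm ?M g"
    by (rule order_trans[OF l2ip_le_norm[OF f'(1) g'(1)]])
      (intro mult_mono l2norm_fst_snd_le L l2norm_nonneg)
  have 2: "\<bar>l2ip ?M (\<lambda>q. snd (f q)) (\<lambda>q. snd (g q))\<bar> \<le> l2norm ?M f * l2norm ?M g"
    by (rule order_trans[OF l2ip_le_norm[OF f'(2) g'(2)]])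
      (intro mult_mono l2norm_fst_snd_le L l2norm_nonneg)
  have "l2norm ?M (\<lambda>q. q \<bullet> snd (g q)) \<le> l2norm ?M g"
    using L2_radial(2)[OF g'(2)] l2norm_fst_snd_le(2)[OF L(2)] by (rule order_trans)
  then have "l2norm ?M (hardy_quotient f) * l2norm ?M (\<lambda>q. q \<bullet> snd (g q)) \<le> (?H * l2norm ?M f) * l2norm ?M g"
    by (intro mult_mono hq mult_nonneg_nonneg H l2norm_nonneg)
  then have 3: "\<bar>l2ip ?M (hardy_quotient f) (\<lambda>q. q \<bullet> snd (g q))\<bar> \<le> ?H * (l2norm ?M f * l2norm ?M g)"
    unfolding mult.assoc
    by (rule order_trans[OF l2ip_le_norm[OF hardy_inequality(1)[OF s f] L2_radial(1)[OF g'(2)]]])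
  have "\<bar>bdf2_form b De dt s f g\<bar> \<le> \<bar>3 / (2 * dt)\<bar> * \<bar>l2ip ?M (\<lambda>q. fst (f q)) (\<lambda>q. fst (g q))\<bar>
      + \<bar>1 / De\<bar> * \<bar>l2ip ?M (\<lambda>q. snd (f q)) (\<lambda>q. snd (g q))\<bar>
      + \<bar>(b - 2 * s) / De\<bar> * \<bar>l2ip ?M (hardy_quotient f) (\<lambda>q. q \<bullet> snd (g q))\<bar>"
    unfolding bdf2_form_def abs_mult[symmetric] by (rule abs_triangle3)
  also have "\<dots> \<le> \<bar>3 / (2 * dt)\<bar> * (l2norm ?M f * l2norm ?M g) + \<bar>1 / De\<bar> * (l2norm ?M f * l2norm ?M g)
      + \<bar>(b - 2 * s) / De\<bar> * (?H * (l2norm ?M f * l2norm ?M g))"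
    by (intro add_mono mult_left_mono 1 2 3 abs_ge_zero)
  finally show ?thesis by (simp only: distrib_right mult.assoc)
qed

text \<open>The convection term is bounded below by the zero-order norm alone, so the gradient keeps
  its full coefficient 1/De and the zero-order part keeps \<open>\<mu>\<close>. For s = b/2 the
  convection coefficient is 0 and \<open>\<mu>\<close> reduces to 3 / (2 dt).\<close>

lemma bdf2_form_coercive:
  assumes "De > 0" "dt > 0" and s: "1 < s" "s \<le> b / 2"
    and cond: "s < b / 2 \<Longrightarrow> 3 / (2 * dt) > (b - 2 * s) / De * gamma_fun s"
  shows "\<exists>\<alpha>>0. \<forall>f\<in>H1_space s. \<alpha> * l2ip (wmeas s) f f \<le> bdf2_form b De dt s f f"
proof -
  let ?M = "wmeas s"
  define \<mu> where "\<mu> = 3 / (2 * dt) - (b - 2 * s) / De * gamma_fun s"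
  have \<mu>: "0 < \<mu>"
  proof (cases "s < b / 2")
    case True then show ?thesis using cond by (simp add: \<mu>_def)
  next
    case False
    then have "b - 2 * s = 0" using s by simp
    then show ?thesis using assms(2) by (simp add: \<mu>_def)
  qed
  show ?thesis
  proof (intro exI[of _ "min \<mu> (1 / De)"] conjI ballI)
    show "0 < min \<mu> (1 / De)" using \<mu> assms(1) by simp
    fix f assume f: "f \<in> H1_space s"
    then have L: "f \<in> L2 ?M" by (simp add: H1_space_def)
    define U where "U = l2ip ?M (\<lambda>q. fst (f q)) (\<lambda>q. fst (f q))"
    define V where "V = l2ip ?M (\<lambda>q. snd (f q)) (\<lambda>q. snd (f q))"
    have UV: "0 \<le> U" "0 \<le> V" by (auto simp: U_def V_def l2ip_self_nonneg)
    have ff: "l2ip ?M f f = U + V"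
      using l2ip_Pair[OF L2_fst_snd(1)[OF L] L2_fst_snd(1)[OF L] L2_fst_snd(2)[OF L] L2_fst_snd(2)[OF L]]
      by (simp add: U_def V_def)
    have c: "0 \<le> (b - 2 * s) / De" using s assms(1) by simp
    have "min \<mu> (1 / De) * l2ip ?M f f = min \<mu> (1 / De) * U + min \<mu> (1 / De) * V" by (simp add: ff distrib_left)
    also have "\<dots> \<le> \<mu> * U + 1 / De * V" using UV by (intro add_mono mult_right_mono) auto
    also have "\<dots> = 3 / (2 * dt) * U + 1 / De * V + (b - 2 * s) / De * (- gamma_fun s * U)"
      by (simp add: \<mu>_def left_diff_distrib)
    also have "\<dots> \<le> bdf2_form b De dt s f f"
      unfolding bdf2_form_def U_def[symmetric] V_def[symmetric]
      using mult_left_mono[OF convection_lower_bound[OF s(1) f] c] by (simp add: U_def)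
    finally show "min \<mu> (1 / De) * l2ip ?M f f \<le> bdf2_form b De dt s f f" .
  qed
qed

lemma bdf2_rhs_lcomb:
  assumes "hn \<in> L2 (wmeas s)" "hn1 \<in> L2 (wmeas s)" and "f \<in> L2 (wmeas s)" "f' \<in> L2 (wmeas s)"
  shows "bdf2_rhs dt s K hn hn1 (lcomb f c f') = bdf2_rhs dt s K hn hn1 f + c * bdf2_rhs dt s K hn hn1 f'"
proof -
  have KL: "(\<lambda>q. (K *v q) \<bullet> G q) \<in> L2 (wmeas s)" if "G \<in> L2 (wmeas s)" for G
    using L2_matrix_field[of K] that by blast
  have eqs: "(\<lambda>q. fst (lcomb f c f' q)) = lcomb (\<lambda>q. fst (f q)) c (\<lambda>q. fst (f' q))"
    "(\<lambda>q. (K *v q) \<bullet> snd (lcomb f c f' q)) = lcomb (\<lambda>q. (K *v q) \<bullet> snd (f q)) c (\<lambda>q. (K *v q) \<bullet> snd (f' q))"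
    by (simp_all add: lcomb_def fun_eq_iff inner_add_right)
  note A = L2_fst_snd[OF assms(3)] L2_fst_snd[OF assms(4)] KL[OF L2_fst_snd(2)[OF assms(3)]] KL[OF L2_fst_snd(2)[OF assms(4)]]
  define p where "p = lcomb (\<lambda>q. 4 * hn q) (-1) hn1"
  define r where "r = lcomb (\<lambda>q. 2 * hn q) (-1) hn1"
  have pr: "p \<in> L2 (wmeas s)" "r \<in> L2 (wmeas s)" unfolding p_def r_def by (intro lcomb_in_L2 L2_cmult assms)+
  show ?thesis
    unfolding bdf2_rhs_def eqs p_def[symmetric] r_def[symmetric]
    by (simp add: A pr L2.ip_comb_right algebra_simps add_divide_distrib)
qed

lemma bdf2_rhs_bounded:
  assumes "hn \<in> L2 (wmeas s)" "hn1 \<in> L2 (wmeas s)"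
  shows "\<exists>B. \<forall>f\<in>L2 (wmeas s). \<bar>bdf2_rhs dt s K hn hn1 f\<bar> \<le> B * l2norm (wmeas s) f"
proof -
  let ?M = "wmeas s"
  obtain C where C: "0 \<le> C" and CK: "\<forall>s. \<forall>G\<in>L2 (wmeas s). (\<lambda>q. (K *v q) \<bullet> G q) \<in> L2 (wmeas s) \<and>
      l2norm (wmeas s) (\<lambda>q. (K *v q) \<bullet> G q) \<le> C * l2norm (wmeas s) G"
    using L2_matrix_field[of K] by blast
  have KL: "(\<lambda>q. (K *v q) \<bullet> G q) \<in> L2 ?M" and Kn: "l2norm ?M (\<lambda>q. (K *v q) \<bullet> G q) \<le> C * l2norm ?M G"
    if "G \<in> L2 ?M" for G using CK that by auto
  define p where "p = lcomb (\<lambda>q. 4 * hn q) (-1) hn1"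
  define r where "r = lcomb (\<lambda>q. 2 * hn q) (-1) hn1"
  have p: "p \<in> L2 ?M" and r: "r \<in> L2 ?M" unfolding p_def r_def by (intro lcomb_in_L2 L2_cmult assms)+
  have "\<bar>bdf2_rhs dt s K hn hn1 f\<bar> \<le> (\<bar>1 / (2 * dt)\<bar> * l2norm ?M p + l2norm ?M r * C) * l2norm ?M f" if f: "f \<in> L2 ?M" for f
  proof -
    note f' = L2_fst_snd[OF f]
    have 1: "\<bar>l2ip ?M p (\<lambda>q. fst (f q))\<bar> \<le> l2norm ?M p * l2norm ?M f"
      by (rule order_trans[OF l2ip_le_norm[OF p f'(1)]]) (intro mult_left_mono l2norm_fst_snd_le f l2norm_nonneg)
    have "l2norm ?M (\<lambda>q. (K *v q) \<bullet> snd (f q)) \<le> C * l2norm ?M f"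
      using Kn[OF f'(2)] mult_left_mono[OF l2norm_fst_snd_le(2)[OF f] C] by (rule order_trans)
    then have 2: "\<bar>l2ip ?M r (\<lambda>q. (K *v q) \<bullet> snd (f q))\<bar> \<le> l2norm ?M r * (C * l2norm ?M f)"
      using l2ip_le_norm[OF r KL[OF f'(2)]] mult_left_mono[OF _ l2norm_nonneg] by (meson order_trans)
    have "\<bar>bdf2_rhs dt s K hn hn1 f\<bar> \<le> \<bar>1 / (2 * dt)\<bar> * \<bar>l2ip ?M p (\<lambda>q. fst (f q))\<bar> + \<bar>l2ip ?M r (\<lambda>q. (K *v q) \<bullet> snd (f q))\<bar>"
      unfolding bdf2_rhs_def p_def[symmetric] r_def[symmetric] abs_mult[symmetric] by (rule abs_triangle_ineq)
    also have "\<dots> \<le> \<bar>1 / (2 * dt)\<bar> * (l2norm ?M p * l2norm ?M f) + l2norm ?M r * (C * l2norm ?M f)"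
      by (intro add_mono mult_left_mono 1 2 abs_ge_zero)
    finally show ?thesis by (simp only: distrib_right mult.assoc)
  qed
  then show ?thesis by blast
qed

text \<open>The density is positive inside the unit ball, and the sphere, where it vanishes, is a
  null set.\<close>

lemma AE_Omega_eq:
  assumes "AE q in wmeas s. u q = v q"
  shows "AE q in lebesgue. q \<in> Omega \<longrightarrow> u q = v q"
proof -
  have "AE q in lebesgue. 0 < wdens s q \<longrightarrow> u q = v q"
    using assms unfolding wmeas_def by (subst (asm) AE_density) auto
  moreover have "AE q in lebesgue. q \<notin> sphere (0::real^3) 1"
    using negligible_sphere[of "0::real^3" 1] by (intro AE_not_in) (simp add: negligible_iff_null_sets)
  ultimately show ?thesis
    by eventually_elim (auto simp: Omega_def wdens_eq wt_pos)
qed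

theorem mainTheorem1:
  fixes b De dt s :: real and K :: "real^3^3" and hn hn1 :: "real^3 \<Rightarrow> real"
  assumes "b > 0" and "De > 0" and "trace K = 0" and "dt > 0"
    and "1 < s" and "s \<le> b / 2"
    and "s < b / 2 \<Longrightarrow> 3 / (2 * dt) > (b - 2 * s) / De * gamma_fun s"
    and "L2w s hn" and "L2w s hn1"
  shows "\<exists>h G. H1w s h G \<and> (\<forall>g Gg. H1w s g Gg \<longrightarrow> bdf2_eq b De dt s K hn hn1 h G g Gg)
           \<and> (\<forall>h' G'. H1w s h' G' \<and> (\<forall>g Gg. H1w s g Gg \<longrightarrow> bdf2_eq b De dt s K hn hn1 h' G' g Gg)
                 \<longrightarrow> (AE q in lebesgue. q \<in> Omega \<longrightarrow> h' q = h q))"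
proof -
  let ?M = "wmeas s" and ?a = "bdf2_form b De dt s" and ?F = "bdf2_rhs dt s K hn hn1"
  note s = \<open>1 < s\<close>
  have hn: "hn \<in> L2 ?M" "hn1 \<in> L2 ?M" using assms(8,9) by (simp_all add: L2w_iff)
  interpret H: semi_hilbert "H1_space s" lcomb "l2ip ?M" using s by (intro semi_hilbert_H1) simp
  have sub: "f \<in> L2 ?M" if "f \<in> H1_space s" for f using that by (simp add: H1_space_def)
  obtain \<alpha> where \<alpha>: "0 < \<alpha>" and coer: "\<And>f. f \<in> H1_space s \<Longrightarrow> \<alpha> * l2ip ?M f f \<le> ?a f f"
    using bdf2_form_coercive[OF assms(2,4,5,6,7)] by blast
  obtain B where B: "\<And>f. f \<in> L2 ?M \<Longrightarrow> \<bar>?F f\<bar> \<le> B * l2norm ?M f"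
    using bdf2_rhs_bounded[OF hn] by blast
  define C where "C = \<bar>3 / (2 * dt)\<bar> + \<bar>1 / De\<bar> + \<bar>(b - 2 * s) / De\<bar> * ((2 * s + 3) / (2 * (s - 1)))"
  have "\<exists>f\<in>H1_space s. \<forall>g\<in>H1_space s. ?a f g = ?F g"
  proof (rule H.lax_milgram[where a = ?a and F = ?F and C = "C\<^sup>2" and D = "B\<^sup>2" and \<alpha> = \<alpha>])
    fix x y assume xy: "x \<in> H1_space s" "y \<in> H1_space s"
    have "\<bar>?a x y\<bar>\<^sup>2 \<le> (C * (l2norm ?M x * l2norm ?M y))\<^sup>2"
      using bdf2_form_bounded[OF s xy, of b De dt] unfolding C_def by (rule power_mono) simp
    then show "(?a x y)\<^sup>2 \<le> C\<^sup>2 * l2ip ?M x x * l2ip ?M y y"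
      by (simp add: power_mult_distrib l2norm_square mult.assoc)
    show "?F (lcomb x c y) = ?F x + c * ?F y" for c using xy by (intro bdf2_rhs_lcomb hn sub)
  next
    fix x assume x: "x \<in> H1_space s"
    have "\<bar>?F x\<bar>\<^sup>2 \<le> (B * l2norm ?M x)\<^sup>2" using B[OF sub[OF x]] by (rule power_mono) simp
    then show "(?F x)\<^sup>2 \<le> B\<^sup>2 * l2ip ?M x x" by (simp add: power_mult_distrib l2norm_square)
  qed (use coer \<alpha> in \<open>auto simp: bdf2_form_lcomb[OF s]\<close>)
  then obtain f where f: "f \<in> H1_space s" and sol: "\<And>g. g \<in> H1_space s \<Longrightarrow> ?a f g = ?F g" by blast
  define h where "h q = fst (f q)" for q
  define G where "G q = snd (f q)" for q
  have hG: "(\<lambda>q. (h q, G q)) = f" by (simp add: h_def G_def)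
  have H1: "(\<lambda>q. (h q, G q)) \<in> H1_space s" using f by (simp add: hG)
  have eq: "bdf2_eq b De dt s K hn hn1 h G g Gg" if "H1w s g Gg" for g Gg
    using that sol unfolding H1w_iff bdf2_eq_iff[OF s H1 _ hn] hG by (simp add: bdf2_eq_iff[OF s H1 _ hn] hG)
  moreover have "AE q in lebesgue. q \<in> Omega \<longrightarrow> h' q = h q"
    if h': "H1w s h' G'" "\<And>g Gg. H1w s g Gg \<Longrightarrow> bdf2_eq b De dt s K hn hn1 h' G' g Gg" for h' G'
  proof -
    define f' where "f' = (\<lambda>q. (h' q, G' q))"
    have f': "f' \<in> H1_space s" using h'(1) by (simp add: H1w_iff f'_def)
    have sol': "?a f' g = ?F g" if g: "g \<in> H1_space s" for g
    proof -
      have "H1w s (\<lambda>q. fst (g q)) (\<lambda>q. snd (g q))" using g by (simp add: H1w_iff)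
      from h'(2)[OF this] show ?thesis
        using bdf2_eq_iff[OF s f'[unfolded f'_def] _ hn, of "\<lambda>q. fst (g q)" "\<lambda>q. snd (g q)"] g by (simp add: f'_def)
    qed
    \<comment> \<open>The difference of two solutions is itself an admissible test element. The form
      vanishes on it, and coercivity makes its norm 0, which is uniqueness up to null sets.\<close>
    define d where "d = lcomb f' (-1) f"
    have d: "d \<in> H1_space s" unfolding d_def by (intro H.comb_in f f')
    have "?a d d = 0"
      using bdf2_form_lcomb(1)[OF s f' f d, of b De dt "-1"] sol[OF d] sol'[OF d] by (simp add: d_def)
    then have "l2ip ?M d d = 0" using coer[OF d] \<alpha> l2ip_self_nonneg[of ?M d]
      by (metis mult_le_0_iff order_antisym_conv not_le)
    then have "AE q in ?M. (norm (d q))\<^sup>2 = 0"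
      unfolding l2ip_self
      by (subst (asm) integral_nonneg_eq_0_iff_AE) (use L2_integrable_square[OF sub[OF d]] in auto)
    then have "AE q in ?M. h' q = h q"
      by eventually_elim (auto simp: d_def lcomb_def f'_def h_def prod_eq_iff)
    then show ?thesis by (rule AE_Omega_eq)
  qed
  ultimately show ?thesis using H1 unfolding H1w_iff[symmetric] by blast
qed

end
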